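(* Let $p_{\xi}(n)$ be defined by $\sum_{n\ge 0} p_{\xi}(n)q^n=\xi(q)$. Then, as identities of $q$-series, $$2\sum_{n=0}^{\infty} p_{\xi}(2n+1)q^{n+1} = \frac{f_{6}^6f_{12}}{f_3^4f_{24}^2} - f(q^{12}) +4q\frac{f_2^2f_{8}^2}{f_1f_3f_4}$$ and $$\sum_{n=0}^{\infty} p_{\xi}(2n)q^{n} = q\frac{f_{6}^8f_{24}^2}{f_3^4f_{12}^5} - q^4\omega(-q^{6}) + \frac{f_4^5}{f_1f_3f_{8}^2}.$$
   Context: For $|q|<1$, $(a;q)_0=1$, $(a;q)_n=(1-a)(1-aq)\cdots(1-aq^{n-1})$, $(a;q)_\infty=\lim_{n\to\infty}(a;q)_n$, and $f_k:=(q^k;q^k)_\infty$. The Gordon–McIntosh third order mock theta function is $\xi(q)=1+2\sum_{n\ge1}\frac{q^{6n^2-6n+1}}{(q;q^6)_n(q^5;q^6)_n}$, and $p_\xi(n)$ denotes its $n$-th coefficient. The third order mock theta functions $\omega$ and $f$ are $\omega(q)=\sum_{n\ge0}\frac{q^{2n(n+1)}}{(q;q^2)_{n+1}^2}$ and $f(q)=\sum_{n\ge0}\frac{q^{n^2}}{(-q;q)_n^2}$. *)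

theory Defs
  imports "HOL-Complex_Analysis.Complex_Analysis"
begin

definition qpoch :: "complex \<Rightarrow> complex \<Rightarrow> nat \<Rightarrow> complex" where
  "qpoch a q n = (\<Prod>k<n. 1 - a * q ^ k)"

definition qpoch_inf :: "complex \<Rightarrow> complex \<Rightarrow> complex" where
  "qpoch_inf a q = lim (\<lambda>n. qpoch a q n)"

text \<open>\<open>ff k q\<close> is the Euler product usually written $f_k$; it is unrelated to the
  mock theta function \<open>mock_f\<close>.\<close>

definition ff :: "nat \<Rightarrow> complex \<Rightarrow> complex" where
  "ff k q = qpoch_inf (q ^ k) (q ^ k)"

definition mock_omega :: "complex \<Rightarrow> complex" where
  "mock_omega q = (\<Sum>n. q ^ (2 * n * (n + 1)) / (qpoch q (q ^ 2) (n + 1)) ^ 2)"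

definition mock_f :: "complex \<Rightarrow> complex" where
  "mock_f q = (\<Sum>n. q ^ (n ^ 2) / (qpoch (- q) q n) ^ 2)"

text \<open>The sum over $n \ge 1$ is shifted to start at $0$. The natural-number subtraction in the
  exponent does not truncate, as $6n \le 6n^2$.\<close>

definition mock_xi :: "complex \<Rightarrow> complex" where
  "mock_xi q = 1 + 2 * (\<Sum>m. let n = Suc m in
     q ^ (6 * n ^ 2 - 6 * n + 1) / (qpoch q (q ^ 6) n * qpoch (q ^ 5) (q ^ 6) n))"

definition p_xi :: "nat \<Rightarrow> complex" where
  "p_xi n = fps_nth (fps_expansion mock_xi 0) n"

end

theory Submission
  imports Defs
begin

text \<open>
  With \<open>g\<^sub>3(x, q) = \<Sum> q\<^bsup>n(n+1)\<^esup> / ((x;q)\<^sub>n\<^sub>+\<^sub>1 (q/x;q)\<^sub>n\<^sub>+\<^sub>1)\<close> one has \<open>\<xi>(q) = 1 + 2q g\<^sub>3(q, q\<^sup>6)\<close>,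
  \<open>\<omega>(q) = g\<^sub>3(q, q\<^sup>2)\<close> and \<open>f(q) = 2 - 2 g\<^sub>3(-1, q)\<close>, and \<open>g\<^sub>3\<close> is a bilateral
  Appell--Lerch series. Everything rests on the partial fraction expansion of the reciprocal theta
  function, \<open>\<Sum> (-1)\<^sup>n q\<^bsup>n(n+1)\<^esup> / (1 - x q\<^sup>2\<^sup>n) = (q\<^sup>2;q\<^sup>2)\<^sup>2 / j(x;q\<^sup>2)\<close>.

  At \<open>x = q\<close> the residues of \<open>n\<close> modulo 3 give \<open>\<xi>(q) = q\<^sup>2 \<omega>(q\<^sup>3) + f\<^sub>2\<^sup>4 / (f\<^sub>1\<^sup>2 f\<^sub>6)\<close>. Multiplying two such
  expansions gives Watson's relation
  \<open>f(q\<^sup>8) + 2q \<omega>(q) + 2q\<^sup>3 \<omega>(-q\<^sup>4) = f\<^sub>2 f\<^sub>4\<^sup>6 / (f\<^sub>1\<^sup>2 f\<^sub>8\<^sup>4)\<close>. In both relations the even and odd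
  parts of the theta quotient are those of \<open>1 / f\<^sub>1\<^sup>2\<close>, so the even and odd parts of \<open>\<omega>\<close>, and hence of
  \<open>\<xi>\<close>, can be read off.
\<close>

section \<open>q-Pochhammer symbols\<close>

text \<open>The identities are proved pointwise at complex \<open>q\<close> with
  \<open>0 < norm q < 1\<close>, without residue calculus: finite q-binomial identities are shown by
  induction and carried to bilateral series by dominated convergence. Taking \<open>q ^ 2\<close> as
  base keeps all exponents integral, so \<open>q powi k\<close> with integer \<open>k\<close>
  suffices. In Watson's relation the partner of \<open>1 / j(q; q^2)\<close> is
  \<open>1 / j(-1; q^4)\<close> because its poles, combined with those of the first factor, leave
  denominators \<open>1 + q powi (4 * n + 2)\<close>. These factor over \<open>\<i>\<close> and
  \<open>- \<i>\<close>, and the resulting powers of \<open>\<i>\<close> separate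
  \<open>f(q^8)\<close> (even index) from \<open>omega(-q^4)\<close> (odd index). Apart from
  \<open>1 / f_1^2\<close>, the theta quotients of both relations contain only \<open>f_k\<close>
  with even \<open>k\<close> and are even in \<open>q\<close>, so one dissection of
  \<open>1 / f_1^2\<close> serves both. As \<open>p_xi\<close> is defined by Taylor coefficients, xi
  has to be shown holomorphic. Its even and odd parts are series in \<open>q ^ 2\<close>, so the
  theorem is obtained at a square root of \<open>q\<close>.\<close>

lemma qpoch_0 [simp]: "qpoch a q 0 = 1"
  by (simp add: qpoch_def)

lemma qpoch_Suc: "qpoch a q (Suc n) = qpoch a q n * (1 - a * q ^ n)"
  by (simp add: qpoch_def)

lemma qpoch_Suc_left: "qpoch a q (Suc n) = (1 - a) * qpoch (a * q) q n"
  unfolding qpoch_def prod.lessThan_Suc_shift by (simp add: o_def mult.assoc)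

lemma qpoch_eq_0_iff: "qpoch a q n = 0 \<longleftrightarrow> (\<exists>k<n. a * q ^ k = 1)"
  by (auto simp: qpoch_def prod_zero_iff)

lemma qpoch_add: "qpoch a q (m + n) = qpoch a q m * qpoch (a * q ^ m) q n"
  by (induction n) (simp_all add: qpoch_Suc power_add mult.assoc)

lemma convergent_prod_qpoch:
  fixes a q :: complex
  assumes "norm q < 1"
  shows "convergent_prod (\<lambda>k. 1 - a * q ^ k)"
proof -
  have "summable (\<lambda>k. norm a * norm q ^ k)"
    using assms by (intro summable_mult summable_geometric) auto
  hence "abs_convergent_prod (\<lambda>k. 1 - a * q ^ k)"
    unfolding abs_convergent_prod_conv_summable by (simp add: norm_mult norm_power)
  thus ?thesis
    by (rule abs_convergent_prod_imp_convergent_prod)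
qed

lemma qpoch_tendsto_prodinf:
  assumes "norm q < 1"
  shows "qpoch a q \<longlonglongrightarrow> prodinf (\<lambda>k. 1 - a * q ^ k)"
proof -
  have "(\<lambda>n. \<Prod>k\<le>n. 1 - a * q ^ k) \<longlonglongrightarrow> prodinf (\<lambda>k. 1 - a * q ^ k)"
    by (rule convergent_prod_LIMSEQ[OF convergent_prod_qpoch[OF assms]])
  hence "(\<lambda>n. qpoch a q (Suc n)) \<longlonglongrightarrow> prodinf (\<lambda>k. 1 - a * q ^ k)"
    by (simp add: qpoch_def lessThan_Suc_atMost)
  thus ?thesis
    by (rule LIMSEQ_imp_Suc)
qed

lemma qpoch_inf_eq_prodinf:
  assumes "norm q < 1"
  shows "qpoch_inf a q = prodinf (\<lambda>k. 1 - a * q ^ k)"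
  unfolding qpoch_inf_def using qpoch_tendsto_prodinf[OF assms] by (rule limI)

lemma qpoch_tendsto: "norm q < 1 \<Longrightarrow> qpoch a q \<longlonglongrightarrow> qpoch_inf a q"
  using qpoch_tendsto_prodinf qpoch_inf_eq_prodinf by simp

lemma qpoch_inf_unique: "norm q < 1 \<Longrightarrow> qpoch a q \<longlonglongrightarrow> L \<Longrightarrow> qpoch_inf a q = L"
  by (rule LIMSEQ_unique[OF qpoch_tendsto])

lemma qpoch_inf_nonzero:
  assumes "norm q < 1" "\<And>k. a * q ^ k \<noteq> 1"
  shows "qpoch_inf a q \<noteq> 0"
  unfolding qpoch_inf_eq_prodinf[OF assms(1)]
  by (rule prodinf_nonzero[OF convergent_prod_qpoch[OF assms(1)]]) (use assms(2) in auto)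

lemma power_mult_neq_1:
  fixes a q :: complex
  assumes "norm q < 1" "norm a < 1"
  shows "a * q ^ k \<noteq> 1"
proof
  assume "a * q ^ k = 1"
  hence "norm a * norm q ^ k = 1"
    by (metis norm_mult norm_one norm_power)
  moreover have "norm a * norm q ^ k \<le> norm a * 1"
    using assms by (intro mult_left_mono power_le_one) auto
  ultimately show False
    using assms by simp
qed

lemma qpoch_nonzero: "norm q < 1 \<Longrightarrow> norm a < 1 \<Longrightarrow> qpoch a q n \<noteq> 0"
  using power_mult_neq_1 by (auto simp: qpoch_eq_0_iff)

lemma qpoch_inf_head:
  assumes "norm q < 1"
  shows "qpoch_inf a q = (1 - a) * qpoch_inf (a * q) q"
proof (rule qpoch_inf_unique[OF assms LIMSEQ_imp_Suc])
  show "(\<lambda>n. qpoch a q (Suc n)) \<longlonglongrightarrow> (1 - a) * qpoch_inf (a * q) q"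
    unfolding qpoch_Suc_left by (intro tendsto_intros qpoch_tendsto assms)
qed

lemma norm_power_less_1: "norm (q :: complex) < 1 \<Longrightarrow> n > 0 \<Longrightarrow> norm (q ^ n) < 1"
  by (metis norm_ge_zero norm_power power_less_one_iff)

lemma qpoch_inf_even_odd:
  assumes "norm q < 1"
  shows "qpoch_inf a q = qpoch_inf a (q\<^sup>2) * qpoch_inf (a * q) (q\<^sup>2)"
proof -
  have q2: "norm (q\<^sup>2) < 1"
    using assms by (intro norm_power_less_1) auto
  have *: "qpoch a q (2 * n) = qpoch a (q\<^sup>2) n * qpoch (a * q) (q\<^sup>2) n" for n
  proof (induction n)
    case (Suc n)
    have "(q\<^sup>2) ^ n = (q ^ n)\<^sup>2"
      by (simp add: power_even_eq flip: power_mult)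
    with Suc show ?case
      by (simp add: qpoch_Suc power_even_eq)
  qed simp
  have "(\<lambda>n. qpoch a q (2 * n)) \<longlonglongrightarrow> qpoch_inf a q"
    by (rule LIMSEQ_subseq_LIMSEQ[OF qpoch_tendsto[OF assms], of "\<lambda>n. 2 * n", unfolded o_def])
       (auto simp: strict_mono_def)
  moreover have "(\<lambda>n. qpoch a q (2 * n)) \<longlonglongrightarrow> qpoch_inf a (q\<^sup>2) * qpoch_inf (a * q) (q\<^sup>2)"
    unfolding * by (intro tendsto_intros qpoch_tendsto q2)
  ultimately show ?thesis
    by (rule LIMSEQ_unique)
qed

lemma qpoch_inf_mult_minus:
  assumes "norm q < 1"
  shows "qpoch_inf a q * qpoch_inf (- a) q = qpoch_inf (a\<^sup>2) (q\<^sup>2)"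
proof -
  have q2: "norm (q\<^sup>2) < 1"
    using assms by (intro norm_power_less_1) auto
  have *: "qpoch (a\<^sup>2) (q\<^sup>2) n = qpoch a q n * qpoch (- a) q n" for n
    by (induction n) (simp_all add: qpoch_Suc power_mult_distrib power2_eq_square algebra_simps)
  show ?thesis
    by (rule qpoch_inf_unique[OF q2, symmetric], unfold *)
       (intro tendsto_intros qpoch_tendsto assms)
qed

section \<open>Uniform bounds and dominated convergence for sums over the integers\<close>

lemma qpoch_bounded:
  assumes "norm q < 1"
  obtains K where "K > 0" "\<And>n. norm (qpoch a q n) \<le> K"
  using convergent_imp_Bseq[OF convergentI[OF qpoch_tendsto[OF assms]], of a]
  by (elim BseqE) blast

text \<open>The limit of the symbols is nonzero, so the inverses converge. The bound supplies the
  majorants for the Pochhammer denominators in the limits below.\<close>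

lemma inverse_qpoch_bounded:
  assumes "norm q < 1" "\<And>k. a * q ^ k \<noteq> 1"
  obtains K where "K > 0" "\<And>n. norm (inverse (qpoch a q n)) \<le> K"
proof -
  have "(\<lambda>n. inverse (qpoch a q n)) \<longlonglongrightarrow> inverse (qpoch_inf a q)"
    by (intro tendsto_intros qpoch_tendsto qpoch_inf_nonzero assms)
  from convergent_imp_Bseq[OF convergentI[OF this]] show ?thesis
    using that by (elim BseqE) blast
qed

text \<open>Tannery's theorem, transported from series over the naturals.\<close>
lemma infsum_int_dominated:
  fixes a :: "nat \<Rightarrow> int \<Rightarrow> complex"
  assumes lim: "\<And>k. (\<lambda>n. a n k) \<longlonglongrightarrow> b k"
    and bound: "\<And>n k. norm (a n k) \<le> M k"
    and M: "M summable_on UNIV"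
  shows "(\<lambda>k. norm (b k)) summable_on UNIV" "(\<lambda>n. infsum (a n) UNIV) \<longlonglongrightarrow> infsum b UNIV"
proof -
  have bM: "norm (b k) \<le> M k" for k
    by (rule tendsto_upperbound[OF tendsto_norm[OF lim]]) (auto intro!: always_eventually bound)
  show b: "(\<lambda>k. norm (b k)) summable_on UNIV"
    by (rule Infinite_Sum.abs_summable_on_comparison_test'[OF M]) (rule bM)
  have a: "(\<lambda>k. norm (a n k)) summable_on UNIV" for n
    by (rule Infinite_Sum.abs_summable_on_comparison_test'[OF M]) (rule bound)
  have transfer: "(\<lambda>k. f (int_decode k)) sums infsum f UNIV" if "(\<lambda>k. norm (f k)) summable_on UNIV"
    for f :: "int \<Rightarrow> complex"
  proof (rule has_sum_imp_sums)
    show "((\<lambda>k. f (int_decode k)) has_sum infsum f UNIV) UNIV"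
      using has_sum_infsum[OF abs_summable_summable[OF that]]
      by (subst has_sum_reindex_bij_betw[OF bij_int_decode])
  qed
  have "(\<lambda>k. M (int_decode k)) summable_on UNIV"
    using M by (subst summable_on_reindex_bij_betw[OF bij_int_decode])
  hence "summable (\<lambda>k. M (int_decode k))"
    by (rule summable_on_imp_summable)
  from tannerys_theorem[where a = "\<lambda>k n. a n (int_decode k)" and b = "\<lambda>k. b (int_decode k)",
      OF lim _ this sequentially_bot] bound
  have "(\<lambda>n. \<Sum>k. a n (int_decode k)) \<longlonglongrightarrow> (\<Sum>k. b (int_decode k))"
    by (simp add: always_eventually)
  thus "(\<lambda>n. infsum (a n) UNIV) \<longlonglongrightarrow> infsum b UNIV"
    using sums_unique[OF transfer[OF a]] sums_unique[OF transfer[OF b]] by simp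
qed

lemma summable_on_int_geometric:
  fixes r :: real
  assumes "0 \<le> r" "r < 1"
  shows "(\<lambda>k::int. r ^ nat \<bar>k\<bar>) summable_on UNIV"
proof -
  have nat: "(\<lambda>n::nat. r ^ n) summable_on UNIV"
    using assms by (intro norm_summable_imp_summable_on) (simp add: summable_geometric)
  have *: "(\<lambda>k::int. r ^ nat \<bar>k\<bar>) summable_on {0..}"
    using nat by (subst summable_on_reindex_bij_witness[of _ int nat _ "\<lambda>n. r ^ n"]) auto
  have "(\<lambda>k::int. r ^ nat \<bar>k\<bar>) summable_on {..0}"
    using nat by (subst summable_on_reindex_bij_witness[of _ "\<lambda>n. - int n" "\<lambda>k. nat (- k)" UNIV "\<lambda>n. r ^ n"]) auto
  with * have "(\<lambda>k::int. r ^ nat \<bar>k\<bar>) summable_on ({0..} \<union> {..0})"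
    by (rule summable_on_union)
  moreover have "{0..} \<union> {..0} = (UNIV :: int set)"
    by auto
  ultimately show ?thesis
    by simp
qed

lemma gaussian_summable:
  fixes q :: complex and a b :: int
  assumes "norm q < 1" "q \<noteq> 0" "a > 0"
  shows "(\<lambda>k. norm (q powi (a * k\<^sup>2 + b * k))) summable_on UNIV"
proof -
  define r where "r = norm q"
  have r: "0 < r" "r < 1"
    using assms by (auto simp: r_def)
  \<comment> \<open>Completing the square: this constant gives
    \<open>a * k^2 + b * k \<ge> \<bar>k\<bar> - C\<close> for every \<open>k\<close>, which reduces
    the Gaussian to a geometric series.\<close>
  define C where "C = (\<bar>b\<bar> + 1)\<^sup>2"
  have le: "norm (q powi (a * k\<^sup>2 + b * k)) \<le> r powi (- C) * r ^ nat \<bar>k\<bar>" for k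
  proof -
    have "a * k\<^sup>2 \<ge> 1 * k\<^sup>2"
      using assms by (intro mult_right_mono) auto
    moreover have "b * k \<ge> - \<bar>b\<bar> * \<bar>k\<bar>"
      by (metis abs_ge_minus_self abs_mult minus_le_iff minus_mult_left)
    moreover have "k\<^sup>2 - (\<bar>b\<bar> + 1) * \<bar>k\<bar> + C \<ge> 0"
    proof -
      have "k\<^sup>2 - (\<bar>b\<bar> + 1) * \<bar>k\<bar> + C = (\<bar>k\<bar> - (\<bar>b\<bar> + 1))\<^sup>2 + (\<bar>b\<bar> + 1) * \<bar>k\<bar>"
        by (simp add: C_def power2_eq_square algebra_simps)
      also have "\<dots> \<ge> 0"
        by simp
      finally show ?thesis .
    qed
    ultimately have le: "- C + int (nat \<bar>k\<bar>) \<le> a * k\<^sup>2 + b * k"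
      by (simp add: algebra_simps)
    have "norm (q powi (a * k\<^sup>2 + b * k)) = r powi (a * k\<^sup>2 + b * k)"
      by (simp add: norm_power_int r_def)
    also have "\<dots> \<le> r powi (- C + int (nat \<bar>k\<bar>))"
      using le r by (intro power_int_decreasing) auto
    also have "\<dots> = r powi (- C) * r powi (int (nat \<bar>k\<bar>))"
      using r by (intro power_int_add) auto
    also have "r powi (int (nat \<bar>k\<bar>)) = r ^ nat \<bar>k\<bar>"
      by (rule power_int_of_nat)
    finally show ?thesis .
  qed
  have "(\<lambda>k. r powi (- C) * r ^ nat \<bar>k\<bar>) summable_on UNIV"
    using r by (intro summable_on_cmult_right summable_on_int_geometric) auto
  thus ?thesis
    by (rule Infinite_Sum.abs_summable_on_comparison_test') (rule le)
qed

section \<open>Finite q-binomial identities\<close>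

text \<open>The Gaussian binomial coefficient. The value 0 beyond \<open>n\<close> makes the Pascal
  rules true at the edge \<open>k = n\<close> and lets sums run one index too far.\<close>

definition qbin :: "complex \<Rightarrow> nat \<Rightarrow> nat \<Rightarrow> complex" where
  "qbin q n k = (if k \<le> n then qpoch q q n / (qpoch q q k * qpoch q q (n - k)) else 0)"

lemma qpoch_self_nonzero: "norm q < 1 \<Longrightarrow> qpoch q q n \<noteq> 0"
  by (rule qpoch_nonzero)

lemma qbin_0 [simp]: "norm q < 1 \<Longrightarrow> qbin q n 0 = 1"
  by (simp add: qbin_def qpoch_self_nonzero)

lemma qbin_eq_0 [simp]: "k > n \<Longrightarrow> qbin q n k = 0"
  by (simp add: qbin_def)

text \<open>The two rules differ in which term carries the power of \<open>q\<close>. The first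
  drives the q-binomial theorem and the case \<open>s = 0\<close> of the partial fractions, the
  second the step from \<open>s\<close> to \<open>s + 1\<close>.\<close>

lemma qbin_pascal:
  assumes "norm q < 1" "k \<le> n"
  shows "qbin q (Suc n) (Suc k) = qbin q n (Suc k) + q ^ (n - k) * qbin q n k"
    and "qbin q (Suc n) (Suc k) = q ^ Suc k * qbin q n (Suc k) + qbin q n k"
proof -
  note nz = qpoch_self_nonzero[OF assms(1)]
  have nz': "1 - q * q ^ j \<noteq> 0" for j
    using power_mult_neq_1[OF assms(1) assms(1)] by simp
  obtain m where n: "n = k + m"
    using assms le_Suc_ex by blast
  have "qbin q (Suc n) (Suc k) = qbin q n (Suc k) + q ^ (n - k) * qbin q n k \<and>
        qbin q (Suc n) (Suc k) = q ^ Suc k * qbin q n (Suc k) + qbin q n k"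
  proof (cases m)
    case 0
    thus ?thesis
      using n nz nz' by (simp add: qbin_def)
  next
    case (Suc l)
    have eq: "qbin q (Suc n) (Suc k) =
        qpoch q q n * (1 - q * q ^ n) / (qpoch q q k * (1 - q * q ^ k) * (qpoch q q l * (1 - q * q ^ l)))"
      "qbin q n (Suc k) = qpoch q q n / (qpoch q q k * (1 - q * q ^ k) * qpoch q q l)"
      "qbin q n k = qpoch q q n / (qpoch q q k * (qpoch q q l * (1 - q * q ^ l)))"
      using n Suc by (simp_all add: qbin_def qpoch_Suc del: power_Suc)
    have "n - k = Suc l" "q ^ n = q ^ k * (q * q ^ l)"
      using n Suc by (simp_all add: power_add)
    thus ?thesis
      unfolding eq using nz nz' by (simp add: divide_simps) (simp add: algebra_simps)
  qed
  thus "qbin q (Suc n) (Suc k) = qbin q n (Suc k) + q ^ (n - k) * qbin q n k"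
    and "qbin q (Suc n) (Suc k) = q ^ Suc k * qbin q n (Suc k) + qbin q n k"
    by blast+
qed

text \<open>Here and below the base is \<open>q\<^sup>2\<close>, so that no halved exponents occur.\<close>
lemma qbinomial_theorem:
  assumes "norm q < 1"
  shows "qpoch (y * q\<^sup>2) (q\<^sup>2) n = (\<Sum>j\<le>n. (-1) ^ j * q ^ (j * (j + 1)) * qbin (q\<^sup>2) n j * y ^ j)"
proof (induction n)
  case (Suc n)
  have q2: "norm (q\<^sup>2) < 1"
    using assms by (intro norm_power_less_1) auto
  let ?t = "\<lambda>n j. (-1) ^ j * q ^ (j * (j + 1)) * qbin (q\<^sup>2) n j * y ^ j"
  have "(\<Sum>j\<le>Suc n. ?t (Suc n) j) = 1 + (\<Sum>j\<le>n. ?t (Suc n) (Suc j))"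
    using q2 by (subst sum.atMost_Suc_shift) simp
  also have "(\<Sum>j\<le>n. ?t (Suc n) (Suc j)) = (\<Sum>j\<le>n. ?t n (Suc j)) - y * (q\<^sup>2) ^ Suc n * (\<Sum>j\<le>n. ?t n j)"
  proof -
    \<comment> \<open>The Pascal weight \<open>(q^2)^(n - j)\<close> lowers the quadratic exponent
      from index \<open>j + 1\<close> to index \<open>j\<close> at the cost of a factor independent
      of \<open>j\<close>. This produces the new last factor
      \<open>1 - y * (q^2)^(n + 1)\<close>.\<close>
    have "?t (Suc n) (Suc j) = ?t n (Suc j) - y * (q\<^sup>2) ^ Suc n * ?t n j" if "j \<le> n" for j
    proof -
      have "q ^ (Suc j * (Suc j + 1)) * (q\<^sup>2) ^ (n - j) = (q\<^sup>2) ^ Suc n * q ^ (j * (j + 1))"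
      proof -
        have "Suc j * (Suc j + 1) + 2 * (n - j) = 2 * Suc n + j * (j + 1)"
          using that by (simp add: algebra_simps)
        thus ?thesis
          by (metis power_add power_mult)
      qed
      moreover have "?t (Suc n) (Suc j) = ?t n (Suc j)
          - y * (q ^ (Suc j * (Suc j + 1)) * (q\<^sup>2) ^ (n - j)) * ((-1) ^ j * qbin (q\<^sup>2) n j * y ^ j)"
        unfolding qbin_pascal(1)[OF q2 that] by (simp add: ring_distribs)
      ultimately show ?thesis
        by simp
    qed
    thus ?thesis
      by (simp add: sum_subtractf sum_distrib_left del: power_Suc)
  qed
  also have "1 + ((\<Sum>j\<le>n. ?t n (Suc j)) - y * (q\<^sup>2) ^ Suc n * (\<Sum>j\<le>n. ?t n j))
      = (\<Sum>j\<le>Suc n. ?t n j) - y * (q\<^sup>2) ^ Suc n * (\<Sum>j\<le>n. ?t n j)"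
    using q2 by (subst sum.atMost_Suc_shift) simp
  also have "(\<Sum>j\<le>Suc n. ?t n j) = (\<Sum>j\<le>n. ?t n j)"
    by simp
  finally show ?case
    using Suc.IH by (simp add: qpoch_Suc algebra_simps)
qed (simp add: qbin_def)

text \<open>Partial fractions in \<open>y\<close> with simple poles at
  \<open>y = q powi (- 2 * j)\<close> for \<open>j \<le> n\<close>. The condition
  \<open>s \<le> n\<close> keeps the degree of \<open>y ^ s\<close> below that of the denominator,
  so that no polynomial part arises. The induction on \<open>n\<close> must vary \<open>y\<close>
  and \<open>s\<close>, because a Pascal rule produces instances at \<open>y\<close> and at
  \<open>y * q^2\<close>.\<close>

lemma qbinomial_partial_fraction:
  assumes "norm q < 1" "q \<noteq> 0" "\<And>j. y * q ^ (2 * j) \<noteq> 1" "s \<le> n"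
  shows "(\<Sum>j\<le>n. (-1) ^ j * qbin (q\<^sup>2) n j * q powi (int j * (int j + 1) - 2 * int s * int j)
            / (1 - y * q ^ (2 * j)))
         = qpoch (q\<^sup>2) (q\<^sup>2) n * y ^ s / qpoch y (q\<^sup>2) (Suc n)"
  using assms(3,4)
proof (induction n arbitrary: s y)
  case 0
  thus ?case
    using assms(1) by (simp add: qpoch_Suc qbin_def)
next
  case (Suc n)
  have q2: "norm (q\<^sup>2) < 1"
    using assms by (intro norm_power_less_1) auto
  let ?t = "\<lambda>n s y j. (-1) ^ j * qbin (q\<^sup>2) n j * q powi (int j * (int j + 1) - 2 * int s * int j)
            / (1 - y * q ^ (2 * j))"
  have nz: "y * q ^ (2 * j) \<noteq> 1" for j
    by (rule Suc.prems)
  have nz': "y * q\<^sup>2 * q ^ (2 * j) \<noteq> 1" for j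
    using nz[of "Suc j"] by (simp add: power2_eq_square mult.assoc)
  have P: "qpoch y (q\<^sup>2) (Suc n) \<noteq> 0" "qpoch (y * q\<^sup>2) (q\<^sup>2) (Suc n) \<noteq> 0" "qpoch y (q\<^sup>2) (Suc (Suc n)) \<noteq> 0"
    using nz nz' unfolding qpoch_eq_0_iff power_mult by auto
  have shift: "(\<Sum>j\<le>Suc n. ?t N s y j) = ?t N s y 0 + (\<Sum>j\<le>n. ?t N s y (Suc j))" for N s
    by (rule sum.atMost_Suc_shift)
  have left: "qpoch y (q\<^sup>2) (Suc (Suc n)) = (1 - y) * qpoch (y * q\<^sup>2) (q\<^sup>2) (Suc n)"
    by (rule qpoch_Suc_left)
  have right: "qpoch y (q\<^sup>2) (Suc (Suc n)) = qpoch y (q\<^sup>2) (Suc n) * (1 - y * (q\<^sup>2) ^ Suc n)"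
    by (rule qpoch_Suc)
  have nz1: "1 - y \<noteq> 0" "1 - y * (q\<^sup>2) ^ Suc n \<noteq> 0"
    using nz[of 0] nz[of "Suc n"] unfolding power_mult by auto
  show ?case
  proof (cases s)
    case 0
    \<comment> \<open>First Pascal rule: the weight \<open>(q^2)^(n - j)\<close> leaves the exponent
      of index \<open>j\<close> times a constant, and the shifted denominator is the one belonging
      to \<open>y * q^2\<close>.\<close>
    have "?t (Suc n) 0 y (Suc j) = ?t n 0 y (Suc j) - (q\<^sup>2) ^ Suc n * ?t n 0 (y * q\<^sup>2) j" if "j \<le> n" for j
    proof -
      have e: "q powi (int (Suc j) * (int (Suc j) + 1)) * (q\<^sup>2) ^ (n - j) = (q\<^sup>2) ^ Suc n * q powi (int j * (int j + 1))"
      proof -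
        have "int (Suc j) * (int (Suc j) + 1) + 2 * int (n - j) = 2 * int (Suc n) + int j * (int j + 1)"
          using that by (simp add: of_nat_diff algebra_simps)
        moreover have "(q\<^sup>2) ^ k = q powi (2 * int k)" for k
          by (simp add: power_int_mult)
        ultimately show ?thesis
          by (simp only: power_int_add[OF disjI1[OF assms(2)], symmetric])
      qed
      have "?t (Suc n) 0 y (Suc j) = ?t n 0 y (Suc j) - (q powi (int (Suc j) * (int (Suc j) + 1)) * (q\<^sup>2) ^ (n - j)) * ((-1) ^ j * qbin (q\<^sup>2) n j)
            / (1 - y * q ^ (2 * Suc j))"
        unfolding qbin_pascal(1)[OF q2 that] by (simp add: ring_distribs diff_divide_distrib add_divide_distrib)
      also have "\<dots> = ?t n 0 y (Suc j) - (q\<^sup>2) ^ Suc n * ?t n 0 (y * q\<^sup>2) j"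
        unfolding e by (simp add: power2_eq_square mult_ac)
      finally show ?thesis .
    qed
    hence "(\<Sum>j\<le>Suc n. ?t (Suc n) s y j) = (\<Sum>j\<le>Suc n. ?t n 0 y j) - (q\<^sup>2) ^ Suc n * (\<Sum>j\<le>n. ?t n 0 (y * q\<^sup>2) j)"
      unfolding shift 0 using q2 by (simp add: sum_subtractf sum_distrib_left del: power_Suc)
    also have "(\<Sum>j\<le>Suc n. ?t n 0 y j) = (\<Sum>j\<le>n. ?t n 0 y j)"
      by simp
    also have "(\<Sum>j\<le>n. ?t n 0 y j) = qpoch (q\<^sup>2) (q\<^sup>2) n / qpoch y (q\<^sup>2) (Suc n)"
      using Suc.IH[OF nz, of 0] by simp
    also have "(\<Sum>j\<le>n. ?t n 0 (y * q\<^sup>2) j) = qpoch (q\<^sup>2) (q\<^sup>2) n / qpoch (y * q\<^sup>2) (q\<^sup>2) (Suc n)"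
      using Suc.IH[OF nz', of 0] by simp
    also have "qpoch (q\<^sup>2) (q\<^sup>2) n / qpoch y (q\<^sup>2) (Suc n) = qpoch (q\<^sup>2) (q\<^sup>2) n * (1 - y * (q\<^sup>2) ^ Suc n) / qpoch y (q\<^sup>2) (Suc (Suc n))"
      unfolding right using nz1 by simp
    also have "qpoch (q\<^sup>2) (q\<^sup>2) n / qpoch (y * q\<^sup>2) (q\<^sup>2) (Suc n) = qpoch (q\<^sup>2) (q\<^sup>2) n * (1 - y) / qpoch y (q\<^sup>2) (Suc (Suc n))"
      unfolding left using nz1 by simp
    also have "qpoch (q\<^sup>2) (q\<^sup>2) n * (1 - y * (q\<^sup>2) ^ Suc n) / qpoch y (q\<^sup>2) (Suc (Suc n))
        - (q\<^sup>2) ^ Suc n * (qpoch (q\<^sup>2) (q\<^sup>2) n * (1 - y) / qpoch y (q\<^sup>2) (Suc (Suc n)))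
        = qpoch (q\<^sup>2) (q\<^sup>2) n * (1 - (q\<^sup>2) ^ Suc n) / qpoch y (q\<^sup>2) (Suc (Suc n))"
      unfolding times_divide_eq_right diff_divide_distrib[symmetric] by (simp add: algebra_simps)
    finally show ?thesis
      by (simp add: 0 qpoch_Suc)
  next
    case (Suc r)
    have r: "r \<le> n"
      using Suc Suc.prems by simp
    have e: "(q\<^sup>2) ^ k = q powi (2 * int k)" for k
      by (simp add: power_int_mult)
    \<comment> \<open>Second Pascal rule: its factor \<open>(q^2)^(j + 1)\<close> lowers
      \<open>s\<close> to \<open>r\<close> in the first part. In the second part the index shift
      does the same, up to the constant \<open>q powi (- 2 * r)\<close>, and moves \<open>y\<close>
      to \<open>y * q^2\<close>.\<close>
    have "?t (Suc n) s y (Suc j) = ?t n r y (Suc j) - q powi (- 2 * int r) * ?t n r (y * q\<^sup>2) j" if "j \<le> n" for j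
    proof -
      have e1: "q powi (int (Suc j) * (int (Suc j) + 1) - 2 * int s * int (Suc j)) * (q\<^sup>2) ^ Suc j
          = q powi (int (Suc j) * (int (Suc j) + 1) - 2 * int r * int (Suc j))"
        unfolding e using assms(2) Suc by (simp add: algebra_simps flip: power_int_add)
      have e2: "q powi (int (Suc j) * (int (Suc j) + 1) - 2 * int s * int (Suc j))
          = q powi (- 2 * int r) * q powi (int j * (int j + 1) - 2 * int r * int j)"
        using assms(2) Suc by (simp add: algebra_simps flip: power_int_add)
      have "?t (Suc n) s y (Suc j) =
         (-1) ^ Suc j * qbin (q\<^sup>2) n (Suc j) * (q powi (int (Suc j) * (int (Suc j) + 1) - 2 * int s * int (Suc j)) * (q\<^sup>2) ^ Suc j) / (1 - y * q ^ (2 * Suc j))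
         - (-1) ^ j * qbin (q\<^sup>2) n j * (q powi (int (Suc j) * (int (Suc j) + 1) - 2 * int s * int (Suc j))) / (1 - y * q ^ (2 * Suc j))"
        unfolding qbin_pascal(2)[OF q2 that] by (simp add: ring_distribs diff_divide_distrib add_divide_distrib mult_ac)
      also have "\<dots> = ?t n r y (Suc j) - q powi (- 2 * int r) * ?t n r (y * q\<^sup>2) j"
        unfolding e1 unfolding e2 by (simp add: power2_eq_square mult_ac)
      finally show ?thesis .
    qed
    hence "(\<Sum>j\<le>Suc n. ?t (Suc n) s y j) = (?t n r y 0 + (\<Sum>j\<le>n. ?t n r y (Suc j))) - q powi (- 2 * int r) * (\<Sum>j\<le>n. ?t n r (y * q\<^sup>2) j)"
      unfolding shift using q2 by (simp add: sum_subtractf sum_distrib_left del: power_Suc)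
    also have "?t n r y 0 + (\<Sum>j\<le>n. ?t n r y (Suc j)) = (\<Sum>j\<le>n. ?t n r y j)"
      unfolding shift[symmetric] by simp
    also have "(\<Sum>j\<le>n. ?t n r y j) = qpoch (q\<^sup>2) (q\<^sup>2) n * y ^ r / qpoch y (q\<^sup>2) (Suc n)"
      by (rule Suc.IH[OF nz r])
    also have "(\<Sum>j\<le>n. ?t n r (y * q\<^sup>2) j) = qpoch (q\<^sup>2) (q\<^sup>2) n * (y * q\<^sup>2) ^ r / qpoch (y * q\<^sup>2) (q\<^sup>2) (Suc n)"
      by (rule Suc.IH[OF nz' r])
    also have "q powi (- 2 * int r) * (qpoch (q\<^sup>2) (q\<^sup>2) n * (y * q\<^sup>2) ^ r / qpoch (y * q\<^sup>2) (q\<^sup>2) (Suc n))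
        = qpoch (q\<^sup>2) (q\<^sup>2) n * y ^ r / qpoch (y * q\<^sup>2) (q\<^sup>2) (Suc n)"
      unfolding power_mult_distrib e using assms(2) by (simp add: power_int_minus)
    also have "qpoch (q\<^sup>2) (q\<^sup>2) n * y ^ r / qpoch y (q\<^sup>2) (Suc n) = qpoch (q\<^sup>2) (q\<^sup>2) n * y ^ r * (1 - y * (q\<^sup>2) ^ Suc n) / qpoch y (q\<^sup>2) (Suc (Suc n))"
      unfolding right using nz1 by simp
    also have "qpoch (q\<^sup>2) (q\<^sup>2) n * y ^ r / qpoch (y * q\<^sup>2) (q\<^sup>2) (Suc n) = qpoch (q\<^sup>2) (q\<^sup>2) n * y ^ r * (1 - y) / qpoch y (q\<^sup>2) (Suc (Suc n))"
      unfolding left using nz1 by simp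
    also have "qpoch (q\<^sup>2) (q\<^sup>2) n * y ^ r * (1 - y * (q\<^sup>2) ^ Suc n) / qpoch y (q\<^sup>2) (Suc (Suc n))
        - qpoch (q\<^sup>2) (q\<^sup>2) n * y ^ r * (1 - y) / qpoch y (q\<^sup>2) (Suc (Suc n))
        = qpoch (q\<^sup>2) (q\<^sup>2) n * (1 - (q\<^sup>2) ^ Suc n) * y ^ Suc r / qpoch y (q\<^sup>2) (Suc (Suc n))"
      unfolding diff_divide_distrib[symmetric] by (simp add: algebra_simps)
    finally show ?thesis
      by (simp add: Suc qpoch_Suc mult_ac)
  qed
qed

section \<open>Theta functions\<close>

text \<open>The theta function without its customary factor \<open>(q;q)_inf\<close>, which
  therefore shows up explicitly in the triple product and in the partial fraction expansion.\<close>

definition jtheta :: "complex \<Rightarrow> complex \<Rightarrow> complex" where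
  "jtheta z q = qpoch_inf z q * qpoch_inf (q / z) q"

lemma powi_double: "q powi (2 * k) = (q\<^sup>2 :: complex) powi k"
  by (simp add: power_int_mult)

lemma powi_power: "(q powi a) ^ j = (q :: complex) powi (a * int j)"
  unfolding power_int_mult power_int_of_nat ..

section \<open>Partial fraction expansion of the reciprocal theta function\<close>

lemma convergent_bounded:
  fixes l :: complex
  assumes "f \<longlonglongrightarrow> l"
  shows "\<exists>B>0. \<forall>n. norm (f n) \<le> B"
  using convergent_imp_Bseq[OF convergentI[OF assms]] unfolding Bseq_def .

text \<open>For \<open>k\<close> tending to plus infinity the fraction tends to 1. For
  \<open>k = - n\<close> it equals \<open>p ^ n / (p ^ n - x)\<close>, which tends to 0. Both halves
  are thus bounded.\<close>

lemma inverse_one_minus_bounded: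
  fixes x p :: complex
  assumes "norm p < 1" "p \<noteq> 0" "x \<noteq> 0" "\<And>k::int. x * p powi k \<noteq> 1"
  shows "\<exists>B>0. \<forall>k::int. norm (1 / (1 - x * p powi k)) \<le> B"
proof -
  have lim: "(\<lambda>n. p ^ n) \<longlonglongrightarrow> 0"
    by (rule LIMSEQ_power_zero) fact
  have l1: "(\<lambda>n. 1 / (1 - x * p ^ n)) \<longlonglongrightarrow> 1 / (1 - x * 0)"
    by (intro tendsto_intros lim) auto
  then obtain B1 where B1: "B1 > 0" "\<And>n. norm (1 / (1 - x * p ^ n)) \<le> B1"
    using convergent_bounded[OF l1] by blast
  have l2: "(\<lambda>n. p ^ n / (p ^ n - x)) \<longlonglongrightarrow> 0 / (0 - x)"
    using assms by (intro tendsto_intros lim) auto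
  then obtain B2 where B2: "B2 > 0" "\<And>n. norm (p ^ n / (p ^ n - x)) \<le> B2"
    using convergent_bounded[OF l2] by blast
  have "norm (1 / (1 - x * p powi k)) \<le> max B1 B2" for k
  proof (cases "k \<ge> 0")
    case True
    then obtain n where "k = int n"
      by (metis nonneg_int_cases)
    thus ?thesis
      using B1(2)[of n] by simp
  next
    case False
    define n where "n = nat (- k)"
    have n: "k = - int n"
      using False by (simp add: n_def)
    have "1 - x * p powi k = (p ^ n - x) / p ^ n"
      using assms by (simp add: n power_int_minus field_simps)
    thus ?thesis
      using B2(2)[of n] by simp
  qed
  thus ?thesis
    using B1(1) by (intro exI[of _ "max B1 B2"]) auto
qed

text \<open>Each factor is turned around by \<open>1 - x * q powi (- 2 * j) = - x * q powi (- 2 * j)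
  * (1 - q^(2 * j) / x)\<close>, for \<open>j\<close> from 1 to \<open>m\<close>. The exponents
  \<open>2 * j\<close> add up to \<open>m * (m + 1)\<close>.\<close>

lemma qpoch_reverse:
  assumes "q \<noteq> 0" "x \<noteq> 0"
  shows "qpoch (x * q powi (- 2 * int m)) (q\<^sup>2) m = (- x) ^ m * q powi (- int m * (int m + 1)) * qpoch (q\<^sup>2 / x) (q\<^sup>2) m"
proof (induction m)
  case (Suc m)
  have 1: "x * q powi (- 2 * int (Suc m)) * q\<^sup>2 = x * q powi (- 2 * int m)"
  proof -
    have "q powi (- 2 * int (Suc m)) * q powi 2 = q powi (- 2 * int m)"
      using assms(1) by (subst power_int_add[symmetric]) auto
    thus ?thesis
      by simp
  qed
  have 2: "q powi (- int (Suc m) * (int (Suc m) + 1)) = q powi (- int m * (int m + 1)) * q powi (- 2 * int (Suc m))"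
    using assms(1) by (subst power_int_add[symmetric]) (auto simp: algebra_simps)
  have 3: "q powi (- 2 * int (Suc m)) = 1 / (q\<^sup>2 * (q\<^sup>2) ^ m)"
  proof -
    have "q powi (- 2 * int (Suc m)) = q powi (2 * (- int (Suc m)))"
      by simp
    also have "\<dots> = inverse ((q\<^sup>2) ^ Suc m)"
      unfolding powi_double power_int_minus power_int_of_nat ..
    finally show ?thesis
      by (simp add: inverse_eq_divide)
  qed
  show ?case
    unfolding qpoch_Suc_left[of "x * _"] 1 Suc.IH unfolding qpoch_Suc 2 unfolding 3
    using assms by (simp add: field_simps)
qed simp

lemma sum_int_shift:
  fixes f :: "int \<Rightarrow> complex"
  shows "(\<Sum>k\<in>{- int m..int n}. f k) = (\<Sum>j\<le>m + n. f (int j - int m))"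
  by (rule sum.reindex_bij_witness[of _ "\<lambda>j. int j - int m" "\<lambda>k. nat (k + int m)"]) auto

lemma minus_one_powi_add: "(-1 :: complex) powi (a + b) = (-1) powi a * (-1) powi b"
  by (simp add: power_int_add)

text \<open>The expansion \<open>qbinomial_partial_fraction\<close> of order
  \<open>2 * n + 1\<close>, centred: with \<open>s = n + 1\<close>,
  \<open>y = x * q powi (- 2 * (n + 1))\<close> and \<open>j = k + n + 1\<close> the exponent
  becomes \<open>k * (k + 1) - n * (n + 1)\<close>. There are \<open>2 * n + 2\<close> poles, hence
  the lopsided range of \<open>k\<close>.\<close>

lemma theta_partial_fraction_finite:
  assumes "norm q < 1" "q \<noteq> 0" "x \<noteq> 0" "\<And>k::int. x * q powi (2 * k) \<noteq> 1"
  shows "(\<Sum>k\<in>{- int (Suc n)..int n}. (-1) powi k * q powi (k * (k + 1))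
            / (qpoch (q\<^sup>2) (q\<^sup>2) (nat (int n - k)) * qpoch (q\<^sup>2) (q\<^sup>2) (nat (int n + k + 1)))
            / (1 - x * q powi (2 * k)))
         = 1 / (qpoch x (q\<^sup>2) (Suc n) * qpoch (q\<^sup>2 / x) (q\<^sup>2) (Suc n))" (is "sum ?f _ = _")
proof -
  define y where "y = x * q powi (- 2 * int (Suc n))"
  define N where "N = Suc n + n"
  have q2: "norm (q\<^sup>2) < 1"
    using assms by (intro norm_power_less_1) auto
  have y: "y * q ^ (2 * j) = x * q powi (2 * (int j - int (Suc n)))" for j
  proof -
    have "q powi (- 2 * int (Suc n)) * q powi int (2 * j) = q powi (2 * (int j - int (Suc n)))"
      using assms(2) by (subst power_int_add[symmetric]) (auto simp: algebra_simps)
    thus ?thesis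
      unfolding y_def mult.assoc by (simp only: power_int_of_nat)
  qed
  define c where "c = qpoch (q\<^sup>2) (q\<^sup>2) N * (-1) ^ Suc n * q powi (- int n * (int n + 1))"
  have c: "c \<noteq> 0"
    using assms(2) by (simp add: c_def qpoch_self_nonzero[OF q2])
  have coeff: "(-1) ^ j * qbin (q\<^sup>2) N j * q powi (int j * (int j + 1) - 2 * int (Suc n) * int j)
            / (1 - y * q ^ (2 * j)) = c * ?f (int j - int (Suc n))" if "j \<le> N" for j
  proof -
    have e: "q powi (int j * (int j + 1) - 2 * int (Suc n) * int j) = q powi (- int n * (int n + 1)) *
       q powi ((int j - int (Suc n)) * (int j - int (Suc n) + 1))"
      using assms(2) by (subst power_int_add[symmetric]) (auto simp: algebra_simps)
    have s: "(-1 :: complex) ^ j = (-1) ^ Suc n * (-1) powi (int j - int (Suc n))"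
    proof -
      have "(-1 :: complex) ^ j = (-1) powi (int (Suc n) + (int j - int (Suc n)))"
        by simp
      also have "\<dots> = (-1) powi int (Suc n) * (-1) powi (int j - int (Suc n))"
        by (rule minus_one_powi_add)
      finally show ?thesis
        by (simp only: power_int_of_nat)
    qed
    have i: "nat (int n - (int j - int (Suc n))) = N - j" "nat (int n + (int j - int (Suc n)) + 1) = j"
      using that by (auto simp: N_def)
    show ?thesis
      unfolding y unfolding i unfolding c_def e s using that by (simp add: qbin_def mult_ac)
  qed
  have "qpoch (q\<^sup>2) (q\<^sup>2) N * y ^ Suc n / qpoch y (q\<^sup>2) (Suc N)
     = (\<Sum>j\<le>N. (-1) ^ j * qbin (q\<^sup>2) N j * q powi (int j * (int j + 1) - 2 * int (Suc n) * int j)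
            / (1 - y * q ^ (2 * j)))"
    by (intro qbinomial_partial_fraction[symmetric] assms(1,2)) (unfold y N_def, rule assms(4), simp)
  also have "\<dots> = c * (\<Sum>j\<le>N. ?f (int j - int (Suc n)))"
    unfolding sum_distrib_left by (intro sum.cong refl coeff) auto
  also have "(\<Sum>j\<le>N. ?f (int j - int (Suc n))) = sum ?f {- int (Suc n)..int n}"
    unfolding sum_int_shift N_def ..
  finally have 1: "sum ?f {- int (Suc n)..int n} = qpoch (q\<^sup>2) (q\<^sup>2) N * y ^ Suc n / qpoch y (q\<^sup>2) (Suc N) / c"
    using c by (simp add: field_simps)
  have "qpoch y (q\<^sup>2) (Suc N) = qpoch y (q\<^sup>2) (Suc n + Suc n)"
    by (simp add: N_def)
  also have "\<dots> = qpoch y (q\<^sup>2) (Suc n) * qpoch x (q\<^sup>2) (Suc n)"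
  proof -
    have "y * (q\<^sup>2) ^ Suc n = x"
      using y[of "Suc n"] unfolding power_mult by simp
    thus ?thesis
      unfolding qpoch_add by simp
  qed
  also have "qpoch y (q\<^sup>2) (Suc n) = (- x) ^ Suc n * q powi (- int (Suc n) * (int (Suc n) + 1)) * qpoch (q\<^sup>2 / x) (q\<^sup>2) (Suc n)"
    unfolding y_def by (rule qpoch_reverse) fact+
  also have "(- x) ^ Suc n * q powi (- int (Suc n) * (int (Suc n) + 1)) = y ^ Suc n * (-1) ^ Suc n * q powi (int n * (int n + 1))"
  proof -
    have "q powi (- int (Suc n) * (int (Suc n) + 1)) = (q powi (- 2 * int (Suc n))) ^ Suc n * q powi (int n * (int n + 1))"
      unfolding powi_power
      using assms(2) by (subst power_int_add[symmetric]) (auto simp: algebra_simps)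
    thus ?thesis
      unfolding y_def power_mult_distrib power_minus[of x] by (simp add: mult_ac)
  qed
  finally have 2: "qpoch y (q\<^sup>2) (Suc N) = y ^ Suc n * (-1) ^ Suc n * q powi (int n * (int n + 1)) * qpoch (q\<^sup>2 / x) (q\<^sup>2) (Suc n) * qpoch x (q\<^sup>2) (Suc n)" .
  have 3: "q powi (- int n * (int n + 1)) = 1 / q powi (int n * (int n + 1))"
    unfolding mult_minus_left by (simp add: power_int_minus divide_simps)
  have nz: "y \<noteq> 0" "q powi (int n * (int n + 1)) \<noteq> 0" "qpoch (q\<^sup>2) (q\<^sup>2) N \<noteq> 0"
    using assms by (auto simp: y_def qpoch_self_nonzero[OF q2])
  have 4: "(-1 :: complex) ^ Suc n * (-1) ^ Suc n = 1"
    by (simp flip: power_mult_distrib)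
  have cancel: "A * Y / (Y * S * P * U * V) / (A * S * (1 / P)) = 1 / (V * U)"
    if "A \<noteq> 0" "Y \<noteq> 0" "P \<noteq> 0" "S * S = 1" for A Y S P U V :: complex
  proof -
    have "A * Y / (Y * S * P * U * V) / (A * S * (1 / P)) = (A * Y * P) / ((A * Y * P) * ((S * S) * (V * U)))"
      by (simp add: mult_ac)
    also have "\<dots> = 1 / (V * U)"
      using that by simp
    finally show ?thesis .
  qed
  have "y ^ Suc n \<noteq> 0"
    using nz(1) by simp
  from cancel[OF nz(3) this nz(2) 4] show ?thesis
    unfolding 1 2 c_def 3 .
qed

lemma nat_diff_at_top: "filterlim (\<lambda>n. nat (int n + k)) at_top sequentially"
  unfolding filterlim_at_top eventually_sequentially
proof
  fix Z
  show "\<exists>N. \<forall>n\<ge>N. Z \<le> nat (int n + k)"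
    by (rule exI[of _ "Z + nat \<bar>k\<bar>"]) auto
qed

lemma qpoch_nat_diff_tendsto:
  "norm q < 1 \<Longrightarrow> (\<lambda>n. qpoch a q (nat (int n + k))) \<longlonglongrightarrow> qpoch_inf a q"
  by (rule filterlim_compose[OF qpoch_tendsto nat_diff_at_top])

lemma eventually_int_interval: "eventually (\<lambda>n. k \<in> {- int (n + a)..int n}) sequentially"
  unfolding eventually_sequentially by (rule exI[of _ "nat \<bar>k\<bar>"]) auto

lemma qpoch_inf_self_nonzero: "norm q < 1 \<Longrightarrow> qpoch_inf q q \<noteq> 0"
  by (intro qpoch_inf_nonzero power_mult_neq_1)

lemma theta_term_summable:
  fixes q x :: complex
  assumes "norm q < 1" "q \<noteq> 0" "x \<noteq> 0" "\<And>k::int. x * q powi (2 * k) \<noteq> 1" "a > 0"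
  shows "(\<lambda>k. norm ((-1) powi k * q powi (a * k\<^sup>2 + b * k) / (1 - x * q powi (2 * k)))) summable_on UNIV"
proof -
  have q2: "norm (q\<^sup>2) < 1"
    using assms by (intro norm_power_less_1) auto
  have "\<exists>B>0. \<forall>k::int. norm (1 / (1 - x * (q\<^sup>2) powi k)) \<le> B"
    using assms q2 by (intro inverse_one_minus_bounded) (auto simp: powi_double)
  then obtain B where B: "\<And>k::int. norm (1 / (1 - x * (q\<^sup>2) powi k)) \<le> B"
    by blast
  have "norm ((-1) powi k * q powi (a * k\<^sup>2 + b * k) / (1 - x * q powi (2 * k))) \<le> norm (q powi (a * k\<^sup>2 + b * k)) * B" for k
    using mult_left_mono[OF B[of k], of "norm (q powi (a * k\<^sup>2 + b * k))"]
    by (simp add: norm_mult norm_divide norm_power_int powi_double)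
  thus ?thesis
    using gaussian_summable[OF assms(1,2,5), of b]
    by (intro Infinite_Sum.abs_summable_on_comparison_test'[OF summable_on_cmult_left]) auto
qed

text \<open>The limit of the centred finite expansion. For fixed \<open>k\<close> both Pochhammer
  symbols in the coefficient tend to \<open>(q^2;q^2)_inf\<close>, whence the square on the right.
  Their bounded inverses give the majorant.\<close>

theorem theta_partial_fraction:
  fixes q x :: complex
  assumes "norm q < 1" "q \<noteq> 0" "x \<noteq> 0" "\<And>k::int. x * q powi (2 * k) \<noteq> 1"
  shows "((\<lambda>k. (-1) powi k * q powi (k * (k + 1)) / (1 - x * q powi (2 * k)))
     has_sum (qpoch_inf (q\<^sup>2) (q\<^sup>2))\<^sup>2 / jtheta x (q\<^sup>2)) UNIV"
proof -
  define Q where "Q = q\<^sup>2"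
  have Q: "norm Q < 1"
    using assms unfolding Q_def by (intro norm_power_less_1) auto
  define t where "t = (\<lambda>k. (-1) powi k * q powi (k * (k + 1)) / (1 - x * q powi (2 * k)))"
  define a where "a = (\<lambda>n k. if k \<in> {- int (Suc n)..int n} then
      inverse (qpoch Q Q (nat (int n + - k))) * inverse (qpoch Q Q (nat (int n + (k + 1)))) * t k else 0)"
  have t: "(\<lambda>k. norm (t k)) summable_on UNIV"
    using theta_term_summable[OF assms, of 1 1] by (simp add: t_def power2_eq_square algebra_simps)
  obtain K where K: "K > 0" "\<And>n. norm (inverse (qpoch Q Q n)) \<le> K"
    using inverse_qpoch_bounded[OF Q power_mult_neq_1[OF Q Q]] by metis
  have "infsum (a n) UNIV = 1 / (qpoch x Q (Suc n) * qpoch (Q / x) Q (Suc n))" for n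
  proof -
    have "infsum (a n) UNIV = infsum (a n) {- int (Suc n)..int n}"
      by (rule infsum_cong_neutral) (auto simp: a_def)
    also have "\<dots> = sum (a n) {- int (Suc n)..int n}"
      by simp
    also have "\<dots> = 1 / (qpoch x Q (Suc n) * qpoch (Q / x) Q (Suc n))"
      unfolding Q_def theta_partial_fraction_finite[OF assms, symmetric]
      by (intro sum.cong refl) (auto simp: a_def t_def Q_def divide_simps add.assoc)
    finally show ?thesis .
  qed
  moreover have "(\<lambda>n. infsum (a n) UNIV) \<longlonglongrightarrow> infsum (\<lambda>k. inverse (qpoch_inf Q Q) * inverse (qpoch_inf Q Q) * t k) UNIV"
  proof (rule infsum_int_dominated(2))
    fix k
    have "(\<lambda>n. inverse (qpoch Q Q (nat (int n + - k))) * inverse (qpoch Q Q (nat (int n + (k + 1)))) * t k) \<longlonglongrightarrow> inverse (qpoch_inf Q Q) * inverse (qpoch_inf Q Q) * t k"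
      by (intro tendsto_intros qpoch_nat_diff_tendsto Q qpoch_inf_self_nonzero)
    thus "(\<lambda>n. a n k) \<longlonglongrightarrow> inverse (qpoch_inf Q Q) * inverse (qpoch_inf Q Q) * t k"
      by (rule Lim_transform_eventually)
         (use eventually_int_interval[of k 1] in \<open>eventually_elim, auto simp: a_def\<close>)
  next
    show "norm (a n k) \<le> K * K * norm (t k)" for n k
      using K by (auto simp: a_def norm_mult intro!: mult_mono)
    show "(\<lambda>k. K * K * norm (t k)) summable_on UNIV"
      by (intro summable_on_cmult_right t)
  qed
  ultimately have "(\<lambda>n. 1 / (qpoch x Q (Suc n) * qpoch (Q / x) Q (Suc n))) \<longlonglongrightarrow> inverse (qpoch_inf Q Q) * inverse (qpoch_inf Q Q) * infsum t UNIV"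
    by (simp add: infsum_cmult_right')
  moreover have "(\<lambda>n. 1 / (qpoch x Q (Suc n) * qpoch (Q / x) Q (Suc n))) \<longlonglongrightarrow> 1 / jtheta x Q"
  proof -
    have "qpoch_inf x Q \<noteq> 0"
    proof (rule qpoch_inf_nonzero[OF Q])
      show "x * Q ^ k \<noteq> 1" for k
        using assms(4)[of "int k"] by (simp add: Q_def powi_double)
    qed
    \<comment> \<open>A zero of the second product would be a pole of the series at a negative
      index.\<close>
    moreover have "qpoch_inf (Q / x) Q \<noteq> 0"
    proof (rule qpoch_inf_nonzero[OF Q])
      show "Q / x * Q ^ k \<noteq> 1" for k
      proof
        assume "Q / x * Q ^ k = 1"
        hence "x = Q ^ Suc k"
          using assms(3) by (simp add: field_simps)
        moreover have "q powi (2 * (- int (Suc k))) = inverse (Q ^ Suc k)"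
          unfolding Q_def powi_double power_int_minus power_int_of_nat ..
        moreover have "Q ^ Suc k \<noteq> 0"
          using assms(2) by (simp add: Q_def)
        ultimately have "x * q powi (2 * (- int (Suc k))) = 1"
          by (metis right_inverse)
        with assms(4) show False
          by blast
      qed
    qed
    ultimately show ?thesis
      unfolding jtheta_def by (intro tendsto_intros LIMSEQ_Suc[OF qpoch_tendsto] Q) auto
  qed
  ultimately have "inverse (qpoch_inf Q Q) * inverse (qpoch_inf Q Q) * infsum t UNIV = 1 / jtheta x Q"
    by (rule LIMSEQ_unique)
  hence "infsum t UNIV = (qpoch_inf Q Q)\<^sup>2 / jtheta x Q"
    using qpoch_inf_self_nonzero[OF Q] by (simp add: field_simps power2_eq_square)
  thus ?thesis
    using has_sum_infsum[OF abs_summable_summable[OF t]] by (simp add: t_def Q_def)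
qed

section \<open>The Jacobi triple product\<close>

lemma gaussian_powi_summable:
  fixes q z :: complex and a b :: int
  assumes "norm q < 1" "q \<noteq> 0" "z \<noteq> 0" "a > 0"
  shows "(\<lambda>k. norm (q powi (a * k\<^sup>2 + b * k) * z powi k)) summable_on UNIV"
proof -
  \<comment> \<open>With this \<open>d\<close> the growth of \<open>z powi k\<close> in either
    direction is dominated by a power of \<open>q\<close> linear in \<open>k\<close>, so only the
    linear coefficient of the Gaussian exponent changes.\<close>
  obtain d where d: "norm q ^ d < min (norm z) (1 / norm z)"
    using real_arch_pow_inv[of "min (norm z) (1 / norm z)" "norm q"] assms by auto
  define r where "r = norm q ^ d"
  have r: "r > 0" "norm z \<le> inverse r" "inverse (norm z) \<le> inverse r"
    using d assms by (auto simp: r_def field_simps)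
  have le: "norm (z powi k) \<le> norm (q powi (- int d * k)) + norm (q powi (int d * k))" for k
  proof (cases "k \<ge> 0")
    case True
    have "norm (z powi k) = norm z ^ nat k"
      using True by (simp add: power_int_def norm_power)
    also have "\<dots> \<le> inverse r ^ nat k"
      using r by (intro power_mono) auto
    also have "\<dots> = norm (q powi (- int d * k))"
    proof -
      have "q powi (- int d * k) = inverse (q ^ d) ^ nat k"
        using True powi_power[of q "- int d" "nat k"] by (simp add: power_int_minus)
      thus ?thesis
        by (simp add: r_def norm_power norm_inverse)
    qed
    finally show ?thesis
      by (simp add: add_increasing2)
  next
    case False
    have "norm (z powi k) = inverse (norm z) ^ nat (- k)"
      using False by (simp add: power_int_def norm_power norm_inverse)
    also have "\<dots> \<le> inverse r ^ nat (- k)"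
      using r by (intro power_mono) auto
    also have "\<dots> = norm (q powi (int d * k))"
    proof -
      have "q powi (int d * k) = inverse (q ^ d) ^ nat (- k)"
        using False powi_power[of q "- int d" "nat (- k)"] by (simp add: power_int_minus)
      thus ?thesis
        by (simp add: r_def norm_power norm_inverse)
    qed
    finally show ?thesis
      by (simp add: add_increasing)
  qed
  have bound: "norm (q powi (a * k\<^sup>2 + b * k) * z powi k)
      \<le> norm (q powi (a * k\<^sup>2 + (b - int d) * k)) + norm (q powi (a * k\<^sup>2 + (b + int d) * k))" for k
  proof -
    have "norm (q powi (a * k\<^sup>2 + b * k) * z powi k)
      \<le> norm (q powi (a * k\<^sup>2 + b * k)) * (norm (q powi (- int d * k)) + norm (q powi (int d * k)))"
      unfolding norm_mult by (intro mult_left_mono le) auto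
    also have "\<dots> = norm (q powi (a * k\<^sup>2 + b * k) * q powi (- int d * k)) + norm (q powi (a * k\<^sup>2 + b * k) * q powi (int d * k))"
      by (simp add: norm_mult distrib_left)
    also have "q powi (a * k\<^sup>2 + b * k) * q powi (- int d * k) = q powi (a * k\<^sup>2 + (b - int d) * k)"
      using assms(2) by (subst power_int_add[symmetric]) (auto simp: algebra_simps)
    also have "q powi (a * k\<^sup>2 + b * k) * q powi (int d * k) = q powi (a * k\<^sup>2 + (b + int d) * k)"
      using assms(2) by (subst power_int_add[symmetric]) (auto simp: algebra_simps)
    finally show ?thesis .
  qed
  have "(\<lambda>k. norm (q powi (a * k\<^sup>2 + (b - int d) * k)) + norm (q powi (a * k\<^sup>2 + (b + int d) * k))) summable_on UNIV"
    by (intro summable_on_add gaussian_summable assms)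
  thus ?thesis
    by (rule Infinite_Sum.abs_summable_on_comparison_test') (rule bound)
qed

text \<open>The q-binomial theorem for \<open>2 * n\<close> factors, started at
  \<open>z * q powi (- 2 * n)\<close>. The first half of the product is reversed by
  \<open>qpoch_reverse\<close>, the second half is the symbol at \<open>z\<close>.\<close>

lemma triple_product_finite:
  assumes "norm q < 1" "q \<noteq> 0" "z \<noteq> 0"
  shows "(\<Sum>k\<in>{- int n..int n}. (-1) powi k * q powi (k * (k - 1)) * z powi k * qbin (q\<^sup>2) (n + n) (nat (int n + k)))
         = qpoch z (q\<^sup>2) n * qpoch (q\<^sup>2 / z) (q\<^sup>2) n" (is "sum ?f _ = _")
proof -
  define c where "c = (- z) ^ n * q powi (- int n * (int n + 1))"
  have c: "c \<noteq> 0"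
    using assms by (simp add: c_def)
  define y where "y = z * q powi (- 2 * int (Suc n))"
  have y: "y * q\<^sup>2 = z * q powi (- 2 * int n)"
  proof -
    have "q powi (- 2 * int (Suc n)) * q powi 2 = q powi (- 2 * int n)"
      using assms by (subst power_int_add[symmetric]) auto
    thus ?thesis
      by (simp add: y_def)
  qed
  have coeff: "(-1) ^ j * q ^ (j * (j + 1)) * qbin (q\<^sup>2) (n + n) j * y ^ j = c * ?f (int j - int n)" for j
  proof -
    have "q ^ (j * (j + 1)) * (q powi (- 2 * int (Suc n))) ^ j = q powi (int (j * (j + 1)) + (- 2 * int (Suc n)) * int j)"
    proof -
      have "(q powi (- 2 * int (Suc n))) ^ j = q powi (- 2 * int (Suc n) * int j)"
        by (rule powi_power)
      thus ?thesis
        using assms(2) by (subst power_int_add) (auto simp only: power_int_of_nat)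
    qed
    also have "int (j * (j + 1)) + (- 2 * int (Suc n)) * int j = - int n * (int n + 1) + (int j - int n) * (int j - int n - 1)"
      by (simp add: algebra_simps)
    also have "q powi \<dots> = q powi (- int n * (int n + 1)) * q powi ((int j - int n) * (int j - int n - 1))"
      using assms(2) by (intro power_int_add) auto
    finally have e: "q ^ (j * (j + 1)) * (q powi (- 2 * int (Suc n))) ^ j =
      q powi (- int n * (int n + 1)) * q powi ((int j - int n) * (int j - int n - 1))" .
    have "(- z) ^ j = (- z) powi (int n + (int j - int n))"
      by simp
    also have "\<dots> = (- z) powi int n * (- z) powi (int j - int n)"
      using assms(3) by (intro power_int_add) auto
    also have "(- z) powi (int j - int n) = (-1) powi (int j - int n) * z powi (int j - int n)"
      by (simp flip: power_int_mult_distrib)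
    finally have s: "(- z) ^ j = (- z) ^ n * ((-1) powi (int j - int n) * z powi (int j - int n))"
      by (simp only: power_int_of_nat)
    have "(-1) ^ j * q ^ (j * (j + 1)) * qbin (q\<^sup>2) (n + n) j * y ^ j
      = (q ^ (j * (j + 1)) * (q powi (- 2 * int (Suc n))) ^ j) * (- z) ^ j * qbin (q\<^sup>2) (n + n) j"
      unfolding y_def power_mult_distrib power_minus[of z] by (simp only: mult_ac)
    also have "\<dots> = c * ?f (int j - int n)"
      unfolding e s c_def by (simp add: mult_ac)
    finally show ?thesis .
  qed
  have "c * sum ?f {- int n..int n} = (\<Sum>j\<le>n + n. c * ?f (int j - int n))"
    unfolding sum_int_shift by (simp add: sum_distrib_left)
  also have "\<dots> = qpoch (y * q\<^sup>2) (q\<^sup>2) (n + n)"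
    unfolding qbinomial_theorem[OF assms(1)] by (intro sum.cong refl coeff[symmetric])
  also have "\<dots> = qpoch (z * q powi (- 2 * int n)) (q\<^sup>2) n * qpoch z (q\<^sup>2) n"
  proof -
    have "q powi (- 2 * int n) * (q\<^sup>2) ^ n = q powi (- 2 * int n) * q powi (2 * int n)"
      by (simp add: powi_double)
    also have "\<dots> = 1"
      using assms(2) by (subst power_int_add[symmetric]) auto
    finally show ?thesis
      unfolding y qpoch_add mult.assoc by simp
  qed
  also have "\<dots> = c * (qpoch z (q\<^sup>2) n * qpoch (q\<^sup>2 / z) (q\<^sup>2) n)"
    unfolding qpoch_reverse[OF assms(2,3)] c_def by (simp only: mult_ac)
  finally show ?thesis
    using c by simp
qed

text \<open>The coefficient \<open>qbin (q^2) (2 * n) (n + k)\<close> of the finite form tends to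
  \<open>1 / (q^2;q^2)_inf\<close> for each \<open>k\<close> and is bounded uniformly in
  \<open>n\<close> and \<open>k\<close>.\<close>

theorem triple_product:
  assumes "norm q < 1" "q \<noteq> 0" "z \<noteq> 0"
  shows "((\<lambda>k. (-1) powi k * q powi (k * (k - 1)) * z powi k) has_sum qpoch_inf (q\<^sup>2) (q\<^sup>2) * jtheta z (q\<^sup>2)) UNIV"
proof -
  define Q where "Q = q\<^sup>2"
  have Q: "norm Q < 1"
    using assms unfolding Q_def by (intro norm_power_less_1) auto
  define t where "t = (\<lambda>k. (-1) powi k * q powi (k * (k - 1)) * z powi k)"
  define a where "a = (\<lambda>n k. if k \<in> {- int (n + 0)..int n} then
      qpoch Q Q (n + n) * inverse (qpoch Q Q (nat (int n + k))) * inverse (qpoch Q Q (nat (int n + - k))) * t k else 0)"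
  have t: "(\<lambda>k. norm (t k)) summable_on UNIV"
    using gaussian_powi_summable[OF assms, of 1 "-1"]
    by (simp add: t_def norm_mult norm_power_int power2_eq_square algebra_simps)
  obtain K where K: "K > 0" "\<And>n. norm (inverse (qpoch Q Q n)) \<le> K"
    using inverse_qpoch_bounded[OF Q power_mult_neq_1[OF Q Q]] by metis
  obtain K' where K': "K' > 0" "\<And>n. norm (qpoch Q Q n) \<le> K'"
    using qpoch_bounded[OF Q] by metis
  have "infsum (a n) UNIV = qpoch z Q n * qpoch (Q / z) Q n" for n
  proof -
    have "infsum (a n) UNIV = infsum (a n) {- int n..int n}"
      by (rule infsum_cong_neutral) (auto simp: a_def)
    also have "\<dots> = sum (a n) {- int n..int n}"
      by simp
    also have "\<dots> = qpoch z Q n * qpoch (Q / z) Q n"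
      unfolding Q_def triple_product_finite[OF assms, symmetric]
    proof (intro sum.cong refl)
      fix k assume k: "k \<in> {- int n..int n}"
      have "nat (int n + k) \<le> n + n" "n + n - nat (int n + k) = nat (int n - k)"
        using k by auto
      thus "a n k = (-1) powi k * q powi (k * (k - 1)) * z powi k * qbin (q\<^sup>2) (n + n) (nat (int n + k))"
        using k by (simp add: a_def t_def Q_def qbin_def divide_simps)
    qed
    finally show ?thesis .
  qed
  moreover have "(\<lambda>n. infsum (a n) UNIV) \<longlonglongrightarrow> infsum (\<lambda>k. qpoch_inf Q Q * inverse (qpoch_inf Q Q) * inverse (qpoch_inf Q Q) * t k) UNIV"
  proof (rule infsum_int_dominated(2))
    fix k
    have "(\<lambda>n. qpoch Q Q (n + n)) \<longlonglongrightarrow> qpoch_inf Q Q"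
      by (rule filterlim_compose[OF qpoch_tendsto[OF Q]]) (auto simp: filterlim_at_top eventually_sequentially intro: trans_le_add1)
    hence "(\<lambda>n. qpoch Q Q (n + n) * inverse (qpoch Q Q (nat (int n + k))) * inverse (qpoch Q Q (nat (int n + - k))) * t k) \<longlonglongrightarrow> qpoch_inf Q Q * inverse (qpoch_inf Q Q) * inverse (qpoch_inf Q Q) * t k"
      by (intro tendsto_intros qpoch_nat_diff_tendsto Q qpoch_inf_self_nonzero)
    thus "(\<lambda>n. a n k) \<longlonglongrightarrow> qpoch_inf Q Q * inverse (qpoch_inf Q Q) * inverse (qpoch_inf Q Q) * t k"
      by (rule Lim_transform_eventually)
         (use eventually_int_interval[of k 0] in \<open>eventually_elim, auto simp: a_def\<close>)
  next
    show "norm (a n k) \<le> K' * K * K * norm (t k)" for n k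
      using K K' by (auto simp: a_def norm_mult intro!: mult_mono)
    show "(\<lambda>k. K' * K * K * norm (t k)) summable_on UNIV"
      by (intro summable_on_cmult_right t)
  qed
  ultimately have "(\<lambda>n. qpoch z Q n * qpoch (Q / z) Q n) \<longlonglongrightarrow> inverse (qpoch_inf Q Q) * infsum t UNIV"
    using qpoch_inf_self_nonzero[OF Q] by (simp add: infsum_cmult_right')
  moreover have "(\<lambda>n. qpoch z Q n * qpoch (Q / z) Q n) \<longlonglongrightarrow> jtheta z Q"
    unfolding jtheta_def by (intro tendsto_intros qpoch_tendsto Q)
  ultimately have "inverse (qpoch_inf Q Q) * infsum t UNIV = jtheta z Q"
    by (rule LIMSEQ_unique)
  hence "infsum t UNIV = qpoch_inf Q Q * jtheta z Q"
    using qpoch_inf_self_nonzero[OF Q] by (simp add: field_simps)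
  thus ?thesis
    using has_sum_infsum[OF abs_summable_summable[OF t]] by (simp add: t_def Q_def)
qed

section \<open>Quasi-periodicity of the theta function\<close>

lemma jtheta_shift:
  assumes "norm q < 1" "q \<noteq> 0" "z \<noteq> 0"
  shows "jtheta (z * q) q = - jtheta z q / z"
proof -
  have "jtheta (z * q) q = qpoch_inf (z * q) q * ((1 - 1 / z) * qpoch_inf (q / z) q)"
    using assms qpoch_inf_head[OF assms(1), of "1 / z"] by (simp add: jtheta_def)
  also have "\<dots> = - ((1 - z) * qpoch_inf (z * q) q * qpoch_inf (q / z) q) / z"
    using assms(3) by (simp add: divide_simps) (simp add: algebra_simps)
  also have "(1 - z) * qpoch_inf (z * q) q * qpoch_inf (q / z) q = jtheta z q"
    using qpoch_inf_head[OF assms(1), of z] by (simp add: jtheta_def)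
  finally show ?thesis .
qed

text \<open>For \<open>k \<ge> 0\<close> the multiplier is the product of
  \<open>- 1 / (z * q powi (2 * i))\<close> over \<open>0 \<le> i < k\<close>. Negative
  \<open>k\<close> is covered as well, since the inner sums of the double series in
  \<open>watson_relation\<close> are shifted by an arbitrary integer.\<close>

lemma jtheta_quasi_period:
  assumes "norm q < 1" "q \<noteq> 0" "z \<noteq> 0"
  shows "jtheta (z * q powi (2 * k)) (q\<^sup>2) = (-1) powi k * z powi (- k) * q powi (- (k * (k - 1))) * jtheta z (q\<^sup>2)"
proof -
  have q2: "norm (q\<^sup>2) < 1"
    using assms by (intro norm_power_less_1) auto
  define R where "R = (\<lambda>k. (-1) powi k * z powi (- k) * q powi (- (k * (k - 1))))"
  have R: "R (k + 1) = - R k / (z * q powi (2 * k))" for k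
  proof -
    have "q powi (- ((k + 1) * (k + 1 - 1))) = q powi (- (k * (k - 1)) - 2 * k)"
      by (simp add: algebra_simps)
    also have "\<dots> = q powi (- (k * (k - 1))) / q powi (2 * k)"
      using assms by (intro power_int_diff) auto
    finally have e: "q powi (- ((k + 1) * (k + 1 - 1))) = q powi (- (k * (k - 1))) / q powi (2 * k)" .
    have "z powi (- (k + 1)) = z powi (- k - 1)"
      by simp
    also have "\<dots> = z powi (- k) / z"
      using assms by (subst power_int_diff) auto
    finally show ?thesis
      unfolding R_def e minus_one_powi_add by simp
  qed
  have step: "jtheta (z * q powi (2 * (k + 1))) (q\<^sup>2) = - jtheta (z * q powi (2 * k)) (q\<^sup>2) / (z * q powi (2 * k))" for k
  proof -
    have "q powi (2 * (k + 1)) = q powi (2 * k) * q\<^sup>2"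
      unfolding powi_double using assms by (subst power_int_add) auto
    hence "z * q powi (2 * (k + 1)) = (z * q powi (2 * k)) * q\<^sup>2"
      by (simp only: mult.assoc)
    moreover have "jtheta (z * q powi (2 * k) * q\<^sup>2) (q\<^sup>2) = - jtheta (z * q powi (2 * k)) (q\<^sup>2) / (z * q powi (2 * k))"
      using assms by (intro jtheta_shift q2) auto
    ultimately show ?thesis
      by (simp only:)
  qed
  have "jtheta (z * q powi (2 * k)) (q\<^sup>2) = R k * jtheta z (q\<^sup>2)"
  proof (induction k rule: int_induct[of _ 0])
    case base
    show ?case by (simp add: R_def)
  next
    case (step1 k)
    thus ?case unfolding step R by simp
  next
    case (step2 k)
    define w where "w = z * q powi (2 * (k - 1))"
    have w: "w \<noteq> 0"
      using assms by (simp add: w_def)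
    have "jtheta (z * q powi (2 * (k - 1))) (q\<^sup>2) = - (w * jtheta (z * q powi (2 * k)) (q\<^sup>2))"
      using step[of "k - 1"] w by (simp add: w_def)
    also have "\<dots> = - (w * R k) * jtheta z (q\<^sup>2)"
      unfolding step2.IH by simp
    also have "- (w * R k) = R (k - 1)"
      using R[of "k - 1"] w by (simp add: w_def)
    finally show ?case .
  qed
  thus ?thesis
    by (simp add: R_def)
qed

section \<open>Appell--Lerch series of level three\<close>

text \<open>Sorting partitions by their largest \<open>m\<close> by \<open>m + L\<close> rectangle
  explains why the sum does not depend on \<open>L\<close>. The independence is proved by
  telescoping. Letting \<open>L\<close> tend to infinity then kills every term except
  \<open>m = 0\<close>.\<close>

lemma durfee_rectangle:
  fixes p :: complex
  assumes "norm p < 1"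
  shows "(\<lambda>m. p ^ (m * (m + L)) / (qpoch p p m * qpoch p p (m + L))) sums (1 / qpoch_inf p p)"
proof -
  define d where "d = (\<lambda>L m. p ^ (m * (m + L)) / (qpoch p p m * qpoch p p (m + L)))"
  note nz = qpoch_self_nonzero[OF assms]
  obtain K where K: "K > 0" "\<And>n. norm (inverse (qpoch p p n)) \<le> K"
    using inverse_qpoch_bounded[OF assms power_mult_neq_1[OF assms assms]] by metis
  have pow_le: "norm p ^ (m * (m + L)) \<le> norm p ^ m" for m L
  proof (rule power_decreasing)
    show "m \<le> m * (m + L)"
      by (cases m) auto
  qed (use assms in auto)
  have bound: "norm (d L m) \<le> K * K * norm p ^ m" for L m
  proof -
    have "norm (d L m) = norm p ^ (m * (m + L)) * (norm (inverse (qpoch p p m)) * norm (inverse (qpoch p p (m + L))))"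
      by (simp add: d_def norm_mult norm_divide norm_power norm_inverse divide_inverse)
    also have "\<dots> \<le> norm p ^ m * (K * K)"
      using K by (intro mult_mono pow_le) auto
    finally show ?thesis
      by (simp add: mult_ac)
  qed
  have geo: "summable (\<lambda>m. K * K * norm p ^ m)"
    using assms by (intro summable_mult summable_geometric) auto
  have summ: "summable (d L)" for L
    by (rule summable_comparison_test'[OF geo]) (rule bound)
  text \<open>\<open>G\<close> is the telescoping certificate of Cauchy's identity
    \<open>\<Sum> p\<^bsup>m\<^sup>2\<^esup> z\<^sup>m / ((p;p)\<^sub>m (zp;p)\<^sub>m) = 1 / (zp;p)\<^sub>\<infinity>\<close> at \<open>z = p\<^sup>L\<close>.\<close>
  define G where "G = (\<lambda>L m. p ^ (m * (m + L)) * (1 - p ^ m) / (qpoch p p m * qpoch p p (m + L)))"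
  have diff: "d L m - d (Suc L) m = G L m - G L (Suc m)" for L m
  proof -
    define P where "P = qpoch p p m"
    define R where "R = qpoch p p (m + L)"
    define A where "A = p ^ (m * (m + L))"
    define u where "u = p ^ m"
    define v where "v = p ^ L"
    have nz': "P \<noteq> 0" "R \<noteq> 0" "1 - p * u \<noteq> 0" "1 - p * (u * v) \<noteq> 0"
      using nz power_mult_neq_1[OF assms assms, of m] power_mult_neq_1[OF assms assms, of "m + L"]
      by (auto simp: P_def R_def u_def v_def power_add)
    have e: "p ^ (m * (m + Suc L)) = A * u" "p ^ (Suc m * (Suc m + L)) = A * u * u * v * p"
      by (simp_all add: A_def u_def v_def power_add[symmetric] algebra_simps power_Suc[symmetric] del: power_Suc)
    have 1: "d L m = A / (P * R)" "d (Suc L) m = A * u / (P * (R * (1 - p * (u * v))))"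
      unfolding d_def e by (simp_all add: A_def P_def R_def u_def v_def qpoch_Suc power_add)
    have 2: "G L m = A * (1 - u) / (P * R)"
      "G L (Suc m) = A * u * u * v * p * (1 - p * u) / (P * (1 - p * u) * (R * (1 - p * (u * v))))"
      unfolding G_def e by (simp_all add: A_def P_def R_def u_def v_def qpoch_Suc power_add)
    show ?thesis
      unfolding 1 2 using nz' by (simp add: divide_simps) (simp add: algebra_simps)
  qed
  have G: "G L \<longlonglongrightarrow> 0" for L
  proof (rule Lim_null_comparison)
    have "G L m = d L m * (1 - p ^ m)" for m
      by (simp add: G_def d_def)
    moreover have "norm (1 - p ^ m) \<le> 2" for m
    proof -
      have "norm (1 - p ^ m) \<le> 1 + norm p ^ m"
        using norm_triangle_ineq4[of 1 "p ^ m"] by (simp add: norm_power)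
      also have "norm p ^ m \<le> 1"
        using assms by (intro power_le_one) auto
      finally show ?thesis by simp
    qed
    ultimately have "norm (G L m) \<le> K * K * norm p ^ m * 2" for m
      using bound[of L m] by (auto simp: norm_mult intro!: mult_mono)
    thus "\<forall>\<^sub>F m in sequentially. norm (G L m) \<le> K * K * norm p ^ m * 2"
      by simp
    have "(\<lambda>m. K * K * norm p ^ m * 2) \<longlonglongrightarrow> K * K * 0 * 2"
      using assms by (intro tendsto_intros LIMSEQ_power_zero) auto
    thus "(\<lambda>m. K * K * norm p ^ m * 2) \<longlonglongrightarrow> 0"
      by simp
  qed
  have "suminf (d L) - suminf (d (Suc L)) = 0" for L
  proof -
    have 1: "(\<lambda>m. d L m - d (Suc L) m) sums (suminf (d L) - suminf (d (Suc L)))"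
      by (intro sums_diff summable_sums summ)
    have 2: "(\<lambda>m. d L m - d (Suc L) m) sums (G L 0 - 0)"
      unfolding diff by (rule telescope_sums'[OF G])
    show ?thesis
      unfolding sums_unique2[OF 1 2] by (simp add: G_def)
  qed
  hence const: "suminf (d L) = suminf (d 0)" for L
    by (induction L) auto
  have lim: "(\<lambda>L. suminf (d L)) \<longlonglongrightarrow> (\<Sum>m. if m = 0 then 1 / qpoch_inf p p else 0)"
  proof (rule tannerys_theorem[where a = "\<lambda>m L. d L m" and M = "\<lambda>m. K * K * norm p ^ m", THEN conjunct2, THEN conjunct2])
    show "(\<lambda>L. d L m) \<longlonglongrightarrow> (if m = 0 then 1 / qpoch_inf p p else 0)" for m
    proof (cases "m = 0")
      case True
      have "(\<lambda>L. 1 / qpoch p p L) \<longlonglongrightarrow> 1 / qpoch_inf p p"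
        by (intro tendsto_intros qpoch_tendsto assms qpoch_inf_self_nonzero)
      thus ?thesis
        using True by (simp add: d_def)
    next
      case False
      have l1: "(\<lambda>L. (p ^ m) ^ L) \<longlonglongrightarrow> 0"
        using False assms by (intro LIMSEQ_power_zero norm_power_less_1) auto
      have l2: "(\<lambda>L. qpoch p p (m + L)) \<longlonglongrightarrow> qpoch_inf p p"
        using LIMSEQ_ignore_initial_segment[OF qpoch_tendsto[OF assms, of p], of m] by (simp add: add.commute)
      have "(\<lambda>L. p ^ (m * m) * (p ^ m) ^ L * inverse (qpoch p p m) * inverse (qpoch p p (m + L)))
          \<longlonglongrightarrow> p ^ (m * m) * 0 * inverse (qpoch p p m) * inverse (qpoch_inf p p)"
        by (intro tendsto_mult tendsto_const tendsto_inverse l1 l2 qpoch_inf_self_nonzero assms)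
      hence "(\<lambda>L. p ^ (m * m) * (p ^ m) ^ L * inverse (qpoch p p m) * inverse (qpoch p p (m + L))) \<longlonglongrightarrow> 0"
        by (simp only: mult_zero_right mult_zero_left)
      moreover have "d L m = p ^ (m * m) * (p ^ m) ^ L * inverse (qpoch p p m) * inverse (qpoch p p (m + L))" for L
        unfolding d_def power_mult[symmetric] power_add[symmetric] distrib_left[symmetric]
        by (simp add: divide_inverse)
      ultimately show ?thesis
        using False by (simp only: if_False)
    qed
    show "\<forall>\<^sub>F (m, L) in sequentially \<times>\<^sub>F sequentially. norm (d L m) \<le> K * K * norm p ^ m"
      using bound by (intro always_eventually) auto
  qed (use geo in auto)
  have val: "(\<Sum>m::nat. if m = 0 then 1 / qpoch_inf p p else 0) = 1 / qpoch_inf p p"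
    using sums_single[of 0 "\<lambda>_. 1 / qpoch_inf p p"] by (simp add: sums_iff)
  have "(\<lambda>L. suminf (d L)) = (\<lambda>L. suminf (d 0))"
    by (rule ext) (rule const)
  from lim[unfolded this val] have "suminf (d 0) = 1 / qpoch_inf p p"
    by (rule LIMSEQ_unique[OF tendsto_const])
  thus ?thesis
    using summable_sums[OF summ[of L]] const[of L] by (simp add: d_def)
qed

lemma has_sum_finite_sum:
  fixes f :: "'i \<Rightarrow> 'a \<Rightarrow> complex"
  assumes "\<And>n. n \<in> I \<Longrightarrow> (f n has_sum s n) A"
  shows "((\<lambda>k. \<Sum>n\<in>I. f n k) has_sum (\<Sum>n\<in>I. s n)) A"
  using assms by (induction I rule: infinite_finite_induct) (auto intro!: has_sum_add)

text \<open>When the finite partial fractions are summed against \<open>q\<^bsup>2n(n+1)\<^esup>\<close>, the coefficient of each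
  pole of the universal mock theta function \<open>g\<^sub>3(x, q\<^sup>2)\<close> is a Durfee rectangle sum.\<close>

theorem universal_mock_theta_sums:
  fixes q x :: complex
  assumes "norm q < 1" "q \<noteq> 0" "x \<noteq> 0" "\<And>k::int. x * q powi (2 * k) \<noteq> 1"
  shows "(\<lambda>n. q ^ (2 * n * (n + 1)) / (qpoch x (q\<^sup>2) (n + 1) * qpoch (q\<^sup>2 / x) (q\<^sup>2) (n + 1))) sums
    ((\<Sum>\<^sub>\<infinity>k. (-1) powi k * q powi (3 * k * (k + 1)) / (1 - x * q powi (2 * k))) / qpoch_inf (q\<^sup>2) (q\<^sup>2))"
proof -
  define Q where "Q = q\<^sup>2"
  have Q: "norm Q < 1"
    using assms unfolding Q_def by (intro norm_power_less_1) auto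
  define t where "t = (\<lambda>k. (-1) powi k * q powi (k * (k + 1)) / (1 - x * q powi (2 * k)))"
  define c where "c = (\<lambda>n k. if k \<in> {- int (Suc n)..int n} then
      inverse (qpoch Q Q (nat (int n - k))) * inverse (qpoch Q Q (nat (int n + k + 1))) else 0)"
  define a where "a = (\<lambda>N k. (\<Sum>n<N. Q ^ (n * (n + 1)) * c n k) * t k)"
  have t: "(\<lambda>k. norm (t k)) summable_on UNIV"
    using theta_term_summable[OF assms, of 1 1] by (simp add: t_def power2_eq_square algebra_simps)
  obtain K where K: "K > 0" "\<And>n. norm (inverse (qpoch Q Q n)) \<le> K"
    using inverse_qpoch_bounded[OF Q power_mult_neq_1[OF Q Q]] by metis
  have c_bound: "norm (c n k) \<le> K * K" for n k
    using K by (auto simp: c_def norm_mult intro!: mult_mono)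
  have fin: "(\<Sum>\<^sub>\<infinity>k. c n k * t k) = 1 / (qpoch x Q (n + 1) * qpoch (Q / x) Q (n + 1))" for n
  proof -
    have "(\<Sum>\<^sub>\<infinity>k. c n k * t k) = infsum (\<lambda>k. c n k * t k) {- int (Suc n)..int n}"
      by (rule infsum_cong_neutral) (auto simp: c_def)
    also have "\<dots> = (\<Sum>k\<in>{- int (Suc n)..int n}. c n k * t k)"
      by simp
    also have "\<dots> = 1 / (qpoch x Q (n + 1) * qpoch (Q / x) Q (n + 1))"
      unfolding Q_def Suc_eq_plus1[symmetric] theta_partial_fraction_finite[OF assms, symmetric]
      by (intro sum.cong refl) (auto simp: c_def t_def Q_def divide_simps)
    finally show ?thesis .
  qed
  have ct: "(\<lambda>k. c n k * t k) summable_on UNIV" for n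
  proof -
    have "norm (c n k * t k) \<le> K * K * norm (t k)" for k
      unfolding norm_mult by (intro mult_right_mono c_bound) auto
    hence "(\<lambda>k. norm (c n k * t k)) summable_on UNIV"
      by (rule Infinite_Sum.abs_summable_on_comparison_test'[OF summable_on_cmult_right[OF t]])
    thus ?thesis
      by (rule abs_summable_summable)
  qed
  have a_sum: "infsum (a N) UNIV = (\<Sum>n<N. q ^ (2 * n * (n + 1)) / (qpoch x Q (n + 1) * qpoch (Q / x) Q (n + 1)))" for N
  proof -
    have "a N = (\<lambda>k. \<Sum>n<N. Q ^ (n * (n + 1)) * (c n k * t k))"
      by (simp add: a_def sum_distrib_right mult.assoc)
    hence "infsum (a N) UNIV = (\<Sum>\<^sub>\<infinity>k. \<Sum>n<N. Q ^ (n * (n + 1)) * (c n k * t k))"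
      by simp
    also have "\<dots> = (\<Sum>n<N. Q ^ (n * (n + 1)) * (\<Sum>\<^sub>\<infinity>k. c n k * t k))"
      by (intro infsumI has_sum_finite_sum has_sum_cmult_right has_sum_infsum ct)
    finally have "infsum (a N) UNIV = (\<Sum>n<N. Q ^ (n * (n + 1)) * (\<Sum>\<^sub>\<infinity>k. c n k * t k))" .
    moreover have "Q ^ (n * (n + 1)) = q ^ (2 * n * (n + 1))" for n
      unfolding Q_def power_mult[symmetric] mult.assoc ..
    ultimately show ?thesis
      by (simp only: fin mult_1_right times_divide_eq_right)
  qed
  have coeff: "(\<lambda>n. Q ^ (n * (n + 1)) * c n k) sums (q powi (2 * k * (k + 1)) / qpoch_inf Q Q)" for k
  proof -
    \<comment> \<open>The indices \<open>k\<close> and \<open>- 1 - k\<close> have the same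
      coefficient. \<open>j\<close> is the least \<open>n\<close> whose interval contains
      \<open>k\<close>, and with \<open>n = m + j\<close> the two Pochhammer lengths are
      \<open>m\<close> and \<open>m + (2 * j + 1)\<close>, a rectangle with excess
      \<open>2 * j + 1\<close>.\<close>
    define j where "j = (if k \<ge> 0 then nat k else nat (- k - 1))"
    have k: "k = int j \<or> k = - int j - 1"
      by (auto simp: j_def)
    have zero: "Q ^ (n * (n + 1)) * c n k = 0" if "n < j" for n
      using k that by (auto simp: c_def)
    have shifted: "Q ^ ((m + j) * (m + j + 1)) * c (m + j) k
        = q powi (2 * k * (k + 1)) * (Q ^ (m * (m + (2 * j + 1))) / (qpoch Q Q m * qpoch Q Q (m + (2 * j + 1))))" for m
    proof -
      have "2 * k * (k + 1) = int (2 * (j * (j + 1)))"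
        using k by (elim disjE, simp_all only:, simp_all add: algebra_simps)
      hence "q powi (2 * k * (k + 1)) = q ^ (2 * (j * (j + 1)))"
        by (simp only: power_int_of_nat)
      hence e: "q powi (2 * k * (k + 1)) = Q ^ (j * (j + 1))"
        by (simp only: Q_def power_mult)
      have "Q ^ ((m + j) * (m + j + 1)) = Q ^ (j * (j + 1)) * Q ^ (m * (m + (2 * j + 1)))"
      proof -
        have "(m + j) * (m + j + 1) = j * (j + 1) + m * (m + (2 * j + 1))"
          by (simp add: algebra_simps)
        thus ?thesis
          by (simp only: power_add)
      qed
      moreover have "c (m + j) k = inverse (qpoch Q Q m) * inverse (qpoch Q Q (m + (2 * j + 1)))"
        using k
      proof
        assume k: "k = int j"
        have "nat (int (m + j) - k) = m" "nat (int (m + j) + k + 1) = m + (2 * j + 1)"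
          using k by auto
        thus ?thesis
          using k unfolding c_def by auto
      next
        assume k: "k = - int j - 1"
        have "nat (int (m + j) + k + 1) = m" "nat (int (m + j) - k) = m + (2 * j + 1)"
          using k by auto
        thus ?thesis
          using k unfolding c_def by auto
      qed
      ultimately show ?thesis
        unfolding e by (simp add: divide_inverse)
    qed
    have sh: "(\<lambda>m. Q ^ ((m + j) * (m + j + 1)) * c (m + j) k) sums (q powi (2 * k * (k + 1)) * (1 / qpoch_inf Q Q))"
      unfolding shifted by (intro sums_mult durfee_rectangle Q)
    have "(\<lambda>n. Q ^ (n * (n + 1)) * c n k) sums (q powi (2 * k * (k + 1)) * (1 / qpoch_inf Q Q))"
      using sums_zero_iff_shift[of j "\<lambda>n. Q ^ (n * (n + 1)) * c n k", OF zero] sh by blast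
    thus ?thesis
      by simp
  qed
  have "(\<lambda>N. infsum (a N) UNIV) \<longlonglongrightarrow> (\<Sum>\<^sub>\<infinity>k. q powi (2 * k * (k + 1)) / qpoch_inf Q Q * t k)"
  proof (rule infsum_int_dominated(2))
    show "(\<lambda>N. a N k) \<longlonglongrightarrow> q powi (2 * k * (k + 1)) / qpoch_inf Q Q * t k" for k
      unfolding a_def using coeff[of k] by (intro tendsto_intros) (simp add: sums_def)
  next
    \<comment> \<open>The partial sums of the coefficient series are bounded uniformly in
      \<open>N\<close> and \<open>k\<close>, so the summable \<open>t\<close> dominates when the two
      limits are exchanged.\<close>
    define C where "C = (\<Sum>n. norm Q ^ n) * (K * K)"
    show "norm (a N k) \<le> C * norm (t k)" for N k
    proof -
      have "norm (\<Sum>n<N. Q ^ (n * (n + 1)) * c n k) \<le> (\<Sum>n<N. norm Q ^ n * (K * K))"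
      proof (rule sum_norm_le)
        fix n
        have "norm Q ^ (n * (n + 1)) \<le> norm Q ^ n"
          using Q by (intro power_decreasing) auto
        thus "norm (Q ^ (n * (n + 1)) * c n k) \<le> norm Q ^ n * (K * K)"
          unfolding norm_mult norm_power using c_bound by (intro mult_mono) auto
      qed
      also have "\<dots> = (\<Sum>n<N. norm Q ^ n) * (K * K)"
        by (simp add: sum_distrib_right)
      also have "\<dots> \<le> C"
        unfolding C_def using Q by (intro mult_right_mono sum_le_suminf summable_geometric) auto
      finally show ?thesis
        unfolding a_def norm_mult by (intro mult_right_mono) auto
    qed
    show "(\<lambda>k. C * norm (t k)) summable_on UNIV"
      by (intro summable_on_cmult_right t)
  qed
  \<comment> \<open>The Durfee sums contribute \<open>2 * k * (k + 1)\<close> to the exponent and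
    the theta expansion \<open>k * (k + 1)\<close>. This is the origin of the factor 3.\<close>
  also have "(\<Sum>\<^sub>\<infinity>k. q powi (2 * k * (k + 1)) / qpoch_inf Q Q * t k)
    = (\<Sum>\<^sub>\<infinity>k. inverse (qpoch_inf Q Q) * ((-1) powi k * q powi (3 * k * (k + 1)) / (1 - x * q powi (2 * k))))"
  proof (rule infsum_cong)
    fix k
    have "q powi (3 * k * (k + 1)) = q powi (2 * k * (k + 1)) * q powi (k * (k + 1))"
      using assms(2) by (subst power_int_add[symmetric]) (auto simp: algebra_simps)
    thus "q powi (2 * k * (k + 1)) / qpoch_inf Q Q * t k = inverse (qpoch_inf Q Q) * ((-1) powi k * q powi (3 * k * (k + 1)) / (1 - x * q powi (2 * k)))"
      by (simp add: t_def divide_inverse)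
  qed
  finally show ?thesis
    unfolding sums_def a_sum by (simp add: infsum_cmult_right' Q_def divide_inverse mult.commute)
qed

text \<open>This is \<open>(q^2;q^2)_inf\<close> times the universal mock theta function
  \<open>g_3(x, q^2)\<close>.\<close>

definition lerch3 :: "complex \<Rightarrow> complex \<Rightarrow> complex" where
  "lerch3 q x = (\<Sum>\<^sub>\<infinity>k. (-1) powi k * q powi (3 * k * (k + 1)) / (1 - x * q powi (2 * k)))"

lemma powi_neq_1:
  fixes q :: complex
  assumes "norm q < 1" "q \<noteq> 0" "n \<noteq> 0"
  shows "norm (q powi n) \<noteq> 1"
proof
  assume "norm (q powi n) = 1"
  hence *: "norm q powi n = 1"
    by (simp add: norm_power_int)
  have "norm q ^ nat \<bar>n\<bar> = 1"
  proof (cases "n \<ge> 0")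
    case False
    hence "inverse (norm q) ^ nat \<bar>n\<bar> = 1"
      using * by (simp add: power_int_def)
    thus ?thesis
      by (simp add: power_inverse)
  qed (use * in \<open>simp add: power_int_def\<close>)
  moreover have "norm q ^ nat \<bar>n\<bar> < 1"
    using assms by (intro power_less_one_iff[THEN iffD2]) auto
  ultimately show False
    by simp
qed

lemma mult_powi_neq_1:
  fixes q c :: complex
  assumes "norm q < 1" "q \<noteq> 0" "norm c = 1" "n \<noteq> 0"
  shows "c * q powi n \<noteq> 1"
  using powi_neq_1[OF assms(1,2,4)] assms(3) by (metis mult_1 norm_mult norm_one)

lemma has_sum_diff:
  fixes f g :: "'a \<Rightarrow> complex"
  assumes "(f has_sum a) A" "(g has_sum b) A"
  shows "((\<lambda>x. f x - g x) has_sum (a - b)) A"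
  using has_sum_add[OF assms(1) has_sum_uminusI[OF assms(2)]] by simp

lemma theta_cubic_summable:
  fixes q x :: complex
  assumes "norm q < 1" "q \<noteq> 0" "x \<noteq> 0" "\<And>k::int. x * q powi (2 * k) \<noteq> 1"
  shows "(\<lambda>k. (-1) powi k * q powi (3 * k * (k + 1)) / (1 - x * q powi (2 * k))) summable_on UNIV"
  using abs_summable_summable[OF theta_term_summable[OF assms, of 3 3]]
  by (simp add: power2_eq_square algebra_simps)

lemma lerch3_has_sum:
  fixes q x :: complex
  assumes "norm q < 1" "q \<noteq> 0" "x \<noteq> 0" "\<And>k::int. x * q powi (2 * k) \<noteq> 1"
  shows "((\<lambda>k. (-1) powi k * q powi (3 * k * (k + 1)) / (1 - x * q powi (2 * k))) has_sum lerch3 q x) UNIV"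
  unfolding lerch3_def by (rule has_sum_infsum[OF theta_cubic_summable[OF assms]])

lemma signed_gaussian_summable:
  fixes q :: complex
  assumes "norm q < 1" "q \<noteq> 0" "a > 0"
  shows "(\<lambda>k. (-1) powi k * q powi (a * k\<^sup>2 + b * k)) summable_on UNIV"
proof (rule abs_summable_summable)
  show "(\<lambda>k. norm ((-1) powi k * q powi (a * k\<^sup>2 + b * k))) summable_on UNIV"
    using gaussian_summable[OF assms, of b] by (simp add: norm_mult norm_power_int)
qed

text \<open>The reflection \<open>k \<mapsto> -1 - k\<close> changes the sign of every term.\<close>
lemma signed_triangular_has_sum_0:
  fixes q :: complex
  assumes "norm q < 1" "q \<noteq> 0" "a > 0"
  shows "((\<lambda>k. (-1) powi k * q powi (a * k * (k + 1))) has_sum 0) UNIV"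
proof -
  define f where "f = (\<lambda>k. (-1) powi k * q powi (a * k * (k + 1)))"
  have "f summable_on UNIV"
    using signed_gaussian_summable[OF assms, of a]
    by (simp add: f_def power2_eq_square algebra_simps)
  then obtain S where S: "(f has_sum S) UNIV"
    by (auto simp: summable_on_def)
  have "f (-1 - k) = - f k" for k
  proof -
    have "a * (-1 - k) * ((-1 - k) + 1) = a * k * (k + 1)"
      by (simp add: algebra_simps)
    moreover have "(-1 :: complex) powi (-1 - k) = - ((-1) powi k)"
      by (simp add: power_int_minus_left)
    ultimately show ?thesis
      by (simp add: f_def)
  qed
  moreover have "((\<lambda>k. f (-1 - k)) has_sum S) UNIV"
    using S by (subst has_sum_reindex_bij_witness[of _ "\<lambda>k. -1 - k" "\<lambda>k. -1 - k" UNIV f]) auto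
  ultimately have "((\<lambda>k. - f k) has_sum S) UNIV"
    by simp
  hence "- S = S"
    by (rule has_sum_unique[OF has_sum_uminusI[OF S]])
  thus ?thesis
    using S by (simp add: f_def)
qed

text \<open>Division by \<open>d\<close> with remainder is a bijection onto pairs of residue and
  quotient. It is used with \<open>d = 3\<close> for xi and with \<open>d = 2\<close> for the parity
  splittings.\<close>

lemma has_sum_int_residues:
  fixes F :: "int \<Rightarrow> complex"
  assumes "F summable_on UNIV" "d > 0"
  shows "(\<lambda>m. F (d * m + j)) summable_on UNIV"
    and "(F has_sum (\<Sum>j\<in>{0..<d}. \<Sum>\<^sub>\<infinity>m. F (d * m + j))) UNIV"
proof -
  show summ: "(\<lambda>m. F (d * m + j)) summable_on UNIV" for j
  proof -
    have "F summable_on range (\<lambda>m. d * m + j)"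
      using assms(1) by (rule summable_on_subset_banach) auto
    thus ?thesis
      using assms(2) by (subst (asm) summable_on_reindex) (auto simp: inj_on_def o_def)
  qed
  have bij: "bij_betw (\<lambda>(j, m). d * m + j) ({0..<d} \<times> UNIV) UNIV"
    by (rule bij_betwI[of _ _ _ "\<lambda>n. (n mod d, n div d)"]) (use assms(2) in auto)
  have *: "((\<lambda>jm. F ((\<lambda>(j, m). d * m + j) jm)) has_sum infsum F UNIV) ({0..<d} \<times> UNIV)"
    using has_sum_infsum[OF assms(1)] by (subst has_sum_reindex_bij_betw[OF bij])
  have "((\<lambda>j. \<Sum>\<^sub>\<infinity>m. F (d * m + j)) has_sum infsum F UNIV) {0..<d}"
    by (rule has_sum_Sigma'[OF *]) (use has_sum_infsum[OF summ] in auto)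
  hence "infsum F UNIV = (\<Sum>j\<in>{0..<d}. \<Sum>\<^sub>\<infinity>m. F (d * m + j))"
    by (simp add: has_sum_finite_iff)
  thus "(F has_sum (\<Sum>j\<in>{0..<d}. \<Sum>\<^sub>\<infinity>m. F (d * m + j))) UNIV"
    using has_sum_infsum[OF assms(1)] by simp
qed

lemma qpoch_inf_mod_3:
  assumes "norm q < 1"
  shows "qpoch_inf a q = qpoch_inf a (q ^ 3) * qpoch_inf (a * q) (q ^ 3) * qpoch_inf (a * q\<^sup>2) (q ^ 3)"
proof -
  have q3: "norm (q ^ 3) < 1"
    using assms by (intro norm_power_less_1) auto
  have *: "qpoch a q (3 * n) = qpoch a (q ^ 3) n * qpoch (a * q) (q ^ 3) n * qpoch (a * q\<^sup>2) (q ^ 3) n" for n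
  proof (induction n)
    case (Suc n)
    have "3 * Suc n = Suc (Suc (Suc (3 * n)))"
      by simp
    hence 1: "qpoch a q (3 * Suc n) = qpoch a q (3 * n) * (1 - a * q ^ (3 * n)) * (1 - a * q ^ Suc (3 * n)) * (1 - a * q ^ Suc (Suc (3 * n)))"
      by (simp only: qpoch_Suc)
    have 2: "q ^ Suc (3 * n) = q * (q ^ 3) ^ n" "q ^ Suc (Suc (3 * n)) = q\<^sup>2 * (q ^ 3) ^ n" "q ^ (3 * n) = (q ^ 3) ^ n"
      by (simp_all add: power_mult power2_eq_square)
    show ?case
      unfolding 1 2 Suc by (simp add: qpoch_Suc mult_ac)
  qed simp
  have "(\<lambda>n. qpoch a q (3 * n)) \<longlonglongrightarrow> qpoch_inf a q"
    by (rule LIMSEQ_subseq_LIMSEQ[OF qpoch_tendsto[OF assms], of "\<lambda>n. 3 * n", unfolded o_def])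
       (auto simp: strict_mono_def)
  moreover have "(\<lambda>n. qpoch a q (3 * n)) \<longlonglongrightarrow> qpoch_inf a (q ^ 3) * qpoch_inf (a * q) (q ^ 3) * qpoch_inf (a * q\<^sup>2) (q ^ 3)"
    unfolding * by (intro tendsto_intros qpoch_tendsto q3)
  ultimately show ?thesis
    by (rule LIMSEQ_unique)
qed

text \<open>The triple product with \<open>q ^ 3\<close> in place of \<open>q\<close> and
  \<open>z = q ^ 4\<close>: its factors with exponents congruent to 4, 2 and 0 modulo 6 together
  make up \<open>(q^2;q^2)_inf\<close>.\<close>

lemma pentagonal_number_theorem:
  assumes "norm q < 1" "q \<noteq> 0"
  shows "((\<lambda>k. (-1) powi k * q powi (3 * k\<^sup>2 + k)) has_sum qpoch_inf (q\<^sup>2) (q\<^sup>2)) UNIV"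
proof -
  have q3: "norm (q ^ 3) < 1" and q2: "norm (q\<^sup>2) < 1"
    using assms by (auto intro!: norm_power_less_1)
  have "((\<lambda>k. (-1) powi k * (q ^ 3) powi (k * (k - 1)) * (q ^ 4) powi k) has_sum
      qpoch_inf ((q ^ 3)\<^sup>2) ((q ^ 3)\<^sup>2) * jtheta (q ^ 4) ((q ^ 3)\<^sup>2)) UNIV"
    using assms by (intro triple_product q3) auto
  moreover have "(q ^ 3) powi (k * (k - 1)) * (q ^ 4) powi k = q powi (3 * k\<^sup>2 + k)" for k
  proof -
    have "(q ^ 3) powi (k * (k - 1)) * (q ^ 4) powi k = q powi (3 * (k * (k - 1))) * q powi (4 * k)"
      by (simp add: power_int_mult)
    also have "\<dots> = q powi (3 * k\<^sup>2 + k)"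
      using assms(2) by (subst power_int_add[symmetric]) (auto simp: power2_eq_square algebra_simps)
    finally show ?thesis .
  qed
  moreover have "qpoch_inf ((q ^ 3)\<^sup>2) ((q ^ 3)\<^sup>2) * jtheta (q ^ 4) ((q ^ 3)\<^sup>2) = qpoch_inf (q\<^sup>2) (q\<^sup>2)"
  proof -
    have "(q ^ 3)\<^sup>2 = q ^ 6" "(q\<^sup>2) ^ 3 = q ^ 6" "q\<^sup>2 * q\<^sup>2 = q ^ 4" "q\<^sup>2 * (q\<^sup>2)\<^sup>2 = q ^ 6" "q ^ 6 / q ^ 4 = q\<^sup>2"
      using assms(2) by (simp_all flip: power_mult power_add power_diff)
    thus ?thesis
      using qpoch_inf_mod_3[OF q2, of "q\<^sup>2"] by (simp add: jtheta_def)
  qed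
  ultimately show ?thesis
    by (simp add: mult.assoc)
qed

section \<open>The mock theta functions omega and f as Appell-Lerch series\<close>

lemma mock_omega_lerch3:
  assumes "norm q < 1" "q \<noteq> 0"
  shows "ff 2 q * mock_omega q = lerch3 q q"
proof -
  have q2: "norm (q\<^sup>2) < 1"
    using assms by (intro norm_power_less_1) auto
  have "q * q powi (2 * k) \<noteq> 1" for k
  proof -
    have "q * q powi (2 * k) = 1 * q powi (1 + 2 * k)"
      using assms by (subst power_int_add) auto
    also have "\<dots> \<noteq> 1"
      using assms by (intro mult_powi_neq_1) (auto, presburger)
    finally show ?thesis .
  qed
  \<comment> \<open>At \<open>x = q\<close> also \<open>q^2 / x = q\<close>, so the two Pochhammer
    symbols merge into a square.\<close>
  from universal_mock_theta_sums[OF assms assms(2) this]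
  have "(\<lambda>n. q ^ (2 * n * (n + 1)) / (qpoch q (q\<^sup>2) (n + 1))\<^sup>2) sums (lerch3 q q / ff 2 q)"
    using assms by (simp add: lerch3_def ff_def power2_eq_square)
  hence "mock_omega q = lerch3 q q / ff 2 q"
    unfolding mock_omega_def by (rule sums_unique[symmetric])
  thus ?thesis
    using qpoch_inf_self_nonzero[OF q2] by (simp add: ff_def)
qed

text \<open>The base enters the series through even powers only, so it may stay \<open>q\<close>
  while the point \<open>x\<close> becomes \<open>- q\<close>.\<close>

lemma mock_omega_minus_lerch3:
  assumes "norm q < 1" "q \<noteq> 0"
  shows "ff 2 q * mock_omega (- q) = lerch3 q (- q)"
proof -
  have q2: "norm (q\<^sup>2) < 1"
    using assms by (intro norm_power_less_1) auto
  have "- q * q powi (2 * k) \<noteq> 1" for k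
  proof -
    have "- q * q powi (2 * k) = - 1 * q powi (1 + 2 * k)"
      using assms by (subst power_int_add) auto
    also have "\<dots> \<noteq> 1"
      using assms by (intro mult_powi_neq_1) (auto, presburger)
    finally show ?thesis .
  qed
  from universal_mock_theta_sums[OF assms _ this]
  have "(\<lambda>n. (- q) ^ (2 * n * (n + 1)) / (qpoch (- q) (q\<^sup>2) (n + 1))\<^sup>2) sums (lerch3 q (- q) / ff 2 q)"
    using assms by (simp add: lerch3_def ff_def power2_eq_square mult.assoc)
  hence "mock_omega (- q) = lerch3 q (- q) / ff 2 q"
    unfolding mock_omega_def by (simp add: sums_iff)
  thus ?thesis
    using qpoch_inf_self_nonzero[OF q2] by (simp add: ff_def)
qed

text \<open>\<open>f = 2 - 2 g\<^sub>3(-1)\<close>, because the sum of the two series telescopes.\<close>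
lemma mock_f_eq:
  assumes "norm q < 1" "q \<noteq> 0"
  shows "ff 2 q * mock_f (q\<^sup>2) = 2 * ff 2 q - 2 * lerch3 q (-1)"
proof -
  define Q where "Q = q\<^sup>2"
  have Q: "norm Q < 1"
    using assms unfolding Q_def by (intro norm_power_less_1) auto
  have "-1 * q powi (2 * k) \<noteq> 1" for k
    using mult_powi_neq_1[OF assms, of "-1" "2 * k"] by (cases "k = 0") auto
  moreover have "(-1 :: complex) \<noteq> 0"
    by simp
  ultimately have g: "(\<lambda>n. q ^ (2 * n * (n + 1)) / (qpoch (-1) (q\<^sup>2) (n + 1) * qpoch (q\<^sup>2 / (-1)) (q\<^sup>2) (n + 1))) sums
      (lerch3 q (-1) / qpoch_inf (q\<^sup>2) (q\<^sup>2))"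
    unfolding lerch3_def using assms by (intro universal_mock_theta_sums) auto
  define P where "P = qpoch (- Q) Q"
  have P: "P n \<noteq> 0" for n
    unfolding P_def by (rule qpoch_nonzero) (use Q in auto)
  have PS: "P (Suc n) = P n * (1 + Q ^ Suc n)" for n
    by (simp add: P_def qpoch_Suc)
  have nz: "1 + Q ^ Suc n \<noteq> 0" for n
    using P[of "Suc n"] unfolding PS by simp
  define h where "h = (\<lambda>n. Q ^ (n * (n + 1)) / (P n * P (n + 1)))"
  have h: "h sums (2 * (lerch3 q (-1) / ff 2 q))"
  proof -
    have "qpoch (-1) Q (n + 1) = 2 * P n" for n
      by (simp add: P_def qpoch_Suc_left)
    hence "h = (\<lambda>n. 2 * (q ^ (2 * n * (n + 1)) / (qpoch (-1) Q (n + 1) * qpoch (Q / (-1)) Q (n + 1))))"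
      by (intro ext) (simp add: h_def Q_def P_def power_mult[symmetric] mult.assoc)
    thus ?thesis
      using sums_mult[OF g, of 2] by (simp only: Q_def ff_def)
  qed
  \<comment> \<open>Telescoping certificate for the sum of the two series. Its initial value
    \<open>U 0 = 2\<close> is the constant in the relation.\<close>
  define U where "U = (\<lambda>n. Q ^ (n\<^sup>2) * (1 + Q ^ n) / (P n)\<^sup>2)"
  have tel: "Q ^ (n\<^sup>2) / (P n)\<^sup>2 + h n = U n - U (Suc n)" for n
  proof -
    define A where "A = Q ^ (n\<^sup>2)"
    define u where "u = Q ^ n"
    have e: "Q ^ (n * (n + 1)) = A * u" "Q ^ ((Suc n)\<^sup>2) = A * u * u * Q"
      by (simp_all add: A_def u_def power_add power2_eq_square algebra_simps)
    have 1: "h n = A * u / (P n * (P n * (1 + Q * u)))"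
      by (simp add: h_def e[simplified] PS u_def)
    have 2: "U (Suc n) = A * u * u * Q * (1 + Q * u) / (P n * (1 + Q * u))\<^sup>2"
      by (simp add: U_def e PS u_def)
    show ?thesis
      unfolding 1 2 unfolding U_def using P[of n] nz[of n]
      by (simp add: A_def[symmetric] u_def[symmetric] divide_simps) (simp add: algebra_simps power2_eq_square)
  qed
  have U: "U \<longlonglongrightarrow> 0"
  proof -
    have "- Q * Q ^ k \<noteq> 1" for k
      by (rule power_mult_neq_1) (use Q in auto)
    hence "P \<longlonglongrightarrow> qpoch_inf (- Q) Q" "qpoch_inf (- Q) Q \<noteq> 0"
      unfolding P_def by (intro qpoch_tendsto qpoch_inf_nonzero Q; assumption)+
    moreover have "(\<lambda>n. Q ^ n) \<longlonglongrightarrow> 0"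
      by (rule LIMSEQ_power_zero[OF Q])
    moreover have "(\<lambda>n. Q ^ (n\<^sup>2)) \<longlonglongrightarrow> 0"
      by (rule filterlim_compose[OF LIMSEQ_power_zero[OF Q] filterlim_subseq])
         (auto simp: strict_mono_def power_strict_mono)
    ultimately have "U \<longlonglongrightarrow> 0 * (1 + 0) / (qpoch_inf (- Q) Q)\<^sup>2"
      unfolding U_def using Q by (intro tendsto_intros) auto
    thus ?thesis by simp
  qed
  have "(\<lambda>n. Q ^ (n\<^sup>2) / (P n)\<^sup>2 + h n) sums (U 0 - 0)"
    unfolding tel by (rule telescope_sums'[OF U])
  from sums_diff[OF this h] have "(\<lambda>n. Q ^ (n\<^sup>2) / (P n)\<^sup>2) sums (2 - 2 * (lerch3 q (-1) / ff 2 q))"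
    by (simp add: U_def P_def)
  hence "mock_f Q = 2 - 2 * (lerch3 q (-1) / ff 2 q)"
    unfolding mock_f_def P_def by (rule sums_unique[symmetric])
  thus ?thesis
    using qpoch_inf_self_nonzero[OF Q] by (simp add: ff_def Q_def field_simps)
qed

text \<open>The constant term of \<open>mock_f_eq\<close> is expanded by the pentagonal number
  theorem and merged termwise, by \<open>1 - u / (1 + u) = 1 / (1 + u)\<close> with
  \<open>u = q powi (2 * k)\<close>. In this shape \<open>f\<close> arises from the even indices in
  \<open>watson_relation\<close>.\<close>

lemma mock_f_has_sum:
  assumes "norm q < 1" "q \<noteq> 0"
  shows "((\<lambda>k. (-1) powi k * q powi (3 * k\<^sup>2 + k) / (1 + q powi (2 * k))) has_sum ff 2 q * mock_f (q\<^sup>2) / 2) UNIV"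
proof -
  have nz: "-1 * q powi (2 * k) \<noteq> 1" for k
    using mult_powi_neq_1[OF assms, of "-1" "2 * k"] by (cases "k = 0") auto
  have "((\<lambda>k. (-1) powi k * q powi (3 * k\<^sup>2 + k) - (-1) powi k * q powi (3 * k * (k + 1)) / (1 - -1 * q powi (2 * k)))
     has_sum qpoch_inf (q\<^sup>2) (q\<^sup>2) - lerch3 q (-1)) UNIV"
    by (intro has_sum_diff pentagonal_number_theorem lerch3_has_sum assms nz) auto
  moreover have "(-1) powi k * q powi (3 * k\<^sup>2 + k) - (-1) powi k * q powi (3 * k * (k + 1)) / (1 - -1 * q powi (2 * k))
     = (-1) powi k * q powi (3 * k\<^sup>2 + k) / (1 + q powi (2 * k))" for k
  proof -
    have "3 * k * (k + 1) = (3 * k\<^sup>2 + k) + 2 * k"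
      by (simp add: power2_eq_square algebra_simps)
    hence "q powi (3 * k * (k + 1)) = q powi (3 * k\<^sup>2 + k) * q powi (2 * k)"
      by (simp only: power_int_add[OF disjI1[OF assms(2)]])
    moreover have "1 + q powi (2 * k) \<noteq> 0"
      using nz[of k] by (auto simp: add_eq_0_iff)
    ultimately show ?thesis
      by (simp add: divide_simps) (simp add: algebra_simps)
  qed
  moreover have "qpoch_inf (q\<^sup>2) (q\<^sup>2) - lerch3 q (-1) = ff 2 q * mock_f (q\<^sup>2) / 2"
    unfolding mock_f_eq[OF assms] by (simp add: ff_def)
  ultimately show ?thesis
    by simp
qed

section \<open>Relations between the mock theta functions\<close>

lemma ff_nonzero: "norm q < 1 \<Longrightarrow> k > 0 \<Longrightarrow> ff k q \<noteq> 0"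
  unfolding ff_def by (intro qpoch_inf_self_nonzero norm_power_less_1)

lemma ff_power: "ff k (q ^ n) = ff (n * k) q"
  by (simp add: ff_def power_mult)

lemma jtheta_odd:
  assumes "norm q < 1" "q \<noteq> 0"
  shows "jtheta q (q\<^sup>2) = (ff 1 q / ff 2 q)\<^sup>2"
  using qpoch_inf_even_odd[OF assms(1), of q] ff_nonzero[OF assms(1), of 2] assms(2)
  by (simp add: jtheta_def ff_def power2_eq_square)

text \<open>In the expansion at \<open>x = q\<close>, residue 0 gives the pentagonal series
  \<open>f_6\<close> plus \<open>q * lerch3 r q\<close>, residue 2 gives
  \<open>q * lerch3 r q\<close> once more after reflection, and residue 1 gives the omega part. The
  two equal contributions match the factor 2 in the definition of xi, and \<open>f_6 / f_6\<close>
  its constant 1.\<close>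

theorem mock_xi_omega:
  assumes "norm q < 1" "q \<noteq> 0"
  shows "mock_xi q = q\<^sup>2 * mock_omega (q ^ 3) + ff 2 q ^ 4 / (ff 1 q ^ 2 * ff 6 q)"
proof -
  define r where "r = q ^ 3"
  have r: "norm r < 1" "r \<noteq> 0"
    using assms by (auto simp: r_def intro!: norm_power_less_1)
  note pa = power_int_add[OF disjI1[OF assms(2)]]
  have rq: "r powi k = q powi (3 * k)" for k
    by (simp add: r_def power_int_mult)
  have nz: "q * q powi (2 * k) \<noteq> 1" for k
  proof -
    have "q * q powi (2 * k) = 1 * q powi (1 + 2 * k)"
      by (simp add: pa)
    also have "\<dots> \<noteq> 1"
      using assms by (intro mult_powi_neq_1) (auto, presburger)
    finally show ?thesis .
  qed
  have nzr: "q * r powi (2 * k) \<noteq> 1" for k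
    using nz[of "3 * k"] by (simp add: rq)
  have shift: "q * q powi (2 * (3 * m + 1)) = r * r powi (2 * m)" for m
  proof -
    have "q * q powi (2 * (3 * m + 1)) = q powi 1 * q powi (2 * (3 * m + 1))"
      by simp
    also have "\<dots> = q powi 3 * q powi (3 * (2 * m))"
      unfolding pa[symmetric] by (simp add: algebra_simps)
    finally show ?thesis
      unfolding rq by (simp add: r_def)
  qed
  have nzr': "r * r powi (2 * k) \<noteq> 1" for k
    using nz[of "3 * k + 1"] unfolding shift .
  define F where "F = (\<lambda>n. (-1) powi n * q powi (n * (n + 1)) / (1 - q * q powi (2 * n)))"
  define t where "t = (\<lambda>x m. (-1) powi m * r powi (3 * m * (m + 1)) / (1 - x * r powi (2 * m)))"
  have F: "(F has_sum ff 2 q ^ 4 / ff 1 q ^ 2) UNIV"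
    using theta_partial_fraction[OF assms assms(2) nz] ff_nonzero[OF assms(1), of 2]
    unfolding jtheta_odd[OF assms] by (simp add: F_def ff_def field_simps power2_eq_square power4_eq_xxxx)
  have sF: "F summable_on UNIV"
    using F by (rule has_sum_imp_summable)
  have tq: "(t q has_sum lerch3 r q) UNIV" and tr: "(t r has_sum lerch3 r r) UNIV"
    unfolding t_def by (intro lerch3_has_sum r assms(2) nzr nzr')+
  have sgn3: "(-1 :: complex) powi (3 * m) = (-1) powi m" for m
    by (simp add: power_int_mult)
  \<comment> \<open>The fraction is split by \<open>1 / (1 - u) = 1 + u / (1 - u)\<close> with
    \<open>u = q * r powi (2 * m)\<close>.\<close>
  have F0: "F (3 * m) = (-1) powi m * r powi (3 * m\<^sup>2 + m) + q * t q m" for m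
  proof -
    define X where "X = r powi (3 * m\<^sup>2 + m)"
    define w where "w = r powi (2 * m)"
    have "q powi (3 * m * (3 * m + 1)) = X"
      unfolding X_def rq by (simp add: algebra_simps power2_eq_square)
    moreover have "q powi (2 * (3 * m)) = w"
      unfolding w_def rq by simp
    ultimately have 1: "F (3 * m) = (-1) powi m * X / (1 - q * w)"
      by (simp only: F_def sgn3)
    have "r powi (3 * m * (m + 1)) = X * w"
      unfolding X_def w_def rq pa[symmetric] by (simp add: algebra_simps power2_eq_square)
    hence 2: "t q m = (-1) powi m * (X * w) / (1 - q * w)"
      by (simp only: t_def w_def)
    have "1 - q * w \<noteq> 0"
      using nzr[of m] by (simp add: w_def)
    thus ?thesis
      unfolding 1 2 X_def[symmetric] by (simp add: divide_simps) (simp add: algebra_simps)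
  qed
  have F1: "F (3 * m + 1) = - (q\<^sup>2) * t r m" for m
  proof -
    have "q powi ((3 * m + 1) * (3 * m + 1 + 1)) = q powi (2 + 3 * (3 * m * (m + 1)))"
      by (simp add: algebra_simps)
    also have "\<dots> = q\<^sup>2 * r powi (3 * m * (m + 1))"
      unfolding rq pa by simp
    finally have 1: "q powi ((3 * m + 1) * (3 * m + 1 + 1)) = q\<^sup>2 * r powi (3 * m * (m + 1))" .
    have 3: "(-1 :: complex) powi (3 * m + 1) = - ((-1) powi m)"
      unfolding minus_one_powi_add sgn3 by simp
    show ?thesis
      unfolding F_def 1 shift 3 t_def by simp
  qed
  \<comment> \<open>The reflection sends residue 2 to the index \<open>- 1 - 3 * m\<close>, whose
    denominator \<open>1 - 1 / u\<close> is that of residue 0 up to the factor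
    \<open>- 1 / u\<close>.\<close>
  have F2: "F (3 * (-1 - m) + 2) = q * t q m" for m
  proof -
    have n: "3 * (-1 - m) + 2 = -1 - 3 * m"
      by simp
    have 1: "q powi ((-1 - 3 * m) * (-1 - 3 * m + 1)) = r powi (3 * m\<^sup>2 + m)"
      unfolding rq by (simp add: algebra_simps power2_eq_square)
    have 2: "q * q powi (2 * (-1 - 3 * m)) = 1 / (q * r powi (2 * m))"
    proof -
      have "(q * q powi (2 * (-1 - 3 * m))) * (q * r powi (2 * m)) = q powi 1 * q powi (2 * (-1 - 3 * m)) * (q powi 1 * q powi (3 * (2 * m)))"
        unfolding rq by simp
      also have "\<dots> = 1"
        unfolding pa[symmetric] by simp
      finally show ?thesis
        using assms r by (simp add: field_simps)
    qed
    have 3: "(-1 :: complex) powi (-1 - 3 * m) = - ((-1) powi m)"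
    proof -
      have "(-1 :: complex) powi (-1 - 3 * m) = (-1) powi (-1) * (-1) powi (3 * (- m))"
        unfolding minus_one_powi_add[symmetric] by simp
      thus ?thesis
        unfolding sgn3 by (simp add: power_int_minus_left)
    qed
    have 4: "r powi (3 * m * (m + 1)) = r powi (3 * m\<^sup>2 + m) * r powi (2 * m)"
      unfolding rq pa[symmetric] by (simp add: algebra_simps power2_eq_square)
    show ?thesis
      unfolding n F_def 1 2 3 t_def 4 using assms r nzr[of m] by (simp add: divide_simps) (simp add: algebra_simps)
  qed
  have "infsum F UNIV = (\<Sum>j\<in>{0..<3}. \<Sum>\<^sub>\<infinity>m. F (3 * m + j))"
    by (rule infsumI[OF has_sum_int_residues(2)[OF sF]]) simp
  also have "{0..<3} = {0, 1, 2 :: int}"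
    by auto
  also have "(\<Sum>j\<in>{0, 1, 2}. \<Sum>\<^sub>\<infinity>m. F (3 * m + j)) = (\<Sum>\<^sub>\<infinity>m. F (3 * m)) + (\<Sum>\<^sub>\<infinity>m. F (3 * m + 1)) + (\<Sum>\<^sub>\<infinity>m. F (3 * m + 2))"
    by simp
  also have "(\<Sum>\<^sub>\<infinity>m. F (3 * m)) = ff 6 q + q * lerch3 r q"
  proof -
    have "((\<lambda>m. (-1) powi m * r powi (3 * m\<^sup>2 + m) + q * t q m) has_sum qpoch_inf (r\<^sup>2) (r\<^sup>2) + q * lerch3 r q) UNIV"
      by (intro has_sum_add pentagonal_number_theorem has_sum_cmult_right tq r)
    moreover have "qpoch_inf (r\<^sup>2) (r\<^sup>2) = ff 6 q"
      by (simp add: r_def ff_def flip: power_mult)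
    ultimately show ?thesis
      unfolding F0 by (simp add: infsumI)
  qed
  also have "(\<Sum>\<^sub>\<infinity>m. F (3 * m + 1)) = - (q\<^sup>2) * lerch3 r r"
    unfolding F1 by (intro infsumI has_sum_cmult_right tr)
  also have "(\<Sum>\<^sub>\<infinity>m. F (3 * m + 2)) = (\<Sum>\<^sub>\<infinity>m. F (3 * (-1 - m) + 2))"
    by (rule infsum_reindex_bij_witness[of _ "\<lambda>m. -1 - m" "\<lambda>m. -1 - m"]) auto
  also have "\<dots> = q * lerch3 r q"
    unfolding F2 by (intro infsumI has_sum_cmult_right tq)
  finally have main: "ff 2 q ^ 4 / ff 1 q ^ 2 = ff 6 q + q * lerch3 r q + - (q\<^sup>2) * lerch3 r r + q * lerch3 r q"
    using infsumI[OF F] by simp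
  have xi: "mock_xi q = 1 + 2 * (q * (lerch3 r q / ff 6 q))"
  proof -
    have "r\<^sup>2 = q ^ 6" "q ^ 6 / q = q ^ 5"
      using assms(2) by (simp_all add: r_def eval_nat_numeral)
    hence "(\<lambda>n. r ^ (2 * n * (n + 1)) / (qpoch q (q ^ 6) (n + 1) * qpoch (q ^ 5) (q ^ 6) (n + 1))) sums (lerch3 r q / ff 6 q)"
      using universal_mock_theta_sums[OF r assms(2) nzr] by (simp add: lerch3_def ff_def)
    hence *: "(\<lambda>n. q * (r ^ (2 * n * (n + 1)) / (qpoch q (q ^ 6) (n + 1) * qpoch (q ^ 5) (q ^ 6) (n + 1)))) sums (q * (lerch3 r q / ff 6 q))"
      by (rule sums_mult)
    have e: "q * r ^ (2 * n * (n + 1)) = q ^ (6 * (Suc n)\<^sup>2 - 6 * Suc n + 1)" for n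
    proof -
      have "6 * (Suc n)\<^sup>2 - 6 * Suc n + 1 = Suc (3 * (2 * n * (n + 1)))"
        by (simp add: power2_eq_square algebra_simps)
      thus ?thesis
        by (simp only: r_def power_mult[symmetric] power_Suc)
    qed
    have "(\<lambda>n. q ^ (6 * (Suc n)\<^sup>2 - 6 * Suc n + 1) / (qpoch q (q ^ 6) (Suc n) * qpoch (q ^ 5) (q ^ 6) (Suc n))) sums (q * (lerch3 r q / ff 6 q))"
      using * unfolding times_divide_eq_right e Suc_eq_plus1 .
    thus ?thesis
      unfolding mock_xi_def Let_def by (simp only: sums_iff)
  qed
  have "ff 2 r = ff 6 q"
    by (simp add: ff_power r_def)
  hence omega: "mock_omega r = lerch3 r r / ff 6 q"
    using mock_omega_lerch3[OF r] ff_nonzero[OF assms(1), of 6] by (simp add: field_simps)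
  have "ff 2 q ^ 4 / (ff 1 q ^ 2 * ff 6 q) = (ff 2 q ^ 4 / ff 1 q ^ 2) / ff 6 q"
    by simp
  thus ?thesis
    unfolding xi main omega r_def[symmetric] using ff_nonzero[OF assms(1), of 6]
    by (simp add: field_simps)
qed

section \<open>Watson's relation\<close>

lemma dominated_double_summable:
  fixes f g :: "int \<Rightarrow> complex" and h :: "int \<Rightarrow> int \<Rightarrow> complex"
  assumes f: "(\<lambda>k. norm (f k)) summable_on UNIV" and g: "(\<lambda>m. norm (g m)) summable_on UNIV"
    and h: "\<And>k m. norm (h k m) \<le> B"
  shows "(\<lambda>(k, m). f k * g m * h k m) summable_on UNIV \<times> UNIV"
proof -
  have "(\<lambda>km. norm (f (fst km)) * norm (g (snd km))) summable_on UNIV \<times> UNIV"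
  proof (rule summable_on_SigmaI)
    show "((\<lambda>m. norm (f (fst (k, m))) * norm (g (snd (k, m)))) has_sum norm (f k) * (\<Sum>\<^sub>\<infinity>m. norm (g m))) UNIV" for k
      using has_sum_cmult_right[OF has_sum_infsum[OF g], of "norm (f k)"] by simp
    show "(\<lambda>k. norm (f k) * (\<Sum>\<^sub>\<infinity>m. norm (g m))) summable_on UNIV"
      by (rule summable_on_cmult_left[OF f])
  qed auto
  hence *: "(\<lambda>km. (norm (f (fst km)) * norm (g (snd km))) * B) summable_on UNIV \<times> UNIV"
    by (rule summable_on_cmult_left)
  have "(\<lambda>km. norm ((\<lambda>(k, m). f k * g m * h k m) km)) summable_on UNIV \<times> UNIV"
  proof (rule Infinite_Sum.abs_summable_on_comparison_test'[OF *])
    fix km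
    show "norm ((\<lambda>(k, m). f k * g m * h k m) km) \<le> (norm (f (fst km)) * norm (g (snd km))) * B"
      unfolding case_prod_unfold norm_mult by (intro mult_left_mono h) auto
  qed
  thus ?thesis
    by (rule abs_summable_summable)
qed

text \<open>Partial fractions in \<open>u\<close> with \<open>c\<close> held fixed. In the
  application \<open>u = q powi (2 * k + 1)\<close> and \<open>c * u^2 = q powi (4 * m)\<close>, so
  that \<open>c\<close> depends on \<open>m - k\<close> alone and each part is a simple fraction in
  one of the two indices.\<close>

lemma partial_fraction_split:
  fixes u c :: complex
  assumes "1 - u \<noteq> 0" "1 + c \<noteq> 0" "1 + c * u\<^sup>2 \<noteq> 0"
  shows "1 / ((1 - u) * (1 + c * u\<^sup>2)) = 1 / ((1 + c) * (1 - u)) + c * (1 + u) / ((1 + c) * (1 + c * u\<^sup>2))"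
  using assms by (simp add: divide_simps) (simp add: algebra_simps power2_eq_square)

text \<open>The two reciprocal theta functions \<open>1 / j(q; q\<^sup>2)\<close> and \<open>1 / j(-1; q\<^sup>4)\<close>
  are multiplied as partial fraction series; each product of two simple fractions is split into
  simple fractions again, and the inner sums are once more values of partial fraction series.\<close>

theorem watson_relation:
  assumes q: "norm q < 1" and q0: "q \<noteq> 0"
  shows "mock_f (q ^ 8) + 2 * q * mock_omega q + 2 * q ^ 3 * mock_omega (- (q ^ 4))
    = ff 2 q * ff 4 q ^ 6 / (ff 1 q ^ 2 * ff 8 q ^ 4)"
proof -
  define p where "p = q\<^sup>2"
  have p: "norm p < 1" "p \<noteq> 0"
    using q q0 by (auto simp: p_def intro!: norm_power_less_1)
  have q4: "norm (q ^ 4) < 1" "q ^ 4 \<noteq> 0"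
    using q q0 by (auto intro!: norm_power_less_1)
  note pa = power_int_add[OF disjI1[OF q0]]
  have pq: "p powi k = q powi (2 * k)" for k
    by (simp add: p_def power_int_mult)
  have q4q: "(q ^ 4) powi k = q powi (4 * k)" for k
    by (simp add: power_int_mult)
  have pp: "p\<^sup>2 = q ^ 4"
    by (simp add: p_def flip: power_mult)
  have neq1: "c * q powi n \<noteq> 1" if "norm c = 1" "n \<noteq> 0" for c n
    by (rule mult_powi_neq_1) (use q q0 that in auto)
  have nzm: "1 + q powi (4 * m) \<noteq> 0" for m
  proof (cases "m = 0")
    case False
    thus ?thesis
      using neq1[of "-1" "4 * m"] by (auto simp: add_eq_0_iff)
  qed auto
  have nzc: "1 + q powi (4 * n + 2) \<noteq> 0" for n
  proof -
    have "4 * n + 2 \<noteq> 0"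
      by presburger
    thus ?thesis
      using neq1[of "-1" "4 * n + 2"] by (auto simp: add_eq_0_iff)
  qed
  have nzu: "1 - q powi (2 * k + 1) \<noteq> 0" for k
  proof -
    have "2 * k + 1 \<noteq> 0"
      by presburger
    thus ?thesis
      using neq1[of 1 "2 * k + 1"] by auto
  qed

  \<comment> \<open>The one infinite product in terms of which all inner theta values are expressed:
    \<open>j(-q^2; q^4) = N^2\<close> and
    \<open>j(\<i> * q; q^2) = j(- \<i> * q; q^2) = N\<close>.\<close>
  define N where "N = qpoch_inf (- (q\<^sup>2)) (q ^ 4)"
  define a where "a = (\<lambda>k. (-1) powi k * q powi (k * (k + 1)) / (1 - q powi (2 * k + 1)))"
  define b where "b = (\<lambda>m. (-1) powi m * q powi (2 * m * (m + 1)) / (1 + q powi (4 * m)))"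

  have a_eq: "a k = (-1) powi k * q powi (k * (k + 1)) / (1 - q * q powi (2 * k))" for k
    by (simp add: a_def pa)
  have b_eq: "b m = (-1) powi m * p powi (m * (m + 1)) / (1 - (-1) * p powi (2 * m))" for m
    by (simp add: b_def pq mult.assoc)
  have a_nz: "q * q powi (2 * k) \<noteq> 1" for k
    using nzu[of k] by (simp add: pa mult.commute)
  have b_nz: "-1 * p powi (2 * m) \<noteq> 1" for m
    using nzm[of m] by (simp add: pq minus_equation_iff) (metis add.right_inverse)
  have a: "(a has_sum (ff 2 q)\<^sup>2 / jtheta q (q\<^sup>2)) UNIV"
    using theta_partial_fraction[OF q q0 q0 a_nz] by (simp only: a_eq[abs_def] ff_def)
  have b: "(b has_sum (ff 4 q)\<^sup>2 / jtheta (-1) (q ^ 4)) UNIV"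
    using theta_partial_fraction[OF p _ b_nz] by (simp add: b_eq[abs_def] ff_def pp)

  have a_abs: "(\<lambda>k. norm (a k)) summable_on UNIV"
    using theta_term_summable[OF q q0 q0 a_nz, of 1 1]
    by (simp only: a_eq) (simp add: power2_eq_square algebra_simps)
  have b_abs: "(\<lambda>m. norm (b m)) summable_on UNIV"
    using theta_term_summable[OF p _ b_nz, of 1 1]
    by (simp only: b_eq) (simp add: power2_eq_square algebra_simps)
  \<comment> \<open>\<open>a'\<close> and \<open>b'\<close> are the series with one denominator
    removed: after the split each part keeps only one of the two original denominators, and
    \<open>a'\<close> takes up the numerator \<open>1 + u\<close>.\<close>
  define a' where "a' = (\<lambda>k. (-1) powi k * q powi (k * (k + 1)) * (1 + q powi (2 * k + 1)))"
  define b' where "b' = (\<lambda>m. (-1) powi m * q powi (2 * m * (m + 1)))"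
  have a'_abs: "(\<lambda>k. norm (a' k)) summable_on UNIV"
  proof (rule Infinite_Sum.abs_summable_on_comparison_test')
    show "(\<lambda>k. norm (q powi (1 * k\<^sup>2 + 1 * k)) + norm (q powi (1 * k\<^sup>2 + 3 * k)) * norm q) summable_on UNIV"
      by (intro summable_on_add summable_on_cmult_left gaussian_summable q q0) auto
    fix k
    have e1: "q powi (k * (k + 1)) = q powi (1 * k\<^sup>2 + 1 * k)"
      by (simp add: power2_eq_square algebra_simps)
    have e2: "q powi (k * (k + 1)) * q powi (2 * k + 1) = q powi (1 * k\<^sup>2 + 3 * k) * q"
    proof -
      have "q powi (1 * k\<^sup>2 + 3 * k) * q = q powi (1 * k\<^sup>2 + 3 * k) * q powi 1"
        by simp
      thus ?thesis
        unfolding pa[symmetric] by (simp add: power2_eq_square algebra_simps)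
    qed
    have "a' k = (-1) powi k * (q powi (k * (k + 1)) + q powi (k * (k + 1)) * q powi (2 * k + 1))"
      by (simp add: a'_def ring_distribs)
    hence "norm (a' k) = norm (q powi (k * (k + 1)) + q powi (k * (k + 1)) * q powi (2 * k + 1))"
      by (simp add: norm_mult norm_power_int)
    also have "\<dots> \<le> norm (q powi (1 * k\<^sup>2 + 1 * k)) + norm (q powi (1 * k\<^sup>2 + 3 * k)) * norm q"
      unfolding e2 unfolding e1 norm_mult[symmetric] by (rule norm_triangle_ineq)
    finally show "norm (a' k) \<le> norm (q powi (1 * k\<^sup>2 + 1 * k)) + norm (q powi (1 * k\<^sup>2 + 3 * k)) * norm q" .
  qed
  have b'_abs: "(\<lambda>m. norm (b' m)) summable_on UNIV"
    using gaussian_summable[OF q q0, of 2 2]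
    by (simp add: b'_def norm_mult norm_power_int power2_eq_square algebra_simps)

  \<comment> \<open>The new denominators depend on the difference of the indices only, so a single
    bound serves the whole double series.\<close>
  have "\<exists>B>0. \<forall>k::int. norm (1 / (1 - (- (q powi (-2))) * (q ^ 4) powi k)) \<le> B"
  proof (intro inverse_one_minus_bounded q4)
    show "- (q powi (-2)) * (q ^ 4) powi k \<noteq> 1" for k
      using nzc[of "k - 1"] by (simp add: q4q pa[symmetric] minus_equation_iff) (metis add.right_inverse)
  qed (use q0 in auto)
  then obtain B1 where B1: "\<And>k. norm (1 / (1 + q powi (4 * k - 2))) \<le> B1"
    by (auto simp: q4q pa[symmetric])
  have B2: "norm (1 / (1 + q powi (4 * k + 2))) \<le> B1" for k
    using B1[of "k + 1"] by (simp add: algebra_simps)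

  \<comment> \<open>\<open>H1\<close> is summed over \<open>m\<close> first and \<open>H2\<close>
    over \<open>k\<close> first. In \<open>H2\<close> the factor \<open>c / (1 + c)\<close> is
    written as \<open>1 / (1 + 1 / c)\<close> to bring its inner index \<open>k\<close> into the
    form of a partial fraction series.\<close>
  define H1 where "H1 = (\<lambda>(k, m). a k * b' m * (1 / (1 + q powi (4 * (m - k) - 2))))"
  define H2 where "H2 = (\<lambda>(k, m). a' k * b m * (1 / (1 + q powi (4 * (k - m) + 2))))"
  have H1: "H1 summable_on UNIV \<times> UNIV"
    unfolding H1_def by (rule dominated_double_summable[OF a_abs b'_abs B1])
  have H2: "H2 summable_on UNIV \<times> UNIV"
    unfolding H2_def by (rule dominated_double_summable[OF a'_abs b_abs B2])

  have split: "a k * b m = H1 (k, m) + H2 (k, m)" for k m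
  proof -
    define u where "u = q powi (2 * k + 1)"
    define c where "c = q powi (4 * (m - k) - 2)"
    have cu: "c * u\<^sup>2 = q powi (4 * m)"
    proof -
      have "u\<^sup>2 = q powi (4 * k + 2)"
        unfolding u_def powi_power by (simp add: algebra_simps)
      thus ?thesis
        unfolding c_def by (simp add: pa[symmetric] algebra_simps)
    qed
    have c': "q powi (4 * (k - m) + 2) = 1 / c"
    proof -
      have "4 * (k - m) + 2 = - (4 * (m - k) - 2)"
        by simp
      thus ?thesis
        unfolding c_def by (simp only: power_int_minus inverse_eq_divide)
    qed
    have nz: "1 - u \<noteq> 0" "1 + c \<noteq> 0" "1 + c * u\<^sup>2 \<noteq> 0" "c \<noteq> 0"
      using nzu[of k] nzc[of "m - k - 1"] nzm[of m] q0 unfolding cu by (simp_all add: u_def c_def)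
    have "1 / (1 + 1 / c) = c / (1 + c)"
      using nz by (simp add: field_simps)
    hence h: "H2 (k, m) = a' k * b m * (c / (1 + c))"
      by (simp only: H2_def prod.case c')
    have expand: "X * Y * (1 / (D * E) + c * V / (D * G)) = X / E * Y * (1 / D) + X * V * (Y / G) * (c / D)"
      for X Y D E G V :: complex
      by (simp add: divide_inverse algebra_simps)
    have "a k * b m = ((-1) powi k * q powi (k * (k + 1))) * ((-1) powi m * q powi (2 * m * (m + 1))) * (1 / ((1 - u) * (1 + c * u\<^sup>2)))"
      unfolding cu unfolding a_def b_def u_def by simp
    also have "\<dots> = H1 (k, m) + H2 (k, m)"
      unfolding partial_fraction_split[OF nz(1-3)] h H1_def prod.case a_def a'_def b_def b'_def u_def[symmetric] c_def[symmetric] cu[symmetric]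
      by (rule expand)
    finally show ?thesis .
  qed

  have total: "infsum (\<lambda>(k, m). a k * b m) (UNIV \<times> UNIV) = (ff 2 q)\<^sup>2 / jtheta q (q\<^sup>2) * ((ff 4 q)\<^sup>2 / jtheta (-1) (q ^ 4))"
  proof -
    have "(\<lambda>(k, m). a k * b m * 1) summable_on UNIV \<times> UNIV"
      by (rule dominated_double_summable[OF a_abs b_abs, of _ 1]) simp
    hence "infsum (\<lambda>(k, m). a k * b m) (UNIV \<times> UNIV) = (\<Sum>\<^sub>\<infinity>k. \<Sum>\<^sub>\<infinity>m. a k * b m)"
      by (intro infsum_Sigma'_banach[symmetric]) simp
    also have "\<dots> = infsum a UNIV * infsum b UNIV"
      by (simp add: infsum_cmult_right' infsum_cmult_left')
    finally show ?thesis
      using infsumI[OF a] infsumI[OF b] by simp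
  qed

  have N_def': "N = jtheta (\<i> * q) (q\<^sup>2)" "N = jtheta (- \<i> * q) (q\<^sup>2)" "jtheta (- (q powi (-2))) (q ^ 4) = N\<^sup>2 / q\<^sup>2"
  proof -
    have m: "q\<^sup>2 / (\<i> * q) = - (\<i> * q)" "q\<^sup>2 / (- \<i> * q) = \<i> * q"
      using q0 by (simp_all add: field_simps power2_eq_square)
    have "N = qpoch_inf (\<i> * q) (q\<^sup>2) * qpoch_inf (- (\<i> * q)) (q\<^sup>2)"
      using qpoch_inf_mult_minus[of "q\<^sup>2" "\<i> * q"] norm_power_less_1[OF q, of 2]
      by (simp add: N_def power_mult_distrib flip: power_mult)
    thus "N = jtheta (\<i> * q) (q\<^sup>2)" "N = jtheta (- \<i> * q) (q\<^sup>2)"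
      unfolding jtheta_def m by (simp_all add: mult.commute)
    have m2: "- (q powi (-2)) = - (1 / q\<^sup>2)"
      by (simp add: power_int_minus divide_simps)
    have m3: "- (1 / q\<^sup>2) * q ^ 4 = - (q\<^sup>2)" "q ^ 4 / - (q\<^sup>2) = - (q\<^sup>2)"
      using q0 by (simp_all add: eval_nat_numeral)
    have "jtheta (- (1 / q\<^sup>2) * q ^ 4) (q ^ 4) = - jtheta (- (1 / q\<^sup>2)) (q ^ 4) / (- (1 / q\<^sup>2))"
      by (rule jtheta_shift) (use q4 q0 in auto)
    hence "jtheta (- (1 / q\<^sup>2)) (q ^ 4) = jtheta (- (q\<^sup>2)) (q ^ 4) / q\<^sup>2"
      unfolding m3 using q0 by (simp add: field_simps)
    moreover have "jtheta (- (q\<^sup>2)) (q ^ 4) = N\<^sup>2"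
      unfolding jtheta_def m3 N_def by (simp only: power2_eq_square[of "qpoch_inf _ _"])
    ultimately show "jtheta (- (q powi (-2))) (q ^ 4) = N\<^sup>2 / q\<^sup>2"
      unfolding m2 by simp
  qed
  have N0: "N \<noteq> 0"
  proof -
    have "- (q\<^sup>2) * (q ^ 4) ^ k \<noteq> 1" for k
      by (rule power_mult_neq_1) (use q4 p in \<open>auto simp: p_def\<close>)
    thus ?thesis
      unfolding N_def by (intro qpoch_inf_nonzero q4)
  qed

  \<comment> \<open>For fixed \<open>k\<close> the sum over \<open>m\<close> is a reciprocal theta
    value at \<open>- (q powi (- 4 * k - 2))\<close>. The quasi-period moves this point to
    \<open>- (q powi (-2))\<close>, and its multiplier turns \<open>k * (k + 1)\<close> into the
    exponent \<open>3 * k * (k + 1) + 2 * k\<close>.\<close>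
  have part1: "infsum H1 (UNIV \<times> UNIV) = q * (ff 4 q)\<^sup>2 / N\<^sup>2 * lerch3 q q"
  proof -
    define s where "s = (\<lambda>k. (-1) powi k * q powi (3 * k * (k + 1)) / (1 - q * q powi (2 * k)))"
    \<comment> \<open>What remains without denominator when \<open>q * w / (1 - q * w)\<close>, for
      \<open>w = q powi (2 * k)\<close>, is written as \<open>1 / (1 - q * w) - 1\<close>. Its sum
      over \<open>k\<close> vanishes by reflection.\<close>
    define z where "z = (\<lambda>k. (-1 :: complex) powi k * q powi (3 * k * (k + 1)))"
    have inner: "((\<lambda>m. H1 (k, m)) has_sum q * (ff 4 q)\<^sup>2 / N\<^sup>2 * (s k - z k)) UNIV" for k
    proof -
      define x where "x = - (q powi (- 4 * k - 2))"
      have x: "x \<noteq> 0"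
        using q0 by (simp add: x_def)
      have xp: "x * p powi (2 * m) = - (q powi (4 * (m - k) - 2))" for m
        unfolding x_def pq by (simp add: pa[symmetric] algebra_simps)
      have x1: "x * p powi (2 * m) \<noteq> 1" for m
        unfolding xp using nzc[of "m - k - 1"] by (simp add: minus_equation_iff) (metis add.right_inverse)
      have "q powi (- 4 * k - 2) = q powi (-2) * q powi (2 * (2 * (- k)))"
        unfolding pa[symmetric] by (rule arg_cong[of _ _ "(powi) q"]) simp
      hence "x = - (q powi (-2)) * p powi (2 * (- k))"
        unfolding x_def pq by simp
      hence "jtheta x (p\<^sup>2) = (-1) powi (- k) * (- (q powi (-2))) powi (- (- k)) * p powi (- (- k * (- k - 1))) * jtheta (- (q powi (-2))) (p\<^sup>2)"
        using jtheta_quasi_period[OF p, of "- (q powi (-2))" "- k"] q0 by simp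
      also have "(-1) powi (- k) * (- (q powi (-2))) powi (- (- k)) * p powi (- (- k * (- k - 1))) = q powi (- 2 * k * k - 4 * k)"
      proof -
        have "(- (q powi (-2))) powi k = (-1) powi k * (q powi (-2)) powi k"
          by (simp flip: power_int_mult_distrib)
        also have "(q powi (-2)) powi k = q powi (- 2 * k)"
          by (rule power_int_mult[symmetric])
        finally have "(-1) powi (- k) * (- (q powi (-2))) powi (- (- k)) * p powi (- (- k * (- k - 1)))
          = ((-1) powi (- k) * (-1) powi k) * (q powi (- 2 * k) * q powi (2 * (- (- k * (- k - 1)))))"
          unfolding pq by simp
        also have "(-1 :: complex) powi (- k) * (-1) powi k = 1"
          unfolding minus_one_powi_add[symmetric] by simp
        also have "q powi (- 2 * k) * q powi (2 * (- (- k * (- k - 1)))) = q powi (- 2 * k * k - 4 * k)"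
          unfolding pa[symmetric] by (rule arg_cong[of _ _ "(powi) q"]) (simp add: algebra_simps)
        finally show ?thesis by simp
      qed
      finally have J: "jtheta x (p\<^sup>2) = q powi (- (2 * k * k + 4 * k)) * (N\<^sup>2 / q\<^sup>2)"
        unfolding pp N_def'(3) by simp
      have "((\<lambda>m. (-1) powi m * p powi (m * (m + 1)) / (1 - x * p powi (2 * m))) has_sum (qpoch_inf (p\<^sup>2) (p\<^sup>2))\<^sup>2 / jtheta x (p\<^sup>2)) UNIV"
        by (rule theta_partial_fraction[OF p x x1])
      hence "((\<lambda>m. a k * ((-1) powi m * p powi (m * (m + 1)) / (1 - x * p powi (2 * m)))) has_sum a k * ((qpoch_inf (p\<^sup>2) (p\<^sup>2))\<^sup>2 / jtheta x (p\<^sup>2))) UNIV"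
        by (rule has_sum_cmult_right)
      moreover have "a k * ((-1) powi m * p powi (m * (m + 1)) / (1 - x * p powi (2 * m))) = H1 (k, m)" for m
        unfolding xp by (simp add: H1_def b'_def pq mult.assoc)
      moreover have "a k * ((qpoch_inf (p\<^sup>2) (p\<^sup>2))\<^sup>2 / jtheta x (p\<^sup>2)) = q * (ff 4 q)\<^sup>2 / N\<^sup>2 * (s k - z k)"
      proof -
        define X where "X = q powi (3 * k * (k + 1))"
        define w where "w = q powi (2 * k)"
        have "q powi (k * (k + 1)) * q powi (2 * k * k + 4 * k) = X * w"
          unfolding X_def w_def pa[symmetric] by (simp add: algebra_simps)
        moreover have "q powi (- (2 * k * k + 4 * k)) = 1 / q powi (2 * k * k + 4 * k)"
          by (simp only: power_int_minus inverse_eq_divide)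
        moreover have "S * A / D * (F / (1 / E * (M / q\<^sup>2))) = S * (A * E) / D * (q\<^sup>2 * F / M)" for S A D E F M :: complex
          by simp
        ultimately have "a k * ((qpoch_inf (p\<^sup>2) (p\<^sup>2))\<^sup>2 / jtheta x (p\<^sup>2)) = (-1) powi k * (X * w) / (1 - q * w) * (q\<^sup>2 * (ff 4 q)\<^sup>2 / N\<^sup>2)"
          unfolding J unfolding pp a_eq w_def[symmetric] ff_def by (simp only:)
        moreover have "(-1) powi k * (X * w) / (1 - q * w) * (q\<^sup>2 * F / M) = q * F / M * ((-1) powi k * X / (1 - q * w) - (-1) powi k * X)" if "M \<noteq> 0" for F M :: complex
          using a_nz[of k] that unfolding w_def[symmetric] by (simp add: divide_simps) (simp add: algebra_simps power2_eq_square)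
        ultimately show ?thesis
          using N0 by (simp add: s_def z_def X_def w_def)
      qed
      ultimately show ?thesis
        by simp
    qed
    have "((\<lambda>k. q * (ff 4 q)\<^sup>2 / N\<^sup>2 * (s k - z k)) has_sum infsum H1 (UNIV \<times> UNIV)) UNIV"
      by (rule has_sum_Sigma'[OF has_sum_infsum[OF H1]]) (rule inner)
    moreover have "((\<lambda>k. q * (ff 4 q)\<^sup>2 / N\<^sup>2 * (s k - z k)) has_sum q * (ff 4 q)\<^sup>2 / N\<^sup>2 * (lerch3 q q - 0)) UNIV"
      unfolding s_def z_def
      by (intro has_sum_cmult_right has_sum_diff lerch3_has_sum signed_triangular_has_sum_0 q q0 a_nz) simp
    ultimately show ?thesis
      using has_sum_unique by fastforce
  qed

  have part2: "infsum H2 (UNIV \<times> UNIV) = (ff 2 q)\<^sup>2 / N * (ff 8 q * mock_f (q ^ 8) / 2 + q ^ 3 * (ff 8 q * mock_omega (- (q ^ 4))))"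
  proof -
    define C where "C = (ff 2 q)\<^sup>2 / N"
    \<comment> \<open>With \<open>v = q powi (2 * (k - m) + 1)\<close> the denominator
      \<open>1 + v^2\<close> splits into \<open>1 - \<i> * v\<close> and
      \<open>1 + \<i> * v\<close>. \<open>e\<close> collects the two partial fraction coefficients
      together with the powers of \<open>\<i>\<close> and \<open>- \<i>\<close> from the
      quasi-period.\<close>
    define e where "e = (\<lambda>m. (1 - \<i> * q powi (2 * m)) / 2 * inverse (\<i> powi m) + (1 + \<i> * q powi (2 * m)) / 2 * inverse ((- \<i>) powi m))"
    define G where "G = (\<lambda>m. C * (b m * ((-1) powi m * q powi (m\<^sup>2) * e m)))"
    have inner: "((\<lambda>k. H2 (k, m)) has_sum G m) UNIV" for m
    proof -
      define x where "x = (\<lambda>i. i * q * q powi (2 * (- m)))"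
      define T where "T = (\<lambda>i k. (-1) powi k * q powi (k * (k + 1)) / (1 - x i * q powi (2 * k)))"
      have xq: "x i * q powi (2 * k) = i * q powi (2 * (k - m) + 1)" for i k
      proof -
        have "q powi 1 * q powi (2 * (- m)) * q powi (2 * k) = q powi (2 * (k - m) + 1)"
          unfolding pa[symmetric] by (rule arg_cong[of _ _ "(powi) q"]) simp
        thus ?thesis
          by (simp add: x_def mult_ac)
      qed
      have T: "(T i has_sum C * ((-1) powi m * q powi (m\<^sup>2) * inverse (i powi m))) UNIV"
        if i: "norm i = 1" "jtheta (i * q) (q\<^sup>2) = N" for i
      proof -
        have i0: "i \<noteq> 0"
          using i by auto
        have "x i \<noteq> 0"
          using i0 q0 by (simp add: x_def)
        moreover have "x i * q powi (2 * k) \<noteq> 1" for k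
        proof -
          have "2 * (k - m) + 1 \<noteq> 0"
            by presburger
          thus ?thesis
            unfolding xq using neq1 i by blast
        qed
        ultimately have "(T i has_sum (ff 2 q)\<^sup>2 / jtheta (x i) (q\<^sup>2)) UNIV"
          unfolding T_def ff_def by (intro theta_partial_fraction q q0)
        moreover have "jtheta (x i) (q\<^sup>2) = (-1) powi (- m) * (i powi m * inverse (q powi (m\<^sup>2))) * N"
        proof -
          have j1: "jtheta (x i) (q\<^sup>2) = (-1) powi (- m) * (i * q) powi (- (- m)) * q powi (- (- m * (- m - 1))) * N"
            unfolding x_def using jtheta_quasi_period[OF q q0, of "i * q" "- m"] i i0 q0 by simp
          have j2: "q powi m * q powi (- (- m * (- m - 1))) = q powi (- (m\<^sup>2))"
            unfolding pa[symmetric] by (rule arg_cong[of _ _ "(powi) q"]) (simp add: algebra_simps power2_eq_square)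
          have j3: "(i * q) powi (- (- m)) = i powi m * q powi m"
            by (simp add: power_int_mult_distrib)
          have "jtheta (x i) (q\<^sup>2) = (-1) powi (- m) * (i powi m * (q powi m * q powi (- (- m * (- m - 1))))) * N"
            unfolding j1 j3 by (simp only: mult.assoc)
          thus ?thesis
            unfolding j2 by (simp only: power_int_minus[of q])
        qed
        moreover have "inverse ((-1 :: complex) powi (- m)) = (-1) powi m"
          by (simp add: power_int_minus)
        ultimately show ?thesis
          by (simp add: C_def divide_inverse mult_ac)
      qed
      have H2_eq: "H2 (k, m) = b m * ((1 - \<i> * q powi (2 * m)) / 2 * T \<i> k + (1 + \<i> * q powi (2 * m)) / 2 * T (- \<i>) k)" for k
      proof -
        define v where "v = q powi (2 * (k - m) + 1)"
        define y where "y = q powi (2 * m)"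
        have 1: "q powi (2 * k + 1) = v * y"
          unfolding v_def y_def pa[symmetric] by (rule arg_cong[of _ _ "(powi) q"]) simp
        have 2: "q powi (4 * (k - m) + 2) = v\<^sup>2"
          unfolding v_def powi_power by (rule arg_cong[of _ _ "(powi) q"]) simp
        have "2 * (k - m) + 1 \<noteq> 0"
          by presburger
        hence nz: "1 - \<i> * v \<noteq> 0" "1 + \<i> * v \<noteq> 0"
          using neq1[of "\<i>" "2 * (k - m) + 1"] neq1[of "- \<i>" "2 * (k - m) + 1"]
          by (auto simp: v_def minus_equation_iff add_eq_0_iff)
        have nz2: "2 + \<i> * (v * 2) \<noteq> 0"
        proof -
          have "2 + \<i> * (v * 2) = 2 * (1 + \<i> * v)"
            by simp
          thus ?thesis
            using nz(2) by (simp only: mult_eq_0_iff) simp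
        qed
        have v2: "1 + v\<^sup>2 = (1 - \<i> * v) * (1 + \<i> * v)"
          by (simp add: algebra_simps power2_eq_square)
        have frac: "(1 + v * y) / (1 + v\<^sup>2) = (1 - \<i> * y) / 2 * (1 / (1 - \<i> * v)) + (1 + \<i> * y) / 2 * (1 / (1 - - \<i> * v))"
          unfolding v2 using nz nz2 by (simp add: divide_simps) (simp add: algebra_simps)
        have expand: "B * (S * (\<alpha> * (1 / D) + \<beta> * (1 / E))) = B * (\<alpha> * (S / D) + \<beta> * (S / E))" for B S \<alpha> \<beta> D E :: complex
          by (simp add: divide_inverse algebra_simps)
        have "H2 (k, m) = b m * ((-1) powi k * q powi (k * (k + 1)) * ((1 + v * y) / (1 + v\<^sup>2)))"
          unfolding H2_def prod.case a'_def 1 2 by simp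
        also have "\<dots> = b m * ((1 - \<i> * y) / 2 * T \<i> k + (1 + \<i> * y) / 2 * T (- \<i>) k)"
          unfolding frac T_def xq v_def[symmetric] by (rule expand)
        finally show ?thesis
          by (simp only: y_def)
      qed
      have "((\<lambda>k. b m * ((1 - \<i> * q powi (2 * m)) / 2 * T \<i> k + (1 + \<i> * q powi (2 * m)) / 2 * T (- \<i>) k)) has_sum
          b m * ((1 - \<i> * q powi (2 * m)) / 2 * (C * ((-1) powi m * q powi (m\<^sup>2) * inverse (\<i> powi m)))
            + (1 + \<i> * q powi (2 * m)) / 2 * (C * ((-1) powi m * q powi (m\<^sup>2) * inverse ((- \<i>) powi m))))) UNIV"
        by (intro has_sum_cmult_right has_sum_add T) (simp_all only: N_def'(1,2)[symmetric] norm_ii norm_minus_cancel)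
      also have "b m * ((1 - \<i> * q powi (2 * m)) / 2 * (C * ((-1) powi m * q powi (m\<^sup>2) * inverse (\<i> powi m)))
            + (1 + \<i> * q powi (2 * m)) / 2 * (C * ((-1) powi m * q powi (m\<^sup>2) * inverse ((- \<i>) powi m)))) = G m"
        by (simp only: G_def e_def distrib_left mult_ac)
      finally show ?thesis
        by (simp only: H2_eq)
    qed
    \<comment> \<open>The pairs are swapped so that the inner summation runs over
      \<open>k\<close>.\<close>
    have swapped: "((\<lambda>mk. H2 (prod.swap mk)) has_sum infsum H2 (UNIV \<times> UNIV)) (UNIV \<times> UNIV)"
      using has_sum_infsum[OF H2]
      by (subst has_sum_reindex_bij_witness[of _ prod.swap prod.swap "UNIV \<times> UNIV" H2]) auto
    have G: "(G has_sum infsum H2 (UNIV \<times> UNIV)) UNIV"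
      by (rule has_sum_Sigma'[OF swapped]) (use inner in simp)
    have sgn_even: "(-1 :: complex) powi (2 * M) = 1" for M
      by (simp add: power_int_mult)
    have i_even: "\<i> powi (2 * M) = (-1) powi M" "(- \<i>) powi (2 * M) = (-1) powi M" for M
      by (simp_all add: power_int_mult)
    have inv_sgn: "inverse ((-1 :: complex) powi M) = (-1) powi M" for M
      by (simp add: power_int_minus_left)
    \<comment> \<open>For \<open>m = 2 * M\<close> the weight \<open>e\<close> is just a sign, and
      the exponents add up to \<open>4 * (3 * M^2 + M)\<close>: this is the series of
      \<open>f\<close> with \<open>q ^ 4\<close> as base.\<close>
    have sum_even: "((\<lambda>M. G (2 * M + 0)) has_sum C * (ff 8 q * mock_f (q ^ 8) / 2)) UNIV"
    proof -
      have "e (2 * M) = (-1) powi M" for M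
        unfolding e_def i_even inv_sgn by (simp add: field_simps)
      moreover have "q powi (2 * (2 * M) * (2 * M + 1)) * q powi ((2 * M)\<^sup>2) = (q ^ 4) powi (3 * M\<^sup>2 + M)" for M
        unfolding q4q pa[symmetric] by (rule arg_cong[of _ _ "(powi) q"]) (simp add: algebra_simps power2_eq_square)
      ultimately have "G (2 * M + 0) = C * ((-1) powi M * (q ^ 4) powi (3 * M\<^sup>2 + M) / (1 + (q ^ 4) powi (2 * M)))" for M
        by (simp add: G_def b_def sgn_even q4q mult_ac)
      moreover have "((\<lambda>M. C * ((-1) powi M * (q ^ 4) powi (3 * M\<^sup>2 + M) / (1 + (q ^ 4) powi (2 * M)))) has_sum C * (ff 2 (q ^ 4) * mock_f ((q ^ 4)\<^sup>2) / 2)) UNIV"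
        by (intro has_sum_cmult_right mock_f_has_sum q4)
      moreover have "ff 2 (q ^ 4) = ff 8 q" "(q ^ 4)\<^sup>2 = q ^ 8"
        by (simp_all add: ff_power flip: power_mult)
      ultimately show ?thesis
        by (simp only:)
    qed
    \<comment> \<open>For \<open>m = 2 * M + 1\<close> a factor \<open>w / (1 + w)\<close> appears.
      Writing it as \<open>1 - 1 / (1 + w)\<close> leaves the series of \<open>omega(-q^4)\<close>
      and a signed triangular series with sum 0.\<close>
    have sum_odd: "((\<lambda>M. G (2 * M + 1)) has_sum C * (q ^ 3 * (ff 8 q * mock_omega (- (q ^ 4))))) UNIV"
    proof -
      define Z where "Z = (\<lambda>M. (-1 :: complex) powi M * (q ^ 4) powi (3 * M * (M + 1)))"
      have nzw: "- (q ^ 4) * (q ^ 4) powi (2 * M) \<noteq> 1" for M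
      proof -
        have "- (q ^ 4) * (q ^ 4) powi (2 * M) = - 1 * (q powi 4 * q powi (4 * (2 * M)))"
          by (simp add: q4q)
        also have "\<dots> = - 1 * q powi (4 + 4 * (2 * M))"
          by (simp only: pa)
        also have "\<dots> \<noteq> 1"
          by (rule neq1) (simp, presburger)
        finally show ?thesis .
      qed
      have e_odd: "e (2 * M + 1) = - ((-1) powi M * q powi (2 * (2 * M + 1)))" for M
      proof -
        have "\<i> powi (2 * M + 1) = (-1) powi M * \<i>" "(- \<i>) powi (2 * M + 1) = (-1) powi M * (- \<i>)"
          by (simp_all add: power_int_add i_even)
        thus ?thesis
          unfolding e_def by (simp add: inv_sgn field_simps)
      qed
      have "G (2 * M + 1) = C * (q ^ 3 * (Z M / (1 - (- (q ^ 4)) * (q ^ 4) powi (2 * M)) - Z M))" for M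
      proof -
        define w where "w = q powi (4 * (2 * M + 1))"
        define Y where "Y = (q ^ 4) powi (3 * M * (M + 1))"
        have w: "- (q ^ 4) * (q ^ 4) powi (2 * M) = - w"
        proof -
          have "q powi 4 * q powi (4 * (2 * M)) = w"
            unfolding w_def pa[symmetric] by (rule arg_cong[of _ _ "(powi) q"]) simp
          thus ?thesis
            by (simp add: q4q)
        qed
        have nz: "1 + w \<noteq> 0"
          using nzw[of M] unfolding w by (auto simp: add_eq_0_iff minus_equation_iff)
        have "q powi (2 * (2 * M + 1) * (2 * M + 1 + 1)) * (q powi ((2 * M + 1)\<^sup>2) * q powi (2 * (2 * M + 1))) = q powi 3 * q powi (4 * (3 * M * (M + 1))) * w"
          unfolding w_def pa[symmetric] by (rule arg_cong[of _ _ "(powi) q"]) (simp add: algebra_simps power2_eq_square)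
        hence E: "q powi (2 * (2 * M + 1) * (2 * M + 1 + 1)) * (q powi ((2 * M + 1)\<^sup>2) * q powi (2 * (2 * M + 1))) = q ^ 3 * Y * w"
          by (simp add: Y_def q4q)
        have s: "(-1 :: complex) powi (2 * M + 1) = -1"
          unfolding minus_one_powi_add sgn_even by simp
        have "G (2 * M + 1) = C * ((- 1 * - 1 * - 1) * (-1) powi M * (q powi (2 * (2 * M + 1) * (2 * M + 1 + 1)) * (q powi ((2 * M + 1)\<^sup>2) * q powi (2 * (2 * M + 1)))) / (1 + w))"
          unfolding G_def b_def e_odd s w_def[symmetric] by simp
        also have "\<dots> = C * (q ^ 3 * ((-1) powi M * Y / (1 - (- w)) - (-1) powi M * Y))"
          unfolding E using nz by (simp add: divide_simps) (simp add: algebra_simps)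
        finally show ?thesis
          unfolding w Z_def Y_def .
      qed
      moreover have "((\<lambda>M. C * (q ^ 3 * (Z M / (1 - (- (q ^ 4)) * (q ^ 4) powi (2 * M)) - Z M))) has_sum C * (q ^ 3 * (lerch3 (q ^ 4) (- (q ^ 4)) - 0))) UNIV"
        unfolding Z_def
        by (intro has_sum_cmult_right has_sum_diff lerch3_has_sum signed_triangular_has_sum_0 q4 nzw) (use q4 in auto)
      moreover have "lerch3 (q ^ 4) (- (q ^ 4)) - 0 = ff 8 q * mock_omega (- (q ^ 4))"
        using mock_omega_minus_lerch3[OF q4] by (simp add: ff_power)
      ultimately show ?thesis
        by (simp only:)
    qed
    have "infsum H2 (UNIV \<times> UNIV) = (\<Sum>j\<in>{0..<2}. \<Sum>\<^sub>\<infinity>M. G (2 * M + j))"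
      by (rule has_sum_unique[OF G has_sum_int_residues(2)[OF has_sum_imp_summable[OF G]]]) simp
    also have "{0..<2} = {0, 1 :: int}"
      by auto
    also have "(\<Sum>j\<in>{0, 1}. \<Sum>\<^sub>\<infinity>M. G (2 * M + j)) = (\<Sum>\<^sub>\<infinity>M. G (2 * M + 0)) + (\<Sum>\<^sub>\<infinity>M. G (2 * M + 1))"
      by simp
    also have "\<dots> = C * (ff 8 q * mock_f (q ^ 8) / 2) + C * (q ^ 3 * (ff 8 q * mock_omega (- (q ^ 4))))"
      unfolding infsumI[OF sum_even] infsumI[OF sum_odd] ..
    finally show ?thesis
      unfolding C_def by (simp only: distrib_left)
  qed

  have "(ff 2 q)\<^sup>2 / jtheta q (q\<^sup>2) * ((ff 4 q)\<^sup>2 / jtheta (-1) (q ^ 4)) = infsum H1 (UNIV \<times> UNIV) + infsum H2 (UNIV \<times> UNIV)"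
  proof -
    have "(\<lambda>(k, m). a k * b m) = (\<lambda>km. H1 km + H2 km)"
      using split by auto
    thus ?thesis
      unfolding total[symmetric] using infsum_add[OF H1 H2] by simp
  qed
  moreover have "N = (ff 4 q)\<^sup>2 / (ff 2 q * ff 8 q)"
  proof -
    have "ff 2 q = qpoch_inf (q\<^sup>2) (q ^ 4) * ff 4 q"
      using qpoch_inf_even_odd[of p p] p by (simp add: ff_def p_def flip: power_mult power_add)
    moreover have "ff 4 q = qpoch_inf (q ^ 4) (q ^ 8) * ff 8 q"
      using qpoch_inf_even_odd[of "q ^ 4" "q ^ 4"] q4 by (simp add: ff_def flip: power_mult power_add)
    moreover have "qpoch_inf (q\<^sup>2) (q ^ 4) * N = qpoch_inf (q ^ 4) (q ^ 8)"
      using qpoch_inf_mult_minus[of "q ^ 4" "q\<^sup>2"] q4 by (simp add: N_def flip: power_mult)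
    ultimately have "ff 2 q * ff 8 q * N = (ff 4 q)\<^sup>2"
      by (simp add: power2_eq_square mult_ac)
    thus ?thesis
      using ff_nonzero[OF q, of 2] ff_nonzero[OF q, of 8] by (simp add: field_simps)
  qed
  moreover have "jtheta (-1) (q ^ 4) = 2 * (ff 8 q / ff 4 q)\<^sup>2"
  proof -
    have "qpoch_inf (-1) (q ^ 4) = 2 * qpoch_inf (- (q ^ 4)) (q ^ 4)"
      using qpoch_inf_head[of "q ^ 4" "-1"] q4 by simp
    moreover have "ff 4 q * qpoch_inf (- (q ^ 4)) (q ^ 4) = ff 8 q"
      using qpoch_inf_mult_minus[of "q ^ 4" "q ^ 4"] q4 by (simp add: ff_def flip: power_mult)
    hence "qpoch_inf (- (q ^ 4)) (q ^ 4) = ff 8 q / ff 4 q"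
      using ff_nonzero[OF q, of 4] by (simp add: field_simps)
    ultimately show ?thesis
      by (simp add: jtheta_def power2_eq_square)
  qed
  ultimately have main: "(ff 2 q)\<^sup>2 / (ff 1 q / ff 2 q)\<^sup>2 * ((ff 4 q)\<^sup>2 / (2 * (ff 8 q / ff 4 q)\<^sup>2))
    = q * (ff 4 q)\<^sup>2 / ((ff 4 q)\<^sup>2 / (ff 2 q * ff 8 q))\<^sup>2 * (ff 2 q * mock_omega q)
      + (ff 2 q)\<^sup>2 / ((ff 4 q)\<^sup>2 / (ff 2 q * ff 8 q)) * (ff 8 q * mock_f (q ^ 8) / 2 + q ^ 3 * (ff 8 q * mock_omega (- (q ^ 4))))"
    unfolding part1 part2 jtheta_odd[OF q q0] mock_omega_lerch3[OF q q0] by simp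
  \<comment> \<open>The letters stand for \<open>f_2\<close>, \<open>f_4\<close>,
    \<open>f_1\<close>, \<open>f_8\<close> and the three mock theta values. Both sides of the
    hypothesis are \<open>A^3 * E^2 / (2 * B^2)\<close> times the sides of the conclusion.\<close>
  have alg: "X + 2 * q * Y + 2 * q ^ 3 * W = A * B ^ 6 / (D ^ 2 * E ^ 4)"
    if "A\<^sup>2 / (D / A)\<^sup>2 * (B\<^sup>2 / (2 * (E / B)\<^sup>2))
      = q * B\<^sup>2 / (B\<^sup>2 / (A * E))\<^sup>2 * (A * Y) + A\<^sup>2 / (B\<^sup>2 / (A * E)) * (E * X / 2 + q ^ 3 * (E * W))"
      and "A \<noteq> 0" "B \<noteq> 0" "D \<noteq> 0" "E \<noteq> 0" for A B D E X Y W :: complex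
  proof -
    have "A\<^sup>2 / (D / A)\<^sup>2 * (B\<^sup>2 / (2 * (E / B)\<^sup>2)) = A ^ 3 * E\<^sup>2 / (2 * B\<^sup>2) * (A * B ^ 6 / (D ^ 2 * E ^ 4))"
      using that(2-) by (simp add: divide_simps) (simp add: eval_nat_numeral algebra_simps)
    moreover have "q * B\<^sup>2 / (B\<^sup>2 / (A * E))\<^sup>2 * (A * Y) + A\<^sup>2 / (B\<^sup>2 / (A * E)) * (E * X / 2 + q ^ 3 * (E * W))
      = A ^ 3 * E\<^sup>2 / (2 * B\<^sup>2) * (X + 2 * q * Y + 2 * q ^ 3 * W)"
      using that(2-) by (simp add: divide_simps) (simp add: eval_nat_numeral algebra_simps)
    ultimately have "A ^ 3 * E\<^sup>2 / (2 * B\<^sup>2) * (X + 2 * q * Y + 2 * q ^ 3 * W) = A ^ 3 * E\<^sup>2 / (2 * B\<^sup>2) * (A * B ^ 6 / (D ^ 2 * E ^ 4))"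
      using that(1) by simp
    moreover have "A ^ 3 * E\<^sup>2 / (2 * B\<^sup>2) \<noteq> 0"
      using that(2-) by simp
    ultimately show ?thesis
      by (metis mult_left_cancel)
  qed
  show ?thesis
    by (rule alg[OF main]) (intro ff_nonzero q; simp)+
qed

section \<open>Dissections\<close>

lemma ff_minus: "even k \<Longrightarrow> ff k (- q) = ff k q"
  by (simp add: ff_def)

text \<open>Ramanujan's theta function phi, from the triple product at \<open>z = - q\<close>; the
  product value rests on \<open>(-q;q^2)_inf = f_2^2 / (f_1 f_4)\<close>.\<close>

lemma phi_has_sum:
  assumes "norm q < 1" "q \<noteq> 0"
  shows "((\<lambda>k. q powi (k\<^sup>2)) has_sum ff 2 q ^ 5 / (ff 1 q ^ 2 * ff 4 q ^ 2)) UNIV"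
proof -
  have q2: "norm (q\<^sup>2) < 1"
    using assms by (intro norm_power_less_1) auto
  note pa = power_int_add[OF disjI1[OF assms(2)]]
  note nz = ff_nonzero[OF assms(1), of 1] ff_nonzero[OF assms(1), of 2] ff_nonzero[OF assms(1), of 4]
  define M where "M = qpoch_inf (- q) (q\<^sup>2)"
  have "(-1) powi k * q powi (k * (k - 1)) * (- q) powi k = q powi (k\<^sup>2)" for k
  proof -
    have "(- q) powi k = (-1) powi k * q powi k"
      by (simp flip: power_int_mult_distrib)
    moreover have "(-1 :: complex) powi k * (-1) powi k = 1"
      by (simp flip: power_int_mult_distrib)
    moreover have "q powi (k\<^sup>2) = q powi (k * (k - 1)) * q powi k"
      unfolding pa[symmetric] by (simp add: power2_eq_square algebra_simps)
    ultimately show ?thesis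
      by (simp add: mult_ac)
  qed
  hence 1: "((\<lambda>k. q powi (k\<^sup>2)) has_sum ff 2 q * jtheta (- q) (q\<^sup>2)) UNIV"
    using triple_product[OF assms, of "- q"] assms(2) by (simp add: ff_def)
  have "q\<^sup>2 / (- q) = - q"
    using assms(2) by (simp add: power2_eq_square)
  hence 2: "jtheta (- q) (q\<^sup>2) = M\<^sup>2"
    by (simp add: jtheta_def M_def power2_eq_square)
  have e1: "ff 1 q = qpoch_inf q (q\<^sup>2) * ff 2 q"
    using qpoch_inf_even_odd[OF assms(1), of q] by (simp add: ff_def power2_eq_square)
  have e2: "ff 2 q = qpoch_inf (q\<^sup>2) (q ^ 4) * ff 4 q"
    using qpoch_inf_even_odd[OF q2, of "q\<^sup>2"] by (simp add: ff_def flip: power_mult power_add)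
  have e3: "qpoch_inf q (q\<^sup>2) * M = qpoch_inf (q\<^sup>2) (q ^ 4)"
    using qpoch_inf_mult_minus[OF q2, of q] by (simp add: M_def flip: power_mult)
  have "ff 1 q * ff 4 q * M = (qpoch_inf q (q\<^sup>2) * M) * ff 2 q * ff 4 q"
    unfolding e1 by simp
  also have "\<dots> = (qpoch_inf (q\<^sup>2) (q ^ 4) * ff 4 q) * ff 2 q"
    unfolding e3 by simp
  also have "\<dots> = ff 2 q ^ 2"
    unfolding e2[symmetric] by (simp add: power2_eq_square)
  finally have M: "M = ff 2 q ^ 2 / (ff 1 q * ff 4 q)"
    using nz by (simp add: field_simps)
  have "ff 2 q * jtheta (- q) (q\<^sup>2) = ff 2 q ^ 5 / (ff 1 q ^ 2 * ff 4 q ^ 2)"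
  proof -
    have "A * (A ^ 2 / (B * C)) ^ 2 = A ^ 5 / (B ^ 2 * C ^ 2)" for A B C :: complex
    proof -
      have "A * (A ^ 2) ^ 2 = A ^ 5"
        by (simp flip: power_mult power_Suc)
      thus ?thesis
        by (simp add: power_divide power_mult_distrib)
    qed
    thus ?thesis
      unfolding 2 M .
  qed
  with 1 show ?thesis
    by simp
qed

text \<open>The triple product at \<open>z = - (q^2)\<close>. This is \<open>2 psi(q^2)\<close> for
  Ramanujan's psi, since the indices \<open>k\<close> and \<open>- 1 - k\<close> contribute
  equally.\<close>

lemma psi_has_sum:
  assumes "norm q < 1" "q \<noteq> 0"
  shows "((\<lambda>k. q powi (k * (k + 1))) has_sum 2 * ff 4 q ^ 2 / ff 2 q) UNIV"
proof -
  have q2: "norm (q\<^sup>2) < 1"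
    using assms by (intro norm_power_less_1) auto
  note pa = power_int_add[OF disjI1[OF assms(2)]]
  have "(-1) powi k * q powi (k * (k - 1)) * (- (q\<^sup>2)) powi k = q powi (k * (k + 1))" for k
  proof -
    have "(- (q\<^sup>2)) powi k = (-1) powi k * (q\<^sup>2) powi k"
      by (simp flip: power_int_mult_distrib)
    moreover have "(-1 :: complex) powi k * (-1) powi k = 1"
      by (simp flip: power_int_mult_distrib)
    moreover have "q powi (k * (k + 1)) = q powi (k * (k - 1)) * (q\<^sup>2) powi k"
      unfolding powi_double[symmetric] pa[symmetric] by (simp add: algebra_simps)
    ultimately show ?thesis
      by (simp add: mult_ac)
  qed
  hence 1: "((\<lambda>k. q powi (k * (k + 1))) has_sum ff 2 q * jtheta (- (q\<^sup>2)) (q\<^sup>2)) UNIV"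
    using triple_product[OF assms, of "- (q\<^sup>2)"] assms(2) by (simp add: ff_def)
  define M where "M = qpoch_inf (- (q\<^sup>2)) (q\<^sup>2)"
  have "qpoch_inf (-1) (q\<^sup>2) = 2 * M"
    using qpoch_inf_head[OF q2, of "-1"] by (simp add: M_def)
  moreover have "q\<^sup>2 / - (q\<^sup>2) = -1"
    using assms(2) by simp
  ultimately have 2: "jtheta (- (q\<^sup>2)) (q\<^sup>2) = 2 * M\<^sup>2"
    by (simp add: jtheta_def M_def power2_eq_square)
  have "ff 2 q * M = ff 4 q"
    using qpoch_inf_mult_minus[OF q2, of "q\<^sup>2"] by (simp add: M_def ff_def flip: power_mult)
  hence "M = ff 4 q / ff 2 q"
    using ff_nonzero[OF assms(1), of 2] by (simp add: field_simps)
  hence "ff 2 q * jtheta (- (q\<^sup>2)) (q\<^sup>2) = 2 * ff 4 q ^ 2 / ff 2 q"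
    unfolding 2 by (simp add: power2_eq_square)
  with 1 show ?thesis
    by simp
qed

text \<open>The theta series \<open>\<Sum> q\<^bsup>k\<^sup>2\<^esup>\<close> is split into even and odd \<open>k\<close>.\<close>
lemma inverse_square_dissection:
  assumes "norm q < 1" "q \<noteq> 0"
  shows "1 / ff 1 q ^ 2 = ff 8 q ^ 5 / (ff 2 q ^ 5 * ff 16 q ^ 2)
    + 2 * q * (ff 4 q ^ 2 * ff 16 q ^ 2 / (ff 2 q ^ 5 * ff 8 q))"
proof -
  have q4: "norm (q ^ 4) < 1" "q ^ 4 \<noteq> 0"
    using assms by (auto intro!: norm_power_less_1)
  note pa = power_int_add[OF disjI1[OF assms(2)]]
  have q4q: "(q ^ 4) powi k = q powi (4 * k)" for k
    by (simp add: power_int_mult)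
  note phi = phi_has_sum[OF assms]
  have "((\<lambda>M. (q ^ 4) powi (M\<^sup>2)) has_sum ff 8 q ^ 5 / (ff 4 q ^ 2 * ff 16 q ^ 2)) UNIV"
    using phi_has_sum[OF q4] by (simp add: ff_power)
  moreover have "(q ^ 4) powi (M\<^sup>2) = q powi ((2 * M + 0)\<^sup>2)" for M
    unfolding q4q by (simp add: power_mult_distrib)
  ultimately have even: "((\<lambda>M. q powi ((2 * M + 0)\<^sup>2)) has_sum ff 8 q ^ 5 / (ff 4 q ^ 2 * ff 16 q ^ 2)) UNIV"
    by (simp only:)
  have "((\<lambda>M. q * (q ^ 4) powi (M * (M + 1))) has_sum q * (2 * ff 16 q ^ 2 / ff 8 q)) UNIV"
    using psi_has_sum[OF q4] by (intro has_sum_cmult_right) (simp add: ff_power)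
  moreover have "q * (q ^ 4) powi (M * (M + 1)) = q powi ((2 * M + 1)\<^sup>2)" for M
  proof -
    have "q powi 1 * q powi (4 * (M * (M + 1))) = q powi ((2 * M + 1)\<^sup>2)"
      unfolding pa[symmetric] by (rule arg_cong[of _ _ "(powi) q"]) (simp add: power2_eq_square algebra_simps)
    thus ?thesis
      unfolding q4q by simp
  qed
  ultimately have odd: "((\<lambda>M. q powi ((2 * M + 1)\<^sup>2)) has_sum q * (2 * ff 16 q ^ 2 / ff 8 q)) UNIV"
    by (simp only:)
  have "ff 2 q ^ 5 / (ff 1 q ^ 2 * ff 4 q ^ 2) = (\<Sum>j\<in>{0..<2}. \<Sum>\<^sub>\<infinity>M. q powi ((2 * M + j)\<^sup>2))"
    by (rule has_sum_unique[OF phi has_sum_int_residues(2)[OF has_sum_imp_summable[OF phi]]]) simp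
  also have "{0..<2} = {0, 1 :: int}"
    by auto
  also have "(\<Sum>j\<in>{0, 1}. \<Sum>\<^sub>\<infinity>M. q powi ((2 * M + j)\<^sup>2)) = (\<Sum>\<^sub>\<infinity>M. q powi ((2 * M + 0)\<^sup>2)) + (\<Sum>\<^sub>\<infinity>M. q powi ((2 * M + 1)\<^sup>2))"
    by simp
  also have "\<dots> = ff 8 q ^ 5 / (ff 4 q ^ 2 * ff 16 q ^ 2) + q * (2 * ff 16 q ^ 2 / ff 8 q)"
    unfolding infsumI[OF even] infsumI[OF odd] ..
  finally have main: "ff 2 q ^ 5 / (ff 1 q ^ 2 * ff 4 q ^ 2) = ff 8 q ^ 5 / (ff 4 q ^ 2 * ff 16 q ^ 2) + q * (2 * ff 16 q ^ 2 / ff 8 q)" .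
  have nz: "ff 2 q \<noteq> 0" "ff 4 q \<noteq> 0"
    by (rule ff_nonzero[OF assms(1)]; simp)+
  \<comment> \<open>The ratio of \<open>1 / f_1^2\<close> to phi is \<open>f_4^2 / f_2^5\<close>, an
    even function of \<open>q\<close>, so the splitting of phi carries over.\<close>
  have "1 / ff 1 q ^ 2 = (ff 4 q ^ 2 / ff 2 q ^ 5) * (ff 2 q ^ 5 / (ff 1 q ^ 2 * ff 4 q ^ 2))"
    using nz by simp
  also have "\<dots> = ff 8 q ^ 5 / (ff 2 q ^ 5 * ff 16 q ^ 2)
    + 2 * q * (ff 4 q ^ 2 * ff 16 q ^ 2 / (ff 2 q ^ 5 * ff 8 q))"
    unfolding main distrib_left using nz by simp
  finally show ?thesis .
qed

section \<open>Holomorphy of xi and its coefficients of given parity\<close>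

lemma norm_qpoch_ge:
  fixes a q :: complex and r :: real
  assumes "norm a \<le> r" "norm q \<le> r" "r < 1"
  shows "norm (qpoch (of_real r) (of_real r) n) \<le> norm (qpoch a q n)"
  unfolding qpoch_def prod_norm[symmetric]
proof (rule prod_mono, safe)
  fix k
  have r: "0 \<le> r"
    using assms(1) norm_ge_zero order_trans by blast
  \<comment> \<open>Every factor is bounded below by its value at the real point
    \<open>a = q = r\<close>. One real sequence thus controls all denominators on the closed disc of
    radius \<open>r\<close>.\<close>
  have le: "norm a * norm q ^ k \<le> r * r ^ k"
    using assms r by (intro mult_mono power_mono) auto
  have "r * r ^ k \<le> 1"
    using r assms power_le_one[of r "Suc k"] by simp
  moreover have "(1 - of_real r * of_real r ^ k :: complex) = of_real (1 - r * r ^ k)"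
    by simp
  ultimately have "norm (1 - of_real r * of_real r ^ k :: complex) = 1 - r * r ^ k"
    by (simp only: norm_of_real)
  also have "\<dots> \<le> 1 - norm (a * q ^ k)"
    using le by (simp add: norm_mult norm_power)
  also have "\<dots> \<le> norm (1 - a * q ^ k)"
    using norm_triangle_ineq2[of 1 "a * q ^ k"] by simp
  finally show "norm (1 - of_real r * of_real r ^ k :: complex) \<le> norm (1 - a * q ^ k)" .
qed simp

text \<open>Weierstrass M-test on closed discs inside the unit disc. Holomorphy is what makes the
  Taylor coefficients \<open>p_xi\<close> sum to xi on the whole disc.\<close>

lemma mock_xi_holomorphic: "mock_xi holomorphic_on ball 0 1"
proof -
  define t where "t = (\<lambda>m q. q ^ (6 * (Suc m)\<^sup>2 - 6 * Suc m + 1) / (qpoch q (q ^ 6) (Suc m) * qpoch (q ^ 5) (q ^ 6) (Suc m)))"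
  have bound: "\<exists>M. summable M \<and> (\<forall>m q. norm q \<le> r \<longrightarrow> norm (t m q) \<le> M m)"
    if r: "0 \<le> r" "r < 1" for r :: real
  proof -
    have "norm (of_real r :: complex) < 1"
      using r by simp
    from inverse_qpoch_bounded[OF this power_mult_neq_1[OF this this]]
    obtain K where K: "K > 0" "\<And>n. norm (inverse (qpoch (of_real r :: complex) (of_real r) n)) \<le> K"
      by metis
    have nzr: "qpoch (of_real r :: complex) (of_real r) n \<noteq> 0" for n
      using r by (intro qpoch_self_nonzero) simp
    have inv: "norm (inverse (qpoch a Q n)) \<le> K" if "norm a \<le> r" "norm Q \<le> r" for a Q n
    proof -
      have "inverse (norm (qpoch a Q n)) \<le> inverse (norm (qpoch (of_real r :: complex) (of_real r) n))"
        using norm_qpoch_ge[OF that r(2), of n] nzr[of n] by (intro le_imp_inverse_le) auto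
      thus ?thesis
        using K(2)[of n] by (simp add: norm_inverse)
    qed
    have "norm (t m q) \<le> r ^ m * (K * K)" if q: "norm q \<le> r" for m q
    proof -
      have pw: "norm (q ^ j) \<le> r" if "j > 0" for j
      proof -
        have "norm q ^ j \<le> norm q ^ 1"
          using that q r by (intro power_decreasing) auto
        thus ?thesis
          using q by (simp add: norm_power)
      qed
      have "norm q ^ (6 * (Suc m)\<^sup>2 - 6 * Suc m + 1) \<le> r ^ (6 * (Suc m)\<^sup>2 - 6 * Suc m + 1)"
        using q by (intro power_mono) auto
      also have "\<dots> \<le> r ^ m"
        using r by (intro power_decreasing) (auto simp: power2_eq_square)
      finally have "norm (q ^ (6 * (Suc m)\<^sup>2 - 6 * Suc m + 1)) \<le> r ^ m"
        by (simp only: norm_power)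
      moreover have "norm (t m q) = norm (q ^ (6 * (Suc m)\<^sup>2 - 6 * Suc m + 1)) *
          (norm (inverse (qpoch q (q ^ 6) (Suc m))) * norm (inverse (qpoch (q ^ 5) (q ^ 6) (Suc m))))"
        by (simp only: t_def norm_mult norm_divide norm_inverse divide_inverse inverse_mult_distrib)
      ultimately show ?thesis
        using q K(1) r by (simp only:) (intro mult_mono inv pw; simp)
    qed
    moreover have "summable (\<lambda>m. r ^ m * (K * K))"
      using r by (intro summable_mult2 summable_geometric) auto
    ultimately show ?thesis
      by blast
  qed
  have "(\<lambda>q. \<Sum>m. t m q) holomorphic_on ball 0 1"
  proof (rule holomorphic_uniform_sequence[where f = "\<lambda>n q. \<Sum>m<n. t m q"])
    fix n
    have "qpoch q (q ^ 6) m \<noteq> 0 \<and> qpoch (q ^ 5) (q ^ 6) m \<noteq> 0" if "q \<in> ball 0 1" for q :: complex and m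
      using that by (intro conjI qpoch_nonzero norm_power_less_1) auto
    thus "(\<lambda>q. \<Sum>m<n. t m q) holomorphic_on ball 0 1"
      unfolding t_def qpoch_def by (intro holomorphic_intros) auto
  next
    fix x :: complex assume x: "x \<in> ball 0 1"
    \<comment> \<open>Halfway between \<open>norm x\<close> and 1, so that the disc of radius
      \<open>d\<close> about \<open>x\<close> stays within radius \<open>r\<close>.\<close>
    define r where "r = (1 + norm x) / 2"
    have r: "0 \<le> r" "r < 1"
      using x by (auto simp: r_def)
    obtain M where M: "summable M" "\<And>m q. norm q \<le> r \<Longrightarrow> norm (t m q) \<le> M m"
      using bound[OF r] by blast
    define d where "d = (1 - norm x) / 2"
    have le: "norm q \<le> r" if "q \<in> cball x d" for q
    proof -
      have "norm q \<le> norm x + norm (q - x)"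
        using norm_triangle_ineq[of x "q - x"] by simp
      also have "norm (q - x) \<le> d"
        using that by (simp add: dist_norm norm_minus_commute)
      finally show ?thesis
        by (simp add: r_def d_def field_simps)
    qed
    have "uniform_limit (cball x d) (\<lambda>n q. \<Sum>m<n. t m q) (\<lambda>q. \<Sum>m. t m q) sequentially"
      by (rule Weierstrass_m_test[OF _ M(1)]) (use M(2) le in blast)
    moreover have "cball x d \<subseteq> ball 0 1"
      using le r by force
    moreover have "d > 0"
      using x by (simp add: d_def)
    ultimately show "\<exists>d>0. cball x d \<subseteq> ball 0 1 \<and>
        uniform_limit (cball x d) (\<lambda>n q. \<Sum>m<n. t m q) (\<lambda>q. \<Sum>m. t m q) sequentially"
      by blast
  qed auto
  hence "(\<lambda>q. 1 + 2 * (\<Sum>m. t m q)) holomorphic_on ball 0 1"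
    by (intro holomorphic_intros)
  thus ?thesis
    by (simp add: mock_xi_def[abs_def] t_def Let_def)
qed

lemma p_xi_sums:
  assumes "norm q < 1"
  shows "(\<lambda>n. p_xi n * q ^ n) sums mock_xi q"
  using holomorphic_power_series[OF mock_xi_holomorphic, of q] assms
  by (simp add: p_xi_def fps_expansion_def)

lemma p_xi_even_sums:
  assumes "norm q < 1"
  shows "(\<lambda>n. p_xi (2 * n) * (q\<^sup>2) ^ n) sums ((mock_xi q + mock_xi (- q)) / 2)"
proof -
  define s where "s = (\<lambda>n. (p_xi n * q ^ n + p_xi n * (- q) ^ n) / 2)"
  have "s sums ((mock_xi q + mock_xi (- q)) / 2)"
    unfolding s_def using assms by (intro sums_divide sums_add p_xi_sums) auto
  moreover have "s n = 0" if "n \<notin> range (\<lambda>n. 2 * n)" for n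
  proof -
    have "odd n"
    proof
      assume "even n"
      then obtain j where "n = 2 * j"
        by (elim evenE)
      with that show False
        by blast
    qed
    thus ?thesis
      by (simp add: s_def)
  qed
  ultimately have "(\<lambda>n. s (2 * n)) sums ((mock_xi q + mock_xi (- q)) / 2)"
    using sums_mono_reindex[of "\<lambda>n. 2 * n" s] by (auto simp: strict_mono_def)
  moreover have "s (2 * n) = p_xi (2 * n) * (q\<^sup>2) ^ n" for n
    by (simp add: s_def power_mult)
  ultimately show ?thesis
    by (simp only:)
qed

text \<open>The odd part is multiplied by \<open>q\<close> so that its powers become those of
  \<open>q^2\<close> with exponent \<open>n + 1\<close>.\<close>

lemma p_xi_odd_sums:
  assumes "norm q < 1"
  shows "(\<lambda>n. p_xi (2 * n + 1) * (q\<^sup>2) ^ (n + 1)) sums (q * (mock_xi q - mock_xi (- q)) / 2)"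
proof -
  define s where "s = (\<lambda>n. (p_xi n * q ^ n - p_xi n * (- q) ^ n) / 2)"
  have "s sums ((mock_xi q - mock_xi (- q)) / 2)"
    unfolding s_def using assms by (intro sums_divide sums_diff p_xi_sums) auto
  moreover have "s n = 0" if "n \<notin> range (\<lambda>n. 2 * n + 1)" for n
  proof -
    have "even n"
    proof (rule ccontr)
      assume "odd n"
      then obtain j where "n = 2 * j + 1"
        by (elim oddE)
      with that show False
        by blast
    qed
    thus ?thesis
      by (simp add: s_def)
  qed
  ultimately have "(\<lambda>n. s (2 * n + 1)) sums ((mock_xi q - mock_xi (- q)) / 2)"
    using sums_mono_reindex[of "\<lambda>n. 2 * n + 1" s] by (auto simp: strict_mono_def)
  hence "(\<lambda>n. q * s (2 * n + 1)) sums (q * ((mock_xi q - mock_xi (- q)) / 2))"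
    by (rule sums_mult)
  moreover have "q * s (2 * n + 1) = p_xi (2 * n + 1) * (q\<^sup>2) ^ (n + 1)" for n
    by (simp add: s_def power_mult power2_eq_square)
  ultimately show ?thesis
    by (simp only: times_divide_eq_right)
qed

section \<open>Even and odd parts of omega and xi\<close>

lemma mock_omega_dissection:
  assumes "norm q < 1" "q \<noteq> 0"
  shows "mock_omega q + mock_omega (- q) = 2 * (ff 4 q ^ 8 * ff 16 q ^ 2 / (ff 2 q ^ 4 * ff 8 q ^ 5)) - 2 * q\<^sup>2 * mock_omega (- (q ^ 4))"
    and "q * (mock_omega q - mock_omega (- q)) = ff 4 q ^ 6 * ff 8 q / (ff 2 q ^ 4 * ff 16 q ^ 2) - mock_f (q ^ 8)"
proof -
  \<comment> \<open>\<open>U\<close> and \<open>2 * q * V\<close> are the even and odd parts of the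
    theta quotient in Watson's relation; \<open>U\<close> and \<open>V\<close> contain only
    \<open>f_k\<close> with even \<open>k\<close>.\<close>
  define U where "U = ff 4 q ^ 6 * ff 8 q / (ff 2 q ^ 4 * ff 16 q ^ 2)"
  define V where "V = ff 4 q ^ 8 * ff 16 q ^ 2 / (ff 2 q ^ 4 * ff 8 q ^ 5)"
  have nz: "ff k x \<noteq> 0" if "k > 0" "norm x = norm q" for k x
    using ff_nonzero that assms by simp
  have W: "mock_f (x ^ 8) + 2 * x * mock_omega x + 2 * x ^ 3 * mock_omega (- (x ^ 4)) = U + 2 * x * V"
    if x: "x = q \<or> x = - q" for x
  proof -
    have nx: "norm x < 1" "x \<noteq> 0" "norm x = norm q"
      using x assms by auto
    have eq: "ff 2 x = ff 2 q" "ff 4 x = ff 4 q" "ff 8 x = ff 8 q" "ff 16 x = ff 16 q"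
      using x by (auto simp: ff_minus)
    have "ff 2 x * ff 4 x ^ 6 / (ff 1 x ^ 2 * ff 8 x ^ 4) = ff 2 x * ff 4 x ^ 6 / ff 8 x ^ 4 * (1 / ff 1 x ^ 2)"
      by simp
    also have "\<dots> = U + 2 * x * V"
    proof -
      have "A * B ^ 6 / E ^ 4 * (E ^ 5 / (A ^ 5 * G\<^sup>2) + 2 * x * (B\<^sup>2 * G\<^sup>2 / (A ^ 5 * E)))
          = B ^ 6 * E / (A ^ 4 * G\<^sup>2) + 2 * x * (B ^ 8 * G\<^sup>2 / (A ^ 4 * E ^ 5))"
        if "A \<noteq> 0" "E \<noteq> 0" "G \<noteq> 0" for A B E G :: complex
      proof -
        have 1: "A * B ^ 6 / E ^ 4 * (E ^ 5 / (A ^ 5 * G\<^sup>2)) = B ^ 6 * E / (A ^ 4 * G\<^sup>2)"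
          and 2: "A * B ^ 6 / E ^ 4 * (B\<^sup>2 * G\<^sup>2 / (A ^ 5 * E)) = B ^ 8 * G\<^sup>2 / (A ^ 4 * E ^ 5)"
          using that by (simp_all add: divide_simps) (simp_all add: eval_nat_numeral)
        show ?thesis
          unfolding distrib_left mult.left_commute[of "A * B ^ 6 / E ^ 4" "2 * x"] 1 2 ..
      qed
      from this[of "ff 2 q" "ff 8 q" "ff 16 q" "ff 4 q"] show ?thesis
        unfolding inverse_square_dissection[OF nx(1,2)] eq U_def V_def using nz by simp
    qed
    finally show ?thesis
      using watson_relation[OF nx(1,2)] by simp
  qed
  have 1: "mock_f (q ^ 8) + 2 * q * mock_omega q + 2 * q ^ 3 * mock_omega (- (q ^ 4)) = U + 2 * q * V"
    by (rule W) simp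
  \<comment> \<open>The relation at \<open>- q\<close>: the values of \<open>f\<close> and of
    \<open>omega(-q^4)\<close> are unchanged while \<open>q\<close> and \<open>q ^ 3\<close> change
    sign. The sum and the difference of the two relations give the claims.\<close>
  have 2: "mock_f (q ^ 8) - 2 * q * mock_omega (- q) - 2 * q ^ 3 * mock_omega (- (q ^ 4)) = U - 2 * q * V"
    using W[of "- q"] by simp
  show "q * (mock_omega q - mock_omega (- q)) = U - mock_f (q ^ 8)"
  proof -
    have "2 * (q * (mock_omega q - mock_omega (- q))) = 2 * (U - mock_f (q ^ 8))"
      using arg_cong2[OF 1 2, of "(+)"] by (simp add: algebra_simps)
    thus ?thesis
      by (metis mult_left_cancel zero_neq_numeral)
  qed
  have "2 * q * (mock_omega q + mock_omega (- q)) = 2 * q * (2 * V - 2 * q\<^sup>2 * mock_omega (- (q ^ 4)))"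
    using arg_cong2[OF 1 2, of "(-)"] by (simp add: algebra_simps power2_eq_square power3_eq_cube)
  thus "mock_omega q + mock_omega (- q) = 2 * V - 2 * q\<^sup>2 * mock_omega (- (q ^ 4))"
    using assms(2) by simp
qed

text \<open>In \<open>mock_xi_omega\<close> the factor \<open>q^2\<close> is even, so the omega part
  is dissected by \<open>mock_omega_dissection\<close> at \<open>q ^ 3\<close>. The extra
  \<open>q\<close> in the odd part completes \<open>q^2\<close> to the factor \<open>q ^ 3\<close>
  which that dissection carries.\<close>

lemma mock_xi_dissection:
  assumes "norm q < 1" "q \<noteq> 0"
  shows "(mock_xi q + mock_xi (- q)) / 2 = q\<^sup>2 * (ff 12 q ^ 8 * ff 48 q ^ 2 / (ff 6 q ^ 4 * ff 24 q ^ 5))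
      - q ^ 8 * mock_omega (- (q ^ 12)) + ff 8 q ^ 5 / (ff 2 q * ff 6 q * ff 16 q ^ 2)"
    and "q * (mock_xi q - mock_xi (- q)) = ff 12 q ^ 6 * ff 24 q / (ff 6 q ^ 4 * ff 48 q ^ 2) - mock_f (q ^ 24)
      + 4 * q\<^sup>2 * (ff 4 q ^ 2 * ff 16 q ^ 2 / (ff 2 q * ff 6 q * ff 8 q))"
proof -
  have q3: "norm (q ^ 3) < 1" "q ^ 3 \<noteq> 0"
    using assms by (auto intro!: norm_power_less_1)
  define U where "U = ff 8 q ^ 5 / (ff 2 q * ff 6 q * ff 16 q ^ 2)"
  define V where "V = ff 4 q ^ 2 * ff 16 q ^ 2 / (ff 2 q * ff 6 q * ff 8 q)"
  have nz: "ff 2 q \<noteq> 0"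
    using assms by (intro ff_nonzero) auto
  have X: "mock_xi x = x\<^sup>2 * mock_omega (x ^ 3) + (U + 2 * x * V)" if x: "x = q \<or> x = - q" for x
  proof -
    have nx: "norm x < 1" "x \<noteq> 0"
      using x assms by auto
    have eq: "ff 2 x = ff 2 q" "ff 4 x = ff 4 q" "ff 6 x = ff 6 q" "ff 8 x = ff 8 q" "ff 16 x = ff 16 q"
      using x by (auto simp: ff_minus)
    have "ff 2 x ^ 4 / (ff 1 x ^ 2 * ff 6 x) = ff 2 x ^ 4 / ff 6 x * (1 / ff 1 x ^ 2)"
      by simp
    also have "\<dots> = U + 2 * x * V"
    proof -
      have "A ^ 4 / B * (C ^ 5 / (A ^ 5 * D\<^sup>2) + 2 * x * (E\<^sup>2 * D\<^sup>2 / (A ^ 5 * C)))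
          = C ^ 5 / (A * B * D\<^sup>2) + 2 * x * (E\<^sup>2 * D\<^sup>2 / (A * B * C))" if "A \<noteq> 0" for A B C D E :: complex
      proof -
        have A5: "A ^ 5 = A * A ^ 4"
          by (simp add: eval_nat_numeral)
        have 1: "A ^ 4 / B * (C ^ 5 / (A ^ 5 * D\<^sup>2)) = C ^ 5 / (A * B * D\<^sup>2)"
          and 2: "A ^ 4 / B * (E\<^sup>2 * D\<^sup>2 / (A ^ 5 * C)) = E\<^sup>2 * D\<^sup>2 / (A * B * C)"
          unfolding A5 using that by (simp_all add: divide_simps)
        show ?thesis
          unfolding distrib_left mult.left_commute[of "A ^ 4 / B" "2 * x"] 1 2 ..
      qed
      from this[OF nz] show ?thesis
        unfolding inverse_square_dissection[OF nx] eq U_def V_def .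
    qed
    finally show ?thesis
      using mock_xi_omega[OF nx] by simp
  qed
  have 1: "mock_xi q = q\<^sup>2 * mock_omega (q ^ 3) + (U + 2 * q * V)"
    by (rule X) simp
  have 2: "mock_xi (- q) = q\<^sup>2 * mock_omega (- (q ^ 3)) + (U - 2 * q * V)"
    using X[of "- q"] by simp
  have pw: "(q ^ 3) ^ 4 = q ^ 12" "(q ^ 3) ^ 8 = q ^ 24" "q\<^sup>2 * (q ^ 3)\<^sup>2 = q ^ 8"
    by (simp_all flip: power_mult power_add)
  have "(mock_xi q + mock_xi (- q)) / 2 = q\<^sup>2 * ((mock_omega (q ^ 3) + mock_omega (- (q ^ 3))) / 2) + U"
    unfolding 1 2 by (simp add: field_simps)
  also have "(mock_omega (q ^ 3) + mock_omega (- (q ^ 3))) / 2 = ff 12 q ^ 8 * ff 48 q ^ 2 / (ff 6 q ^ 4 * ff 24 q ^ 5) - (q ^ 3)\<^sup>2 * mock_omega (- (q ^ 12))"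
    unfolding mock_omega_dissection(1)[OF q3] pw by (simp add: ff_power diff_divide_distrib)
  finally show "(mock_xi q + mock_xi (- q)) / 2 = q\<^sup>2 * (ff 12 q ^ 8 * ff 48 q ^ 2 / (ff 6 q ^ 4 * ff 24 q ^ 5))
      - q ^ 8 * mock_omega (- (q ^ 12)) + U"
    unfolding right_diff_distrib mult.assoc[symmetric] pw .
  have "q * (mock_xi q - mock_xi (- q)) = q ^ 3 * (mock_omega (q ^ 3) - mock_omega (- (q ^ 3))) + 4 * q\<^sup>2 * V"
    unfolding 1 2 by (simp add: algebra_simps power2_eq_square power3_eq_cube)
  also have "q ^ 3 * (mock_omega (q ^ 3) - mock_omega (- (q ^ 3))) = ff 12 q ^ 6 * ff 24 q / (ff 6 q ^ 4 * ff 48 q ^ 2) - mock_f (q ^ 24)"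
    unfolding mock_omega_dissection(2)[OF q3] pw by (simp add: ff_power)
  finally show "q * (mock_xi q - mock_xi (- q)) = ff 12 q ^ 6 * ff 24 q / (ff 6 q ^ 4 * ff 48 q ^ 2) - mock_f (q ^ 24)
      + 4 * q\<^sup>2 * V" .
qed

section \<open>The value at zero and the passage to a square root\<close>

lemma ff_zero: "k > 0 \<Longrightarrow> ff k 0 = 1"
  by (simp add: ff_def qpoch_inf_def qpoch_def zero_power)

lemma mock_f_zero: "mock_f 0 = 1"
proof -
  have "(\<lambda>n. if n = 0 then 1 else 0) = (\<lambda>n. 0 ^ (n ^ 2) / (qpoch (- 0) 0 n) ^ 2 :: complex)"
    by (auto simp: power_0_left)
  thus ?thesis
    unfolding mock_f_def using sums_single[of 0 "\<lambda>_. 1 :: complex"] by (simp add: sums_iff)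
qed

lemma mock_xi_zero: "mock_xi 0 = 1"
  by (simp add: mock_xi_def Let_def)

theorem theorem3p1:
  fixes q :: complex
  assumes "norm q < 1"
  shows "(\<lambda>n. p_xi n * q ^ n) sums mock_xi q
    \<and> (summable (\<lambda>n. p_xi (2 * n + 1) * q ^ (n + 1))
       \<and> 2 * (\<Sum>n. p_xi (2 * n + 1) * q ^ (n + 1)) =
           ff 6 q ^ 6 * ff 12 q / (ff 3 q ^ 4 * ff 24 q ^ 2)
           - mock_f (q ^ 12)
           + 4 * q * (ff 2 q ^ 2 * ff 8 q ^ 2 / (ff 1 q * ff 3 q * ff 4 q)))
    \<and> (summable (\<lambda>n. p_xi (2 * n) * q ^ n)
       \<and> (\<Sum>n. p_xi (2 * n) * q ^ n) =
           q * (ff 6 q ^ 8 * ff 24 q ^ 2 / (ff 3 q ^ 4 * ff 12 q ^ 5))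
           - q ^ 4 * mock_omega (- (q ^ 6))
           + ff 4 q ^ 5 / (ff 1 q * ff 3 q * ff 8 q ^ 2))"
proof -
  \<comment> \<open>The dissections give series in the square of their argument, so they are applied
    at a square root of \<open>q\<close>; this halves every index of \<open>ff\<close>.\<close>
  define w where "w = csqrt q"
  have w2: "w\<^sup>2 = q"
    by (simp add: w_def)
  have "(norm w)\<^sup>2 < 1"
    using assms w2 by (metis norm_power)
  hence w: "norm w < 1"
    by (simp add: power_less_one_iff)
  have odd: "(\<lambda>n. p_xi (2 * n + 1) * q ^ (n + 1)) sums (w * (mock_xi w - mock_xi (- w)) / 2)"
    using p_xi_odd_sums[OF w] unfolding w2 .
  have even: "(\<lambda>n. p_xi (2 * n) * q ^ n) sums ((mock_xi w + mock_xi (- w)) / 2)"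
    using p_xi_even_sums[OF w] unfolding w2 .
  have "w * (mock_xi w - mock_xi (- w)) =
           ff 6 q ^ 6 * ff 12 q / (ff 3 q ^ 4 * ff 24 q ^ 2)
           - mock_f (q ^ 12)
           + 4 * q * (ff 2 q ^ 2 * ff 8 q ^ 2 / (ff 1 q * ff 3 q * ff 4 q))
      \<and> (mock_xi w + mock_xi (- w)) / 2 =
           q * (ff 6 q ^ 8 * ff 24 q ^ 2 / (ff 3 q ^ 4 * ff 12 q ^ 5))
           - q ^ 4 * mock_omega (- (q ^ 6))
           + ff 4 q ^ 5 / (ff 1 q * ff 3 q * ff 8 q ^ 2)"
  \<comment> \<open>The dissections assume a nonzero argument, since bilateral series involve
    negative powers. At 0 the claims reduce to \<open>0 = 1 - 1\<close> and
    \<open>1 = 1\<close>.\<close>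
  proof (cases "q = 0")
    case True
    hence "w = 0"
      by (simp add: w_def)
    thus ?thesis
      using True by (simp add: ff_zero mock_f_zero mock_xi_zero)
  next
    case False
    hence "w \<noteq> 0"
      using w2 by auto
    note dis = mock_xi_dissection[OF w this]
    have "ff (2 * k) w = ff k q" for k
      unfolding w2[symmetric] ff_power ..
    from this[of 1] this[of 2] this[of 3] this[of 4] this[of 6] this[of 8] this[of 12] this[of 24]
    have ff: "ff 2 w = ff 1 q" "ff 4 w = ff 2 q" "ff 6 w = ff 3 q" "ff 8 w = ff 4 q" "ff 12 w = ff 6 q"
      "ff 16 w = ff 8 q" "ff 24 w = ff 12 q" "ff 48 w = ff 24 q"
      by simp_all
    have "w ^ 8 = q ^ 4" "w ^ 12 = q ^ 6" "w ^ 24 = q ^ 12"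
      unfolding w2[symmetric] by (simp_all flip: power_mult)
    thus ?thesis
      using dis unfolding ff w2 by (simp only:)
  qed
  moreover have "2 * (\<Sum>n. p_xi (2 * n + 1) * q ^ (n + 1)) = w * (mock_xi w - mock_xi (- w))"
    unfolding sums_unique[OF odd, symmetric] by simp
  ultimately show ?thesis
    unfolding sums_unique[OF even, symmetric]
    using p_xi_sums[OF assms] sums_summable[OF odd] sums_summable[OF even] by (simp only:)
qed

end
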